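(* Let $H$ be a compact Lie group and $G$ a Lie group. Then every Lie group homomorphism $\phi:H\to G$ admits only trivial deformations; that is, every deformation $(\phi_\varepsilon)_{\varepsilon\in I}$ of $\phi$ is trivial.
   Context: Lie groups are real and finite-dimensional; $I\subset\mathbb R$ is an open interval containing $0$. A deformation of $\phi$ is a family of Lie group homomorphisms $\phi_\varepsilon:H\to G$, $\varepsilon\in I$, smooth in the sense that $(\varepsilon,h)\mapsto\phi_\varepsilon(h)$ is smooth on $I\times H$, with $\phi_0=\phi$. The deformation is trivial if there exists a smooth curve $I\to G$, $\varepsilon\mapsto g_\varepsilon$, with $g_0=1$ and $\phi_\varepsilon(h)=g_\varepsilon\,\phi(h)\,g_\varepsilon^{-1}$ for all $h\in H$ and all $\varepsilon\in I$. *)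

theory Defs
  imports "HOL-Analysis.Analysis" "HOL-Algebra.Group"
begin

section \<open>Finite-dimensional model spaces\<close>

text \<open>
  Manifolds are modelled on an arbitrary finite-dimensional real normed space.  The class
  \<^class>\<open>euclidean_space\<close> is not general enough: its instances have dimension at least 1, so it
  would exclude the zero-dimensional (e.g. finite) Lie groups.  The Heine-Borel property holds in
  every finite-dimensional normed space; it is listed as a superclass only to make the
  corresponding topological facts available.
\<close>

class finite_dim_normed_vector = real_normed_vector + heine_borel +
  assumes finite_dimensional: "\<exists>B. finite B \<and> (\<forall>x. \<exists>c. x = (\<Sum>b\<in>B. scaleR (c b) b))"

lemma finite_dim_normed_vectorI:
  assumes "finite B" "span B = (UNIV :: 'a::real_vector set)"
  shows "\<exists>B :: 'a set. finite B \<and> (\<forall>x. \<exists>c. x = (\<Sum>b\<in>B. scaleR (c b) b))"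
proof (intro exI[of _ B] conjI allI assms(1))
  fix x
  have "x \<in> range (\<lambda>c. \<Sum>b\<in>B. scaleR (c b) b)"
    using assms span_finite[OF assms(1)] by simp
  then show "\<exists>c. x = (\<Sum>b\<in>B. scaleR (c b) b)"
    by blast
qed

lemma finite_spanning_set:
  "\<exists>B :: 'a::finite_dim_normed_vector set. finite B \<and> span B = UNIV"
proof -
  obtain B :: "'a set" where "finite B" "\<And>x. \<exists>c. x = (\<Sum>b\<in>B. c b *\<^sub>R b)"
    using finite_dimensional by metis
  then have "span B = UNIV"
    unfolding span_finite[OF \<open>finite B\<close>] by blast
  with \<open>finite B\<close> show ?thesis
    by blast
qed

instance euclidean_space \<subseteq> finite_dim_normed_vector
  by standard (rule finite_dim_normed_vectorI[OF finite_Basis span_Basis])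

instance prod :: (finite_dim_normed_vector, finite_dim_normed_vector) finite_dim_normed_vector
proof
  obtain B :: "'a set" where B: "finite B" "span B = UNIV"
    using finite_spanning_set by blast
  obtain C :: "'b set" where C: "finite C" "span C = UNIV"
    using finite_spanning_set by blast
  let ?f = "\<lambda>x::'a. (x, 0::'b)" and ?g = "\<lambda>y::'b. (0::'a, y)"
  let ?D = "?f ` B \<union> ?g ` C"
  have f: "linear ?f" and g: "linear ?g"
    by (auto intro!: linearI)
  have "span (?f ` B) = range ?f" "span (?g ` C) = range ?g"
    using linear_span_image[OF f, of B] linear_span_image[OF g, of C] B C by auto
  then have fg: "?f x \<in> span ?D" "?g y \<in> span ?D" for x y
    using span_mono[of "?f ` B" ?D] span_mono[of "?g ` C" ?D] by blast+
  have "(x, y) \<in> span ?D" for x y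
    using span_add[OF fg(1)[of x] fg(2)[of y]] by simp
  then have "span ?D = UNIV"
    by auto
  then show "\<exists>D :: ('a \<times> 'b) set. finite D \<and> (\<forall>x. \<exists>c. x = (\<Sum>b\<in>D. scaleR (c b) b))"
    using B(1) C(1) by (intro finite_dim_normed_vectorI) auto
qed

text \<open>A zero-dimensional instance: countable discrete groups are Lie groups modelled on it.\<close>

datatype point = Point

lemma point_eq: "(x :: point) = y"
  by (cases x; cases y) simp

instantiation point :: real_normed_vector
begin

definition zero_point :: point where "zero_point = Point"
definition plus_point :: "point \<Rightarrow> point \<Rightarrow> point" where "plus_point x y = Point"
definition minus_point :: "point \<Rightarrow> point \<Rightarrow> point" where "minus_point x y = Point"
definition uminus_point :: "point \<Rightarrow> point" where "uminus_point x = Point"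
definition scaleR_point :: "real \<Rightarrow> point \<Rightarrow> point" where "scaleR_point r x = Point"
definition norm_point :: "point \<Rightarrow> real" where "norm_point x = 0"
definition dist_point :: "point \<Rightarrow> point \<Rightarrow> real" where "dist_point x y = 0"
definition sgn_point :: "point \<Rightarrow> point" where "sgn_point x = Point"
definition uniformity_point :: "(point \<times> point) filter" where
  "uniformity_point = (INF e\<in>{0<..}. principal {(x, y). dist x y < e})"
definition open_point :: "point set \<Rightarrow> bool" where
  "open_point U \<longleftrightarrow> (\<forall>x\<in>U. eventually (\<lambda>(x', y). x' = x \<longrightarrow> y \<in> U) uniformity)"

instance
proof
  show "(uniformity :: (point \<times> point) filter) = (INF e\<in>{0<..}. principal {(x, y). dist x y < e})"
    by (rule uniformity_point_def)
  show "open U \<longleftrightarrow> (\<forall>x\<in>U. \<forall>\<^sub>F (x', y) in uniformity. x' = x \<longrightarrow> y \<in> U)" for U :: "point set"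
    by (rule open_point_def)
  show "norm x = 0 \<longleftrightarrow> x = 0" for x :: point
    using point_eq[of x 0] by (simp add: norm_point_def)
qed (rule point_eq | simp only: norm_point_def dist_point_def; simp)+

end

instance point :: finite_dim_normed_vector
proof
  fix f :: "nat \<Rightarrow> point"
  have "f \<circ> id = (\<lambda>_. Point)"
    by (rule ext) (rule point_eq)
  moreover have "strict_mono (id :: nat \<Rightarrow> nat)"
    by (simp add: strict_mono_def)
  ultimately show "\<exists>l r. strict_mono (r :: nat \<Rightarrow> nat) \<and> (f \<circ> r) \<longlonglongrightarrow> l"
    by (intro exI[of _ Point] exI[of _ id]) (simp only: tendsto_const simp_thms)
next
  show "\<exists>B :: point set. finite B \<and> (\<forall>x. \<exists>c. x = (\<Sum>b\<in>B. scaleR (c b) b))"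
    by (intro exI[of _ "{}"] conjI allI exI[of _ "\<lambda>_. 0"] point_eq finite.emptyI)
qed


section \<open>Smooth manifolds and smooth maps\<close>

text \<open>
  \<open>C_k_on k f S\<close> and \<open>smooth_on f S\<close> are only meant for open \<open>S\<close>: the derivative is the
  unrestricted Frechet derivative.  Since the domain is finite-dimensional, being of class
  \<open>C\<^sup>k\<close> may be tested on the directional derivatives.
\<close>

primrec C_k_on ::
  "nat \<Rightarrow> ('a::finite_dim_normed_vector \<Rightarrow> 'b::finite_dim_normed_vector) \<Rightarrow> 'a set \<Rightarrow> bool"
where
  "C_k_on 0 f S \<longleftrightarrow> continuous_on S f"
| "C_k_on (Suc k) f S \<longleftrightarrow>
     f differentiable_on S \<and> (\<forall>v. C_k_on k (\<lambda>x. frechet_derivative f (at x) v) S)"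

definition smooth_on ::
  "('a::finite_dim_normed_vector \<Rightarrow> 'b::finite_dim_normed_vector) \<Rightarrow> 'a set \<Rightarrow> bool"
where
  "smooth_on f S \<longleftrightarrow> (\<forall>k. C_k_on k f S)"

text \<open>
  A chart \<open>(U, a)\<close> consists of its domain and the coordinate map; the values of \<open>a\<close> outside \<open>U\<close>
  are irrelevant.  Atlases are not required to be maximal.
\<close>

type_synonym ('p, 'e) chart = "'p set \<times> ('p \<Rightarrow> 'e)"

record ('p, 'e) manifold =
  mtop :: "'p topology"
  atlas :: "('p, 'e) chart set"

definition is_chart :: "'p topology \<Rightarrow> ('p, 'e::finite_dim_normed_vector) chart \<Rightarrow> bool" where
  "is_chart X = (\<lambda>(U, a). openin X U \<and> open (a ` U) \<and>
     homeomorphic_map (subtopology X U) (top_of_set (a ` U)) a)"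

definition smooth_transition ::
  "('p, 'e::finite_dim_normed_vector) chart \<Rightarrow> ('p, 'e) chart \<Rightarrow> bool"
where
  "smooth_transition = (\<lambda>(U, a) (V, b). smooth_on (b \<circ> inv_into U a) (a ` (U \<inter> V)))"

definition smooth_manifold :: "('p, 'e::finite_dim_normed_vector) manifold \<Rightarrow> bool" where
  "smooth_manifold M \<longleftrightarrow>
     Hausdorff_space (mtop M) \<and> second_countable (mtop M) \<and>
     (\<forall>c \<in> atlas M. is_chart (mtop M) c) \<and>
     (\<Union>c \<in> atlas M. fst c) = topspace (mtop M) \<and>
     (\<forall>c \<in> atlas M. \<forall>d \<in> atlas M. smooth_transition c d)"

definition smooth_map ::
  "('p, 'e::finite_dim_normed_vector) manifold \<Rightarrow> ('q, 'f::finite_dim_normed_vector) manifold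
    \<Rightarrow> ('p \<Rightarrow> 'q) \<Rightarrow> bool"
where
  "smooth_map M N f \<longleftrightarrow> continuous_map (mtop M) (mtop N) f \<and>
     (\<forall>(U, a) \<in> atlas M. \<forall>(V, b) \<in> atlas N.
        smooth_on (b \<circ> f \<circ> inv_into U a) (a ` (U \<inter> f -` V)))"

definition prod_manifold ::
  "('p, 'e) manifold \<Rightarrow> ('q, 'f) manifold \<Rightarrow> ('p \<times> 'q, 'e \<times> 'f) manifold"
where
  "prod_manifold M N =
     \<lparr> mtop = prod_topology (mtop M) (mtop N),
       atlas = {(U \<times> V, map_prod a b) | U a V b. (U, a) \<in> atlas M \<and> (V, b) \<in> atlas N} \<rparr>"

definition open_submanifold :: "'e::finite_dim_normed_vector set \<Rightarrow> ('e, 'e) manifold" where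
  "open_submanifold S = \<lparr> mtop = top_of_set S, atlas = {(S, \<lambda>x. x)} \<rparr>"


section \<open>Lie groups and deformations of homomorphisms\<close>

locale lie_group = group G
  for G :: "('g, 'm) monoid_scheme" (structure)
    and M :: "('g, 'e::finite_dim_normed_vector) manifold" +
  assumes manifold: "smooth_manifold M"
    and topspace_eq_carrier: "topspace (mtop M) = carrier G"
    and smooth_mult: "smooth_map (prod_manifold M M) M (\<lambda>(x, y). x \<otimes> y)"
    and smooth_inv: "smooth_map M M (\<lambda>x. inv x)"

definition lie_group_hom ::
  "('h, 'm) monoid_scheme \<Rightarrow> ('h, 'd::finite_dim_normed_vector) manifold
    \<Rightarrow> ('g, 'n) monoid_scheme \<Rightarrow> ('g, 'e::finite_dim_normed_vector) manifold
    \<Rightarrow> ('h \<Rightarrow> 'g) \<Rightarrow> bool"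
where
  "lie_group_hom H MH G MG \<phi> \<longleftrightarrow> \<phi> \<in> hom H G \<and> smooth_map MH MG \<phi>"

text \<open>
  Groups have an explicit carrier, so the values of homomorphisms are only compared on the carrier.
\<close>

definition deformation ::
  "('h, 'm) monoid_scheme \<Rightarrow> ('h, 'd::finite_dim_normed_vector) manifold
    \<Rightarrow> ('g, 'n) monoid_scheme \<Rightarrow> ('g, 'e::finite_dim_normed_vector) manifold
    \<Rightarrow> ('h \<Rightarrow> 'g) \<Rightarrow> real set \<Rightarrow> (real \<Rightarrow> 'h \<Rightarrow> 'g) \<Rightarrow> bool"
where
  "deformation H MH G MG \<phi> I \<Phi> \<longleftrightarrow>
     (\<forall>\<epsilon>\<in>I. lie_group_hom H MH G MG (\<Phi> \<epsilon>)) \<and>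
     smooth_map (prod_manifold (open_submanifold I) MH) MG (\<lambda>(\<epsilon>, h). \<Phi> \<epsilon> h) \<and>
     (\<forall>h\<in>carrier H. \<Phi> 0 h = \<phi> h)"

definition trivial_deformation ::
  "('h, 'm) monoid_scheme
    \<Rightarrow> ('g, 'n) monoid_scheme \<Rightarrow> ('g, 'e::finite_dim_normed_vector) manifold
    \<Rightarrow> ('h \<Rightarrow> 'g) \<Rightarrow> real set \<Rightarrow> (real \<Rightarrow> 'h \<Rightarrow> 'g) \<Rightarrow> bool"
where
  "trivial_deformation H G MG \<phi> I \<Phi> \<longleftrightarrow>
     (\<exists>g. smooth_map (open_submanifold I) MG g \<and> g 0 = \<one>\<^bsub>G\<^esub> \<and>
        (\<forall>\<epsilon>\<in>I. \<forall>h\<in>carrier H. \<Phi> \<epsilon> h = g \<epsilon> \<otimes>\<^bsub>G\<^esub> \<phi> h \<otimes>\<^bsub>G\<^esub> inv\<^bsub>G\<^esub> (g \<epsilon>)))"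

end

theory Submission
  imports Defs
begin

text \<open>
  Differentiate the deformation in its parameter and translate the velocity back to the unit of
  \<open>G\<close>: this gives, for every \<open>t\<close>, the map \<open>c\<^sub>t(h) = d/ds \<Phi>\<^sub>s(h) \<Phi>\<^sub>t(h)\<^sup>-\<^sup>1\<close> (at \<open>s = t\<close>) from \<open>H\<close> to the
  Lie algebra of \<open>G\<close>.  Because every \<open>\<Phi>\<^sub>s\<close> is a homomorphism, \<open>c\<^sub>t\<close> is a cocycle for the adjoint
  action, \<open>c\<^sub>t(hk) = c\<^sub>t(h) + Ad(\<Phi>\<^sub>t(h)) c\<^sub>t(k)\<close>.  Averaging over \<open>k\<close> in the compact group \<open>H\<close> turns
  this into \<open>c\<^sub>t(h) = \<xi>\<^sub>t - Ad(\<Phi>\<^sub>t(h)) \<xi>\<^sub>t\<close>, where \<open>\<xi>\<^sub>t\<close> is the mean of \<open>c\<^sub>t\<close>: to first order the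
  deformation is a conjugation.  Now let \<open>g\<close> be the curve in \<open>G\<close> with \<open>g\<^sub>0 = 1\<close> and
  \<open>g' g\<^sup>-\<^sup>1 = \<xi>\<close>.  The curves \<open>\<Phi>\<^sub>t(h) g\<^sub>t\<close> and \<open>g\<^sub>t \<phi>(h)\<close> have the same logarithmic derivative, namely
  \<open>c\<^sub>t(h) + Ad(\<Phi>\<^sub>t(h)) \<xi>\<^sub>t = \<xi>\<^sub>t\<close>, and the same value at \<open>0\<close>; hence they coincide, which says that
  \<open>\<Phi>\<^sub>t(h) = g\<^sub>t \<phi>(h) g\<^sub>t\<^sup>-\<^sup>1\<close>.

  The argument rests on four ingredients.  The invariant mean on \<open>H\<close> is constructed for functions
  with values in a Banach space by von Neumann's method: averages over finitely many right
  translates can be made almost constant (\<open>right_averages_small_oscillation\<close>), and their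
  limits are unique because they can be compared with averages over left translates
  (\<open>right_averages_agree\<close>).  The mean may be differentiated under the averaging sign
  (\<open>has_vector_derivative_mean\<close>), so \<open>\<xi>\<close> is smooth.  The logarithmic derivative satisfies a product
  rule (\<open>dlog_mult\<close>) and determines a curve up to its initial value (\<open>dlog_unique\<close>).
  Finally, every smooth curve in the Lie algebra is the logarithmic derivative of a curve in the
  group: locally by the Picard-Lindeloef theorem (\<open>local_primitive\<close>) and globally because
  right translates of solutions are solutions (\<open>global_primitive\<close>).

  Tangent bundles are avoided.  The groups are only probed by smooth maps from open subsets of
  vector spaces, called plots below, and velocities are translated to the unit, where
  one chart identifies the Lie algebra with the model space.
\<close>

section \<open>Smooth maps between finite-dimensional spaces\<close>

instance finite_dim_normed_vector \<subseteq> banach ..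

text \<open>
  The norm is an arbitrary one, so continuity of the coordinates has to be derived from compactness:
  on the compact set of coefficient vectors with \<open>l\<^sup>1\<close>-norm \<open>1\<close>, the norm of the linear combination
  of a basis attains a minimum \<open>d\<close>, which is positive by linear independence.  By homogeneity the
  \<open>l\<^sup>1\<close>-norm of the coordinates of \<open>x\<close> is at most \<open>norm x / d\<close>.
\<close>
lemma bounded_coordinates:
  obtains B :: "'a::finite_dim_normed_vector set" and coord :: "'a \<Rightarrow> 'a \<Rightarrow> real"
  where "finite B" "\<And>b. b \<in> B \<Longrightarrow> bounded_linear (coord b)"
    "\<And>x. x = (\<Sum>b\<in>B. coord b x *\<^sub>R b)"
proof -
  obtain B0 :: "'a set" where B0: "finite B0" "span B0 = UNIV"
    using finite_spanning_set by blast
  obtain B where B: "B \<subseteq> B0" "independent B" "B0 \<subseteq> span B"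
    using maximal_independent_subset by blast
  have fin: "finite B"
    using B(1) B0(1) finite_subset by blast
  have span: "span B = UNIV"
    using B0(2) B(3) by (metis span_minimal subspace_span top.extremum_uniqueI)
  let ?X = "product_topology (\<lambda>_. euclideanreal) B"
  let ?K = "PiE B (\<lambda>_. {-1..1::real})"
  define S where "S = ?K \<inter> {c \<in> topspace ?X. (\<Sum>b\<in>B. \<bar>c b\<bar>) \<in> {1}}"
  have cont_l1: "continuous_map ?X euclideanreal (\<lambda>c. \<Sum>b\<in>B. \<bar>c b\<bar>)"
    by (intro continuous_map_sum fin continuous_map_real_abs continuous_map_product_projection)
  have "compactin ?X ?K"
    by (simp add: compactin_PiE)
  moreover have "closedin ?X {c \<in> topspace ?X. (\<Sum>b\<in>B. \<bar>c b\<bar>) \<in> {1}}"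
    by (intro closedin_continuous_map_preimage[OF cont_l1]) simp
  ultimately have comp: "compactin ?X S"
    unfolding S_def by (rule compact_Int_closedin)
  have cont: "continuous_map ?X euclideanreal (\<lambda>c. norm (\<Sum>b\<in>B. c b *\<^sub>R b))"
  proof -
    have "continuous_map ?X euclidean (\<lambda>c. \<Sum>b\<in>B. c b *\<^sub>R b)"
    proof (intro continuous_map_sum fin)
      fix b assume "b \<in> B"
      then have "continuous_map ?X euclideanreal (\<lambda>c. c b)"
        by (intro continuous_map_product_projection)
      moreover have "continuous_map euclideanreal euclidean (\<lambda>r. r *\<^sub>R b)"
        by (auto intro: continuous_intros)
      ultimately show "continuous_map ?X euclidean (\<lambda>c. c b *\<^sub>R b)"
        using continuous_map_compose[of ?X euclideanreal "\<lambda>c. c b" euclidean "\<lambda>r. r *\<^sub>R b"]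
        by (simp add: o_def)
    qed
    then show ?thesis
      using continuous_map_compose[of ?X euclidean _ euclideanreal norm]
      by (simp add: o_def continuous_on_norm_id)
  qed
  have "compact ((\<lambda>c. norm (\<Sum>b\<in>B. c b *\<^sub>R b)) ` S)"
    using image_compactin[OF comp cont] by simp
  moreover have nz: "norm (\<Sum>b\<in>B. c b *\<^sub>R b) > 0" if "c \<in> S" for c
  proof (rule ccontr)
    assume "\<not> ?thesis"
    then have "(\<Sum>b\<in>B. c b *\<^sub>R b) = 0" by simp
    then have "\<forall>b\<in>B. c b = 0"
      using B(2) fin by (auto simp: independent_explicit_finite_subsets)
    then have "(\<Sum>b\<in>B. \<bar>c b\<bar>) = 0" by simp
    then show False using that by (auto simp: S_def)
  qed
  obtain d where d: "d > 0" "\<And>c. c \<in> S \<Longrightarrow> d \<le> norm (\<Sum>b\<in>B. c b *\<^sub>R b)"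
  proof (cases "S = {}")
    case True
    then show ?thesis using that[of 1] by auto
  next
    case False
    then obtain m where "m \<in> S" "\<forall>c\<in>S. norm (\<Sum>b\<in>B. m b *\<^sub>R b) \<le> norm (\<Sum>b\<in>B. c b *\<^sub>R b)"
      using compact_attains_inf[OF \<open>compact ((\<lambda>c. norm (\<Sum>b\<in>B. c b *\<^sub>R b)) ` S)\<close>] by auto
    then show ?thesis
      using nz that by blast
  qed
  have est: "d * (\<Sum>b\<in>B. \<bar>c b\<bar>) \<le> norm (\<Sum>b\<in>B. c b *\<^sub>R b)" for c
  proof (cases "(\<Sum>b\<in>B. \<bar>c b\<bar>) = 0")
    case True
    then show ?thesis by simp
  next
    case False
    let ?n = "\<Sum>b\<in>B. \<bar>c b\<bar>"
    have n: "?n > 0"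
      using False by (simp add: sum_nonneg less_le)
    let ?c = "restrict (\<lambda>b. c b / ?n) B"
    have "\<bar>c b\<bar> \<le> ?n" if "b \<in> B" for b
      using fin that by (intro member_le_sum) auto
    then have "\<bar>c b / ?n\<bar> \<le> 1" if "b \<in> B" for b
      using n that by simp
    then have "?c \<in> ?K"
      unfolding PiE_iff abs_le_iff by (simp add: minus_le_iff)
    moreover have "(\<Sum>b\<in>B. \<bar>?c b\<bar>) = 1"
      using n by (simp add: sum_divide_distrib[symmetric])
    ultimately have "d \<le> norm (\<Sum>b\<in>B. ?c b *\<^sub>R b)"
      by (intro d(2)) (auto simp: S_def)
    also have "(\<Sum>b\<in>B. ?c b *\<^sub>R b) = (1 / ?n) *\<^sub>R (\<Sum>b\<in>B. c b *\<^sub>R b)"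
      by (simp add: scaleR_sum_right)
    finally show ?thesis
      using n by (simp add: field_simps)
  qed
  have rep: "x = (\<Sum>b\<in>B. representation B x b *\<^sub>R b)" for x
    using sum_representation_eq[OF B(2), of x B] fin span by simp
  have bl: "bounded_linear (\<lambda>x. representation B x b)" if "b \<in> B" for b
  proof (rule bounded_linear_intro[where K = "1 / d"])
    show "representation B (x + y) b = representation B x b + representation B y b" for x y
      using representation_add[OF B(2)] span by simp
    show "representation B (r *\<^sub>R x) b = r *\<^sub>R representation B x b" for r x
      using representation_scale[OF B(2)] span by simp
    show "norm (representation B x b) \<le> norm x * (1 / d)" for x
    proof -
      have "d * \<bar>representation B x b\<bar> \<le> d * (\<Sum>b\<in>B. \<bar>representation B x b\<bar>)"
        using fin that d(1) by (intro mult_left_mono member_le_sum) auto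
      also have "\<dots> \<le> norm x"
        using est[of "representation B x"] unfolding rep[of x, symmetric] .
      finally show ?thesis
        using d(1) by (simp add: field_simps)
    qed
  qed
  show ?thesis
    using that[OF fin bl rep] by blast
qed

lemma has_derivative_frechet_on:
  "f differentiable_on S \<Longrightarrow> open S \<Longrightarrow> x \<in> S
    \<Longrightarrow> (f has_derivative frechet_derivative f (at x)) (at x)"
  by (metis at_within_open differentiable_on_def frechet_derivative_works)

lemma C_k_on_cong:
  assumes "open S" "C_k_on k f S" "\<And>x. x \<in> S \<Longrightarrow> f x = g x"
  shows "C_k_on k g S"
  using assms(2,3)
proof (induction k arbitrary: f g)
  case 0
  then show ?case
    using continuous_on_cong[of S S f g] by simp
next
  case (Suc k)
  have D: "(g has_derivative frechet_derivative f (at x)) (at x)" if "x \<in> S" for x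
    using has_derivative_transform_within_open[OF has_derivative_frechet_on assms(1) that]
      Suc.prems assms(1) that by (metis C_k_on.simps(2))
  then have "g differentiable_on S"
    unfolding differentiable_on_def by (metis assms(1) at_within_open differentiable_def)
  moreover have "C_k_on k (\<lambda>x. frechet_derivative g (at x) v) S" for v
    by (rule Suc.IH[where f = "\<lambda>x. frechet_derivative f (at x) v"])
      (use Suc.prems frechet_derivative_at[OF D] in auto)
  ultimately show ?case by simp
qed

lemma C_k_on_SucI:
  assumes "open S" "\<And>x. x \<in> S \<Longrightarrow> (f has_derivative f' x) (at x)"
    and "\<And>v. C_k_on k (\<lambda>x. f' x v) S"
  shows "C_k_on (Suc k) f S"
proof -
  have "f differentiable_on S"
    using assms(1,2) unfolding differentiable_on_def
    by (metis at_within_open differentiable_def)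
  moreover have "C_k_on k (\<lambda>x. frechet_derivative f (at x) v) S" for v
    by (rule C_k_on_cong[OF assms(1) assms(3)[of v]])
      (use frechet_derivative_at[OF assms(2)] in auto)
  ultimately show ?thesis by simp
qed

lemma C_k_on_subset: "C_k_on k f S \<Longrightarrow> T \<subseteq> S \<Longrightarrow> C_k_on k f T"
  by (induction k arbitrary: f) (auto intro: continuous_on_subset differentiable_on_subset)

lemma C_k_on_imp_continuous_on: "C_k_on k f S \<Longrightarrow> continuous_on S f"
  by (cases k) (auto intro: differentiable_imp_continuous_on)

lemma C_k_on_Suc_imp: "C_k_on (Suc k) f S \<Longrightarrow> C_k_on k f S"
proof (induction k arbitrary: f)
  case 0
  then show ?case by (auto intro: differentiable_imp_continuous_on)
next
  case (Suc k)
  from Suc.prems have "f differentiable_on S"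
    and C: "C_k_on (Suc k) (\<lambda>x. frechet_derivative f (at x) v) S" for v
    by (simp_all only: C_k_on.simps(2)[of "Suc k"])
  then show ?case
    using Suc.IH[OF C] by simp
qed

text \<open>
  This reduces smoothness of a chart expression to a neighbourhood that is small enough to factor the
  map through further charts.
\<close>
lemma C_k_on_local:
  assumes "\<And>x. x \<in> S \<Longrightarrow> \<exists>T. open T \<and> x \<in> T \<and> T \<subseteq> S \<and> C_k_on k f T"
  shows "C_k_on k f S"
  using assms
proof (induction k arbitrary: f)
  case 0
  show ?case
    unfolding C_k_on.simps continuous_on_eq_continuous_within
  proof
    fix x assume "x \<in> S"
    then obtain T where "open T" "x \<in> T" "continuous_on T f"
      using 0[of x] by auto
    then show "continuous (at x within S) f"
      using continuous_at_imp_continuous_within continuous_on_eq_continuous_at by blast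
  qed
next
  case (Suc k)
  have "f differentiable_on S"
    unfolding differentiable_on_def
  proof
    fix x assume "x \<in> S"
    then obtain T where "open T" "x \<in> T" "f differentiable_on T"
      using Suc.prems[of x] by auto
    then have "f differentiable (at x)"
      unfolding differentiable_on_def using at_within_open[of x T] by fastforce
    then show "f differentiable at x within S"
      by (rule differentiable_at_withinI)
  qed
  moreover have "C_k_on k (\<lambda>x. frechet_derivative f (at x) v) S" for v
  proof (rule Suc.IH)
    fix x assume "x \<in> S"
    from Suc.prems[OF this] show "\<exists>T. open T \<and> x \<in> T \<and> T \<subseteq> S \<and>
        C_k_on k (\<lambda>x. frechet_derivative f (at x) v) T"
      unfolding C_k_on.simps by blast
  qed
  ultimately show ?case by simp
qed

lemma C_k_on_const: "open S \<Longrightarrow> C_k_on k (\<lambda>_. c) S"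
proof (induction k arbitrary: c)
  case (Suc k)
  show ?case
    by (rule C_k_on_SucI[where f' = "\<lambda>_ _. 0"]) (use Suc in auto)
qed simp

lemma C_k_on_bounded_linear:
  assumes "bounded_linear L" "open S" "C_k_on k f S"
  shows "C_k_on k (\<lambda>x. L (f x)) S"
  using assms(3)
proof (induction k arbitrary: f)
  case 0
  then show ?case
    using bounded_linear.continuous_on[OF assms(1)] by simp
next
  case (Suc k)
  show ?case
  proof (rule C_k_on_SucI[OF assms(2)])
    show "((\<lambda>x. L (f x)) has_derivative (\<lambda>v. L (frechet_derivative f (at x) v))) (at x)"
      if "x \<in> S" for x
      using Suc.prems assms(2) that
      by (intro bounded_linear.has_derivative[OF assms(1)] has_derivative_frechet_on) auto
    show "C_k_on k (\<lambda>x. L (frechet_derivative f (at x) v)) S" for v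
      by (rule Suc.IH) (use Suc.prems in auto)
  qed
qed

lemma C_k_on_id: "open S \<Longrightarrow> C_k_on k (\<lambda>x. x) S"
proof (cases k)
  case (Suc k)
  assume "open S"
  then show ?thesis unfolding Suc
    by (intro C_k_on_SucI[where f' = "\<lambda>_ v. v"]) (auto intro: C_k_on_const derivative_eq_intros)
qed (auto simp: continuous_on_id)

lemma C_k_on_Pair:
  assumes "open S" "C_k_on k f S" "C_k_on k g S"
  shows "C_k_on k (\<lambda>x. (f x, g x)) S"
  using assms(2,3)
proof (induction k arbitrary: f g)
  case 0
  then show ?case by (simp add: continuous_on_Pair)
next
  case (Suc k)
  show ?case
  proof (rule C_k_on_SucI[OF assms(1)])
    show "((\<lambda>x. (f x, g x)) has_derivative
        (\<lambda>v. (frechet_derivative f (at x) v, frechet_derivative g (at x) v))) (at x)"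
      if "x \<in> S" for x
      using Suc.prems assms(1) that
      by (intro has_derivative_Pair has_derivative_frechet_on) auto
  qed (use Suc in auto)
qed

lemma C_k_on_add:
  assumes "open S" "C_k_on k f S" "C_k_on k g S"
  shows "C_k_on k (\<lambda>x. f x + g x) S"
  using C_k_on_bounded_linear[OF _ assms(1) C_k_on_Pair[OF assms], of "\<lambda>p. fst p + snd p"]
  by (simp add: bounded_linear_add bounded_linear_fst bounded_linear_snd)

lemma C_k_on_sum:
  assumes "open S" "\<And>i. i \<in> A \<Longrightarrow> C_k_on k (f i) S"
  shows "C_k_on k (\<lambda>x. \<Sum>i\<in>A. f i x) S"
  using assms(2)
proof (induction A rule: infinite_finite_induct)
  case (insert i A)
  then show ?case by (simp add: C_k_on_add[OF assms(1)])
qed (auto simp: C_k_on_const assms(1))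

lemma C_k_on_scaleR:
  fixes r :: "'a::finite_dim_normed_vector \<Rightarrow> real"
  assumes "open S" "C_k_on k r S" "C_k_on k f S"
  shows "C_k_on k (\<lambda>x. r x *\<^sub>R f x) S"
  using assms(2,3)
proof (induction k arbitrary: r f)
  case 0
  then show ?case by (simp add: continuous_on_scaleR)
next
  case (Suc k)
  show ?case
  proof (rule C_k_on_SucI[OF assms(1)])
    show "((\<lambda>x. r x *\<^sub>R f x) has_derivative
        (\<lambda>v. r x *\<^sub>R frechet_derivative f (at x) v + frechet_derivative r (at x) v *\<^sub>R f x)) (at x)"
      if "x \<in> S" for x
      using Suc.prems assms(1) that
      by (intro has_derivative_scaleR has_derivative_frechet_on) auto
    show "C_k_on k (\<lambda>x. r x *\<^sub>R frechet_derivative f (at x) v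
        + frechet_derivative r (at x) v *\<^sub>R f x) S" for v
      using Suc.prems C_k_on_Suc_imp[OF Suc.prems(1)] C_k_on_Suc_imp[OF Suc.prems(2)]
      by (intro C_k_on_add Suc.IH assms(1)) auto
  qed
qed

text \<open>
  \<^const>\<open>C_k_on\<close> only controls the derivative of \<open>g\<close> in fixed directions, whereas the chain rule
  evaluates it in the moving direction \<open>Df(x)v\<close>.  Expanding this direction in a basis turns the
  derivative of the composition into a finite sum of products of functions that are known to be
  of class \<open>C\<^sup>k\<close>.
\<close>
lemma C_k_on_compose:
  fixes f :: "'a::finite_dim_normed_vector \<Rightarrow> 'b::finite_dim_normed_vector"
  assumes "open S" "open T" "f ` S \<subseteq> T" "C_k_on k f S" "C_k_on k g T"
  shows "C_k_on k (\<lambda>x. g (f x)) S"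
  using assms(4,5)
proof (induction k arbitrary: g)
  case 0
  then show ?case
    using assms(3) by (auto intro: continuous_on_compose2)
next
  case (Suc k)
  obtain B :: "'b set" and coord where B: "finite B" "\<And>b. b \<in> B \<Longrightarrow> bounded_linear (coord b)"
    "\<And>x. x = (\<Sum>b\<in>B. coord b x *\<^sub>R b)"
    using bounded_coordinates by blast
  let ?Dg = "\<lambda>y. frechet_derivative g (at y)" and ?Df = "\<lambda>x. frechet_derivative f (at x)"
  have Dg: "(g has_derivative ?Dg (f x)) (at (f x))" if "x \<in> S" for x
    using Suc.prems(2) assms(2,3) that by (intro has_derivative_frechet_on[where S = T]) auto
  show ?case
  proof (rule C_k_on_SucI[OF assms(1)])
    show "((\<lambda>x. g (f x)) has_derivative (\<lambda>v. \<Sum>b\<in>B. coord b (?Df x v) *\<^sub>R ?Dg (f x) b)) (at x)"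
      if "x \<in> S" for x
    proof -
      have "((\<lambda>x. g (f x)) has_derivative (\<lambda>v. ?Dg (f x) (?Df x v))) (at x)"
        using Suc.prems(1) assms(1) that
        by (intro has_derivative_compose[where f = f and g = g] has_derivative_frechet_on Dg) auto
      also have "(\<lambda>v. ?Dg (f x) (?Df x v)) = (\<lambda>v. \<Sum>b\<in>B. coord b (?Df x v) *\<^sub>R ?Dg (f x) b)"
      proof (rule ext)
        fix v
        let ?w = "?Df x v"
        have lin: "linear (?Dg (f x))"
          using Dg[OF that] has_derivative_linear by blast
        have "?Dg (f x) ?w = ?Dg (f x) (\<Sum>b\<in>B. coord b ?w *\<^sub>R b)"
          by (rule arg_cong[OF B(3)])
        also have "\<dots> = (\<Sum>b\<in>B. coord b ?w *\<^sub>R ?Dg (f x) b)"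
          by (simp only: linear_sum[OF lin] linear_scale[OF lin])
        finally show "?Dg (f x) ?w = (\<Sum>b\<in>B. coord b ?w *\<^sub>R ?Dg (f x) b)" .
      qed
      finally show ?thesis .
    qed
    show "C_k_on k (\<lambda>x. \<Sum>b\<in>B. coord b (?Df x v) *\<^sub>R ?Dg (f x) b) S" for v
    proof (intro C_k_on_sum C_k_on_scaleR assms(1))
      fix b assume b: "b \<in> B"
      show "C_k_on k (\<lambda>x. coord b (?Df x v)) S"
        by (rule C_k_on_bounded_linear[OF B(2)[OF b] assms(1)]) (use Suc.prems in auto)
      show "C_k_on k (\<lambda>x. ?Dg (f x) b) S"
        by (rule Suc.IH[where g = "\<lambda>y. ?Dg y b"])
          (use Suc.prems C_k_on_Suc_imp[OF Suc.prems(1)] in auto)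
    qed
  qed
qed

lemma smooth_on_cong:
  "open S \<Longrightarrow> smooth_on f S \<Longrightarrow> (\<And>x. x \<in> S \<Longrightarrow> f x = g x) \<Longrightarrow> smooth_on g S"
  unfolding smooth_on_def by (blast intro: C_k_on_cong)

lemma smooth_on_subset: "smooth_on f S \<Longrightarrow> T \<subseteq> S \<Longrightarrow> smooth_on f T"
  unfolding smooth_on_def by (blast intro: C_k_on_subset)

lemma smooth_on_local:
  "(\<And>x. x \<in> S \<Longrightarrow> \<exists>T. open T \<and> x \<in> T \<and> T \<subseteq> S \<and> smooth_on f T) \<Longrightarrow> smooth_on f S"
  unfolding smooth_on_def by (meson C_k_on_local)

lemma smooth_on_const: "open S \<Longrightarrow> smooth_on (\<lambda>_. c) S"
  unfolding smooth_on_def by (simp add: C_k_on_const)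

lemma smooth_on_id: "open S \<Longrightarrow> smooth_on (\<lambda>x. x) S"
  unfolding smooth_on_def by (simp add: C_k_on_id)

lemma smooth_on_bounded_linear:
  "bounded_linear L \<Longrightarrow> open S \<Longrightarrow> smooth_on f S \<Longrightarrow> smooth_on (\<lambda>x. L (f x)) S"
  unfolding smooth_on_def by (blast intro: C_k_on_bounded_linear)

lemma smooth_on_Pair:
  "open S \<Longrightarrow> smooth_on f S \<Longrightarrow> smooth_on g S \<Longrightarrow> smooth_on (\<lambda>x. (f x, g x)) S"
  unfolding smooth_on_def by (blast intro: C_k_on_Pair)

lemma smooth_on_add:
  "open S \<Longrightarrow> smooth_on f S \<Longrightarrow> smooth_on g S \<Longrightarrow> smooth_on (\<lambda>x. f x + g x) S"
  unfolding smooth_on_def by (blast intro: C_k_on_add)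

lemma smooth_on_scaleR:
  fixes r :: "'a::finite_dim_normed_vector \<Rightarrow> real"
  shows "open S \<Longrightarrow> smooth_on r S \<Longrightarrow> smooth_on f S \<Longrightarrow> smooth_on (\<lambda>x. r x *\<^sub>R f x) S"
  unfolding smooth_on_def by (blast intro: C_k_on_scaleR)

lemma smooth_on_compose:
  "open S \<Longrightarrow> open T \<Longrightarrow> f ` S \<subseteq> T \<Longrightarrow> smooth_on f S \<Longrightarrow> smooth_on g T
    \<Longrightarrow> smooth_on (\<lambda>x. g (f x)) S"
  unfolding smooth_on_def by (blast intro: C_k_on_compose)

lemma smooth_on_fst: "open S \<Longrightarrow> smooth_on f S \<Longrightarrow> smooth_on (\<lambda>x. fst (f x)) S"
  by (rule smooth_on_bounded_linear[OF bounded_linear_fst])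

lemma smooth_on_snd: "open S \<Longrightarrow> smooth_on f S \<Longrightarrow> smooth_on (\<lambda>x. snd (f x)) S"
  by (rule smooth_on_bounded_linear[OF bounded_linear_snd])

lemma smooth_on_imp_continuous_on: "smooth_on f S \<Longrightarrow> continuous_on S f"
  unfolding smooth_on_def using C_k_on_imp_continuous_on by blast

lemma smooth_on_has_derivative:
  "smooth_on f S \<Longrightarrow> open S \<Longrightarrow> x \<in> S
    \<Longrightarrow> (f has_derivative frechet_derivative f (at x)) (at x)"
  unfolding smooth_on_def by (metis C_k_on.simps(2) has_derivative_frechet_on)

lemma smooth_on_frechet_derivative:
  "smooth_on f S \<Longrightarrow> smooth_on (\<lambda>x. frechet_derivative f (at x) v) S"
  unfolding smooth_on_def by (metis C_k_on.simps(2))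

lemma C_k_on_Suc_realI:
  fixes f :: "real \<Rightarrow> 'b::finite_dim_normed_vector"
  assumes "open S" "\<And>x. x \<in> S \<Longrightarrow> (f has_vector_derivative f' x) (at x)" "C_k_on k f' S"
  shows "C_k_on (Suc k) f S"
proof (rule C_k_on_SucI[OF assms(1)])
  show "(f has_derivative (\<lambda>v. v *\<^sub>R f' x)) (at x)" if "x \<in> S" for x
    using assms(2)[OF that] by (simp add: has_vector_derivative_def)
qed (use assms in \<open>auto intro: C_k_on_scaleR C_k_on_const\<close>)

lemma smooth_on_has_vector_derivative:
  fixes f :: "real \<Rightarrow> 'e::finite_dim_normed_vector"
  assumes "smooth_on f S" "open S" "t \<in> S"
  shows "(f has_vector_derivative vector_derivative f (at t)) (at t)"
proof -
  have "f differentiable (at t)"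
    using smooth_on_has_derivative[OF assms] differentiable_def by blast
  then show ?thesis by (simp add: vector_derivative_works)
qed

lemma has_vector_derivative_compose_at:
  assumes "(f has_vector_derivative v) (at t)" "(g has_derivative D) (at (f t))"
  shows "((\<lambda>s. g (f s)) has_vector_derivative D v) (at t)"
  using vector_derivative_diff_chain_within[OF assms(1) has_derivative_at_withinI[OF assms(2)]]
  by (simp add: o_def)

section \<open>The invariant mean on a compact group\<close>

lemma norm_average_le:
  fixes g :: "'a \<Rightarrow> 'e::real_normed_vector"
  assumes "finite A" "A \<noteq> {}" "\<And>a. a \<in> A \<Longrightarrow> norm (g a - v) \<le> e"
  shows "norm ((1 / real (card A)) *\<^sub>R (\<Sum>a\<in>A. g a) - v) \<le> e"
proof -
  have n: "real (card A) > 0"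
    using assms by (simp add: card_gt_0_iff)
  have "(1 / real (card A)) *\<^sub>R (\<Sum>a\<in>A. g a) - v = (1 / real (card A)) *\<^sub>R (\<Sum>a\<in>A. g a - v)"
    using n by (simp add: sum_subtractf scaleR_diff_right sum_constant_scaleR)
  also have "norm \<dots> = (1 / real (card A)) * norm (\<Sum>a\<in>A. g a - v)"
    by simp
  also have "\<dots> \<le> (1 / real (card A)) * (real (card A) * e)"
    using assms(3) by (intro mult_left_mono sum_norm_bound) auto
  finally show ?thesis
    using n by simp
qed

lemma norm_sum_diff_le:
  fixes p q :: "'a \<Rightarrow> 'e::real_normed_vector"
  assumes "finite A" "finite B" "card A = card B" "\<And>a b. a \<in> A \<Longrightarrow> b \<in> B \<Longrightarrow> norm (p a - q b) \<le> d"
  shows "norm ((\<Sum>a\<in>A. p a) - (\<Sum>b\<in>B. q b)) \<le> real (card A) * d"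
proof -
  obtain \<pi> where \<pi>: "bij_betw \<pi> A B"
    using finite_same_card_bij assms by blast
  have "(\<Sum>a\<in>A. p a) - (\<Sum>b\<in>B. q b) = (\<Sum>a\<in>A. p a - q (\<pi> a))"
    by (simp add: sum_subtractf sum.reindex_bij_betw[OF \<pi>])
  also have "norm \<dots> \<le> real (card A) * d"
    using assms(4) bij_betwE[OF \<pi>] by (intro sum_norm_bound) auto
  finally show ?thesis .
qed

locale compact_topological_group = group H
  for H :: "('h, 'm) monoid_scheme" (structure) and X :: "'h topology" +
  assumes topspace_carrier: "topspace X = carrier H"
    and compact_space: "compact_space X"
    and continuous_mult: "continuous_map (prod_topology X X) X (\<lambda>(x, y). x \<otimes> y)"
    and continuous_inv: "continuous_map X X (\<lambda>x. inv x)"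
begin

definition right_average :: "'h set \<Rightarrow> ('h \<Rightarrow> 'e::real_vector) \<Rightarrow> 'h \<Rightarrow> 'e" where
  "right_average A f x = (1 / real (card A)) *\<^sub>R (\<Sum>a\<in>A. f (x \<otimes> a))"

definition left_average :: "'h set \<Rightarrow> ('h \<Rightarrow> 'e::real_vector) \<Rightarrow> 'h \<Rightarrow> 'e" where
  "left_average A f x = (1 / real (card A)) *\<^sub>R (\<Sum>a\<in>A. f (a \<otimes> x))"

text \<open>
  The operators are all iterations of averaging over finite sets of translates.  They are closed under
  composition, so one averaging can be refined by another without comparing the averaging sets.
\<close>
inductive_set right_averages :: "(('h \<Rightarrow> 'e::real_vector) \<Rightarrow> 'h \<Rightarrow> 'e) set" where
  id: "(\<lambda>f. f) \<in> right_averages"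
| step: "T \<in> right_averages \<Longrightarrow> finite A \<Longrightarrow> A \<noteq> {} \<Longrightarrow> A \<subseteq> carrier H
    \<Longrightarrow> (\<lambda>f. right_average A (T f)) \<in> right_averages"

inductive_set left_averages :: "(('h \<Rightarrow> 'e::real_vector) \<Rightarrow> 'h \<Rightarrow> 'e) set" where
  id: "(\<lambda>f. f) \<in> left_averages"
| step: "T \<in> left_averages \<Longrightarrow> finite A \<Longrightarrow> A \<noteq> {} \<Longrightarrow> A \<subseteq> carrier H
    \<Longrightarrow> (\<lambda>f. left_average A (T f)) \<in> left_averages"

lemma right_averages_near:
  assumes "T \<in> right_averages" "\<And>x. x \<in> carrier H \<Longrightarrow> norm (f x - v) \<le> e" "x \<in> carrier H"
  shows "norm (T f x - v) \<le> e"
  using assms(1,3)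
proof (induction arbitrary: x rule: right_averages.induct)
  case (step T A)
  then show ?case
    unfolding right_average_def by (intro norm_average_le) auto
qed (use assms(2) in simp)

lemma left_averages_near:
  assumes "T \<in> left_averages" "\<And>x. x \<in> carrier H \<Longrightarrow> norm (f x - v) \<le> e" "x \<in> carrier H"
  shows "norm (T f x - v) \<le> e"
  using assms(1,3)
proof (induction arbitrary: x rule: left_averages.induct)
  case (step T A)
  then show ?case
    unfolding left_average_def by (intro norm_average_le) auto
qed (use assms(2) in simp)

lemma right_averages_comp:
  assumes "S \<in> right_averages" "T \<in> right_averages"
  shows "(\<lambda>f. S (T f)) \<in> right_averages"
  using assms(1) by induction (auto intro: right_averages.step assms(2))

lemma right_averages_linear:
  assumes "linear L" "T \<in> right_averages"
  shows "T (\<lambda>x. L (f x)) = (\<lambda>x. L (T f x))"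
  using assms(2)
  by induction (auto simp: right_average_def linear_sum[OF assms(1)] linear_scale[OF assms(1)])

lemma right_averages_add:
  assumes "T \<in> right_averages"
  shows "T (\<lambda>x. f x + g x) = (\<lambda>x. T f x + T g x)"
  using assms
  by induction (auto simp: right_average_def sum.distrib scaleR_add_right)

lemma right_averages_left_translate:
  assumes "T \<in> right_averages" "h \<in> carrier H" "x \<in> carrier H"
  shows "T (\<lambda>x. f (h \<otimes> x)) x = T f (h \<otimes> x)"
  using assms(1,3)
proof (induction arbitrary: x rule: right_averages.induct)
  case (step T A)
  have "T (\<lambda>x. f (h \<otimes> x)) (x \<otimes> a) = T f (h \<otimes> x \<otimes> a)" if "a \<in> A" for a
    using step.IH[of "x \<otimes> a"] step that assms(2) by (auto simp: m_assoc subset_iff)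
  then show ?case by (simp add: right_average_def)
qed simp

lemma right_average_left_averages_commute:
  assumes "finite A" "A \<noteq> {}" "A \<subseteq> carrier H" "S \<in> left_averages" "x \<in> carrier H"
  shows "right_average A (S f) x = S (right_average A f) x"
  using assms(4,5)
proof (induction arbitrary: x rule: left_averages.induct)
  case (step T B)
  let ?n = "1 / real (card A)" and ?m = "1 / real (card B)"
  have "right_average A (left_average B (T f)) x
      = (\<Sum>a\<in>A. \<Sum>b\<in>B. (?n * ?m) *\<^sub>R T f (b \<otimes> (x \<otimes> a)))"
    by (simp add: right_average_def left_average_def scaleR_sum_right)
  also have "\<dots> = (\<Sum>b\<in>B. \<Sum>a\<in>A. (?m * ?n) *\<^sub>R T f (b \<otimes> x \<otimes> a))"
    using step.hyps step.prems assms(3)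
    by (subst sum.swap) (auto intro!: sum.cong simp: m_assoc mult.commute subset_iff)
  also have "\<dots> = (\<Sum>b\<in>B. ?m *\<^sub>R right_average A (T f) (b \<otimes> x))"
    by (simp add: right_average_def scaleR_sum_right)
  also have "\<dots> = (\<Sum>b\<in>B. ?m *\<^sub>R T (right_average A f) (b \<otimes> x))"
    using step.hyps step.prems by (intro sum.cong refl arg_cong[OF step.IH]) auto
  also have "\<dots> = left_average B (T (right_average A f)) x"
    by (simp add: left_average_def scaleR_sum_right)
  finally show ?case .
qed simp

text \<open>
  Translations from the left and translations from the right commute.  The two kinds of averages can
  therefore be played off against each other to show that the constants that they produce agree.
\<close>
lemma left_right_averages_commute:
  assumes "T \<in> right_averages" "S \<in> left_averages" "x \<in> carrier H"
  shows "T (S f) x = S (T f) x"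
  using assms(1,3)
proof (induction arbitrary: x rule: right_averages.induct)
  case (step T A)
  have "right_average A (T (S f)) x = right_average A (S (T f)) x"
    unfolding right_average_def using step by (intro arg_cong[of _ _ "scaleR _"] sum.cong) auto
  also have "\<dots> = S (right_average A (T f)) x"
    using step assms by (intro right_average_left_averages_commute) auto
  finally show ?case .
qed simp

text \<open>
  Inversion exchanges left and right translations, so that left averages inherit what is known about
  right averages.
\<close>
lemma left_averages_of_right:
  assumes "T \<in> right_averages"
  shows "\<exists>S\<in>left_averages. \<forall>f. \<forall>x\<in>carrier H. S f x = T (\<lambda>y. f (inv y)) (inv x)"
  using assms
proof induction
  case id
  show ?case by (rule bexI[OF _ left_averages.id]) simp
next
  case (step T A)
  then obtain S where S: "S \<in> left_averages"
    "\<And>f x. x \<in> carrier H \<Longrightarrow> S f x = T (\<lambda>y. f (inv y)) (inv x)"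
    by blast
  let ?B = "m_inv H ` A"
  have B: "finite ?B" "?B \<noteq> {}" "?B \<subseteq> carrier H"
    using step.hyps by auto
  have inj: "inj_on (m_inv H) A"
    using step.hyps by (meson inj_on_subset inv_inj)
  have "left_average ?B (S f) x = right_average A (T (\<lambda>y. f (inv y))) (inv x)"
    if x: "x \<in> carrier H" for f x
  proof -
    have "S f (inv a \<otimes> x) = T (\<lambda>y. f (inv y)) (inv x \<otimes> a)" if "a \<in> A" for a
      using S(2)[of "inv a \<otimes> x" f] x that step.hyps by (auto simp: inv_mult_group subset_iff)
    then show ?thesis
      by (simp add: left_average_def right_average_def card_image[OF inj] sum.reindex[OF inj])
  qed
  then show ?case
    using left_averages.step[OF S(1) B] by (intro bexI) auto
qed

text \<open>
  A Doeblin-type contraction estimate.  For all \<open>x\<close> and \<open>y\<close>, some summand \<open>f (x \<otimes> a)\<close> of the first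
  average and some summand \<open>f (y \<otimes> b)\<close> of the second one are evaluated in \<open>U\<close>, where \<open>f\<close> is almost
  constant.  Matching these two costs only \<open>2 * e\<close>, while the remaining summands are matched
  arbitrarily at a cost of the oscillation \<open>d\<close> each.
\<close>
lemma right_average_contracts:
  fixes f :: "'h \<Rightarrow> 'e::real_normed_vector"
  assumes A: "finite A" "A \<subseteq> carrier H"
    and hit: "\<And>x. x \<in> carrier H \<Longrightarrow> \<exists>a\<in>A. x \<otimes> a \<in> U"
    and near: "\<And>u. u \<in> U \<Longrightarrow> norm (f u - w) \<le> e"
    and osc: "\<And>x y. x \<in> carrier H \<Longrightarrow> y \<in> carrier H \<Longrightarrow> norm (f x - f y) \<le> d"
    and x: "x \<in> carrier H" and y: "y \<in> carrier H"
  shows "norm (right_average A f x - right_average A f y)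
    \<le> (2 * e + real (card A - 1) * d) / real (card A)"
proof -
  obtain a b where a: "a \<in> A" "x \<otimes> a \<in> U" and b: "b \<in> A" "y \<otimes> b \<in> U"
    using hit x y by blast
  let ?p = "\<lambda>a. f (x \<otimes> a)" and ?q = "\<lambda>a. f (y \<otimes> a)"
  have n: "real (card A) > 0"
    using A(1) a(1) by (auto simp: card_gt_0_iff)
  have "(\<Sum>a\<in>A. ?p a) - (\<Sum>a\<in>A. ?q a)
      = (?p a - ?q b) + ((\<Sum>a\<in>A - {a}. ?p a) - (\<Sum>a\<in>A - {b}. ?q a))"
    using sum.remove[OF A(1) a(1), of ?p] sum.remove[OF A(1) b(1), of ?q] by simp
  also have "norm \<dots> \<le> 2 * e + real (card (A - {a})) * d"
  proof (intro norm_triangle_le add_mono norm_sum_diff_le)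
    have "norm (?p a - ?q b) \<le> norm (?p a - w) + norm (?q b - w)"
      using norm_triangle_ineq4[of "?p a - w" "?q b - w"] by simp
    then show "norm (?p a - ?q b) \<le> 2 * e"
      using near[OF a(2)] near[OF b(2)] by simp
    show "card (A - {a}) = card (A - {b})"
      using a b by simp
    show "norm (f (x \<otimes> s) - f (y \<otimes> t)) \<le> d" if "s \<in> A - {a}" "t \<in> A - {b}" for s t
      using that A(2) x y by (intro osc) auto
  qed (use A in auto)
  finally have "norm ((\<Sum>a\<in>A. ?p a) - (\<Sum>a\<in>A. ?q a)) \<le> 2 * e + real (card A - 1) * d"
    using a by simp
  then show ?thesis
    using n by (simp add: right_average_def scaleR_diff_right[symmetric] divide_right_mono)
qed

text \<open>
  By Wallace's theorem, the open set of all pairs \<open>(u, x)\<close> with \<open>f (u \<otimes> x)\<close> close to \<open>f x\<close> contains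
  a product neighbourhood of \<open>{\<one>} \<times> H\<close>, because \<open>H\<close> is compact.
\<close>
lemma left_uniformly_continuous:
  fixes f :: "'h \<Rightarrow> 'e::real_normed_vector"
  assumes f: "continuous_map X euclidean f" and "e > 0"
  obtains U where "openin X U" "\<one> \<in> U"
    "\<And>u x. u \<in> U \<Longrightarrow> x \<in> carrier H \<Longrightarrow> norm (f (u \<otimes> x) - f x) < e"
proof -
  have "continuous_map (prod_topology X X) euclidean (\<lambda>p. f (fst p \<otimes> snd p))"
    using continuous_map_compose[OF continuous_mult f] by (simp add: o_def case_prod_beta)
  moreover have "continuous_map (prod_topology X X) euclidean (\<lambda>p. f (snd p))"
    using continuous_map_compose[OF continuous_map_snd f] by (simp add: o_def)
  ultimately have "continuous_map (prod_topology X X) euclidean (\<lambda>p. f (fst p \<otimes> snd p) - f (snd p))"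
    by (rule continuous_map_diff)
  then have W: "openin (prod_topology X X)
      {p \<in> topspace (prod_topology X X). f (fst p \<otimes> snd p) - f (snd p) \<in> ball 0 e}"
    (is "openin _ ?W")
    by (rule openin_continuous_map_preimage) simp
  have K: "compactin X {\<one>}" "compactin X (topspace X)" "{\<one>} \<times> topspace X \<subseteq> ?W"
    using compact_space \<open>e > 0\<close> by (auto simp: compact_space_def topspace_carrier)
  obtain U V where "openin X U" "openin X V" "{\<one>} \<subseteq> U" "topspace X \<subseteq> V" "U \<times> V \<subseteq> ?W"
    by (rule Wallace_theorem_prod_topology[OF K(1,2) W K(3)])
  show ?thesis
  proof (rule that[OF \<open>openin X U\<close>])
    show "norm (f (u \<otimes> x) - f x) < e" if "u \<in> U" "x \<in> carrier H" for u x
    proof -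
      have "(u, x) \<in> ?W"
        by (rule subsetD[OF \<open>U \<times> V \<subseteq> ?W\<close>])
          (use \<open>topspace X \<subseteq> V\<close> that in \<open>auto simp: topspace_carrier\<close>)
      then show ?thesis by simp
    qed
  qed (use \<open>{\<one>} \<subseteq> U\<close> in simp)
qed

text \<open>
  Right averages inherit the modulus of left uniform continuity.  This is what allows one finite set
  to contract the oscillation again and again: its choice depends on this modulus alone.
\<close>
lemma right_averages_left_equicontinuous:
  fixes f :: "'h \<Rightarrow> 'e::real_normed_vector"
  assumes "u \<in> carrier H" "\<And>x. x \<in> carrier H \<Longrightarrow> norm (f (u \<otimes> x) - f x) \<le> e"
    and "T \<in> right_averages" "x \<in> carrier H"
  shows "norm (T f (u \<otimes> x) - T f x) \<le> e"
  using assms(3,4)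
proof (induction arbitrary: x rule: right_averages.induct)
  case (step T A)
  have "right_average A (T f) (u \<otimes> x) - right_average A (T f) x
      = (1 / real (card A)) *\<^sub>R (\<Sum>a\<in>A. T f (u \<otimes> x \<otimes> a) - T f (x \<otimes> a)) - 0"
    by (simp add: right_average_def sum_subtractf scaleR_diff_right)
  also have "norm \<dots> \<le> e"
  proof (intro norm_average_le step.hyps)
    fix a assume "a \<in> A"
    then have "a \<in> carrier H" using step.hyps by blast
    then show "norm (T f (u \<otimes> x \<otimes> a) - T f (x \<otimes> a) - 0) \<le> e"
      using step.IH[of "x \<otimes> a"] step.prems assms(1) by (simp add: m_assoc)
  qed
  finally show ?case .
qed (use assms(2) in simp)

text \<open>
  The set consists of the inverses of the centres of finitely many right translates of \<open>U\<close> that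
  cover the group.
\<close>
lemma finite_set_translating_into:
  assumes "openin X U" "\<one> \<in> U"
  obtains A where "finite A" "A \<noteq> {}" "A \<subseteq> carrier H" "\<And>x. x \<in> carrier H \<Longrightarrow> \<exists>a\<in>A. x \<otimes> a \<in> U"
proof -
  define V where "V a = {x \<in> topspace X. x \<otimes> a \<in> U}" for a
  have op: "openin X (V a)" if "a \<in> carrier H" for a
  proof -
    have "continuous_map X (prod_topology X X) (\<lambda>x. (x, a))"
      using that by (intro continuous_map_pairedI) (auto simp: topspace_carrier)
    from continuous_map_compose[OF this continuous_mult]
    have "continuous_map X X (\<lambda>x. x \<otimes> a)" by (simp add: o_def)
    then show ?thesis
      unfolding V_def using assms(1) by (rule openin_continuous_map_preimage)
  qed
  have "topspace X \<subseteq> \<Union>(V ` carrier H)"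
  proof
    fix x assume "x \<in> topspace X"
    then have "x \<in> V (inv x)" "inv x \<in> carrier H"
      using assms(2) by (auto simp: V_def topspace_carrier)
    then show "x \<in> \<Union>(V ` carrier H)" by blast
  qed
  then obtain F where F: "finite F" "F \<subseteq> V ` carrier H" "topspace X \<subseteq> \<Union>F"
    using compactinD[of X "topspace X" "V ` carrier H"] compact_space op
    unfolding compact_space_def by blast
  then obtain A where A: "finite A" "A \<subseteq> carrier H" "F = V ` A"
    using finite_subset_image by metis
  have hit: "\<exists>a\<in>A. x \<otimes> a \<in> U" if "x \<in> carrier H" for x
    using F(3) A(3) that by (auto simp: V_def topspace_carrier)
  then have "A \<noteq> {}" by (metis one_closed empty_iff)
  then show ?thesis using that A hit by blast
qed

text \<open>
  With \<open>N\<close> elements in the averaging set, one averaging turns a bound \<open>2 * \<eta> + D\<close> of the oscillation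
  into \<open>2 * \<eta> + r * D\<close> with \<open>r = (N - 1) / N < 1\<close>.  Iteration brings the oscillation as close to
  \<open>2 * \<eta>\<close> as desired.
\<close>
lemma right_averages_small_oscillation:
  fixes f :: "'h \<Rightarrow> 'e::real_normed_vector"
  assumes f: "continuous_map X euclidean f" and "e > 0"
  shows "\<exists>T\<in>right_averages. \<forall>x\<in>carrier H. \<forall>y\<in>carrier H. norm (T f x - T f y) \<le> e"
proof -
  define \<eta> where "\<eta> = e / 3"
  have "\<eta> > 0" using \<open>e > 0\<close> by (simp add: \<eta>_def)
  obtain U where U: "openin X U" "\<one> \<in> U"
    "\<And>u x. u \<in> U \<Longrightarrow> x \<in> carrier H \<Longrightarrow> norm (f (u \<otimes> x) - f x) < \<eta>"
    using left_uniformly_continuous[OF f \<open>\<eta> > 0\<close>] by metis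
  obtain A where A: "finite A" "A \<noteq> {}" "A \<subseteq> carrier H"
    "\<And>x. x \<in> carrier H \<Longrightarrow> \<exists>a\<in>A. x \<otimes> a \<in> U"
    using finite_set_translating_into[OF U(1,2)] by blast
  have U_carrier: "U \<subseteq> carrier H"
    using openin_subset[OF U(1)] by (simp add: topspace_carrier)
  have near: "norm (T f u - T f \<one>) \<le> \<eta>" if "T \<in> right_averages" "u \<in> U" for T u
    using right_averages_left_equicontinuous[of u f \<eta> T \<one>] U(3) that U_carrier
    by (auto simp: less_imp_le subset_iff)
  have "compact (f ` carrier H)"
    using image_compactin[OF _ f, of "topspace X"] compact_space
    by (simp add: compact_space_def topspace_carrier)
  then have "bounded (f ` carrier H)"
    by (rule compact_imp_bounded)
  then obtain C where C: "\<And>x. x \<in> carrier H \<Longrightarrow> norm (f x) \<le> C"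
    by (auto simp: bounded_iff)
  define D where "D = 2 * \<bar>C\<bar> + 1"
  have D: "D > 0" by (simp add: D_def)
  define N where "N = real (card A)"
  define r where "r = real (card A - 1) / N"
  have "card A > 0" using A(1,2) by (simp add: card_gt_0_iff)
  then have N: "N > 0" "real (card A - 1) = N - 1" "r < 1" "r \<ge> 0"
    by (auto simp: N_def r_def of_nat_diff)
  have r: "r = (N - 1) / N" using N(2) by (simp add: r_def)
  have "\<exists>T\<in>right_averages. \<forall>x\<in>carrier H. \<forall>y\<in>carrier H.
      norm (T f x - T f y) \<le> 2 * \<eta> + r ^ n * D" for n
  proof (induction n)
    case 0
    have "norm (f x - f y) \<le> 2 * \<eta> + D" if "x \<in> carrier H" "y \<in> carrier H" for x y
      using norm_triangle_ineq4[of "f x" "f y"] C[OF that(1)] C[OF that(2)] \<open>\<eta> > 0\<close>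
      unfolding D_def by linarith
    then show ?case
      by (intro bexI[OF _ right_averages.id]) simp
  next
    case (Suc n)
    then obtain T where T: "T \<in> right_averages"
      "\<And>x y. x \<in> carrier H \<Longrightarrow> y \<in> carrier H \<Longrightarrow> norm (T f x - T f y) \<le> 2 * \<eta> + r ^ n * D"
      by blast
    have eq: "(2 * \<eta> + real (card A - 1) * (2 * \<eta> + r ^ n * D)) / real (card A)
        = 2 * \<eta> + r ^ Suc n * D"
      unfolding r N(2) N_def[symmetric] using N(1) by (simp add: field_simps)
    have "norm (right_average A (T f) x - right_average A (T f) y) \<le> 2 * \<eta> + r ^ Suc n * D"
      if "x \<in> carrier H" "y \<in> carrier H" for x y
      using right_average_contracts[OF A(1,3,4) near[OF T(1)] T(2) that] unfolding eq .
    then show ?case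
      by (intro bexI[OF _ right_averages.step[OF T(1) A(1,2,3)]]) auto
  qed
  moreover obtain n where "r ^ n < \<eta> / D"
    using real_arch_pow_inv[of "\<eta> / D" r] N D \<open>\<eta> > 0\<close> by auto
  then have "2 * \<eta> + r ^ n * D \<le> e"
    using D by (simp add: \<eta>_def field_simps)
  ultimately show ?thesis
    by (meson order_trans)
qed

lemma left_averages_small_oscillation:
  fixes f :: "'h \<Rightarrow> 'e::real_normed_vector"
  assumes f: "continuous_map X euclidean f" and "e > 0"
  obtains S w where "S \<in> left_averages" "\<And>x. x \<in> carrier H \<Longrightarrow> norm (S f x - w) \<le> e"
proof -
  have "continuous_map X euclidean (\<lambda>x. f (inv x))"
    using continuous_map_compose[OF continuous_inv f] by (simp add: o_def)
  then obtain T where T: "T \<in> right_averages"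
    "\<And>x y. x \<in> carrier H \<Longrightarrow> y \<in> carrier H \<Longrightarrow>
      norm (T (\<lambda>x. f (inv x)) x - T (\<lambda>x. f (inv x)) y) \<le> e"
    using right_averages_small_oscillation[OF _ \<open>e > 0\<close>] by metis
  obtain S where "S \<in> left_averages"
    "\<And>f x. x \<in> carrier H \<Longrightarrow> S f x = T (\<lambda>y. f (inv y)) (inv x)"
    using left_averages_of_right[OF T(1)] by blast
  then show ?thesis
    using that[of S "T (\<lambda>x. f (inv x)) \<one>"] T(2) by simp
qed

text \<open>
  Both values are compared with the value \<open>w\<close> of an almost constant left average \<open>S f\<close>: since
  \<open>T (S f) = S (T f)\<close>, the value of \<open>T f\<close> is close to \<open>w\<close> for every right average \<open>T\<close> that makes
  \<open>f\<close> almost constant.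
\<close>
lemma right_averages_agree:
  fixes f :: "'h \<Rightarrow> 'e::real_normed_vector"
  assumes f: "continuous_map X euclidean f"
    and "T1 \<in> right_averages" "\<And>x. x \<in> carrier H \<Longrightarrow> norm (T1 f x - v1) \<le> e1"
    and "T2 \<in> right_averages" "\<And>x. x \<in> carrier H \<Longrightarrow> norm (T2 f x - v2) \<le> e2"
  shows "norm (v1 - v2) \<le> e1 + e2"
proof (rule field_le_epsilon)
  fix d :: real assume "d > 0"
  then obtain S w where S: "S \<in> left_averages" "\<And>x. x \<in> carrier H \<Longrightarrow> norm (S f x - w) \<le> d / 2"
    using left_averages_small_oscillation[OF f, of "d / 2"] by auto
  have *: "norm (v - w) \<le> e + d / 2"
    if T: "T \<in> right_averages" "\<And>x. x \<in> carrier H \<Longrightarrow> norm (T f x - v) \<le> e" for T v e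
  proof -
    have "norm (T (S f) \<one> - w) \<le> d / 2"
      using T(1) S(2) by (rule right_averages_near) auto
    moreover have "norm (S (T f) \<one> - v) \<le> e"
      using S(1) T(2) by (rule left_averages_near) auto
    ultimately show ?thesis
      using norm_triangle_ineq4[of "T (S f) \<one> - w" "T (S f) \<one> - v"]
      by (simp add: left_right_averages_commute[OF T(1) S(1)])
  qed
  have "norm (v1 - v2) \<le> norm (v1 - w) + norm (v2 - w)"
    using norm_triangle_ineq4[of "v1 - w" "v2 - w"] by simp
  then show "norm (v1 - v2) \<le> e1 + e2 + d"
    using *[OF assms(2,3)] *[OF assms(4,5)] by simp
qed

text \<open>
  The value \<open>v\<close> is the integral of \<open>f\<close> with respect to the normalised Haar measure, characterised as
  the constant function in the uniform closure of the averages over right translates.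
\<close>
definition is_mean :: "('h \<Rightarrow> 'e::real_normed_vector) \<Rightarrow> 'e \<Rightarrow> bool" where
  "is_mean f v \<longleftrightarrow> (\<forall>e>0. \<exists>T\<in>right_averages. \<forall>x\<in>carrier H. norm (T f x - v) \<le> e)"

definition mean :: "('h \<Rightarrow> 'e::real_normed_vector) \<Rightarrow> 'e" where
  "mean f = (THE v. is_mean f v)"

lemma is_mean_unique:
  assumes "continuous_map X euclidean f" "is_mean f v" "is_mean f w"
  shows "v = w"
proof (rule ccontr)
  assume "v \<noteq> w"
  then have e: "norm (v - w) / 3 > 0" by simp
  obtain T1 where "T1 \<in> right_averages" "\<And>x. x \<in> carrier H \<Longrightarrow> norm (T1 f x - v) \<le> norm (v - w) / 3"
    using assms(2) e unfolding is_mean_def by blast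
  moreover obtain T2 where "T2 \<in> right_averages"
    "\<And>x. x \<in> carrier H \<Longrightarrow> norm (T2 f x - w) \<le> norm (v - w) / 3"
    using assms(3) e unfolding is_mean_def by blast
  ultimately have "norm (v - w) \<le> norm (v - w) / 3 + norm (v - w) / 3"
    by (rule right_averages_agree[OF assms(1)])
  then show False using e by simp
qed

text \<open>
  The values at \<open>\<one>\<close> of right averages with smaller and smaller oscillation form a Cauchy sequence,
  because any two almost constant right averages agree approximately.
\<close>
lemma is_mean_exists:
  fixes f :: "'h \<Rightarrow> 'e::banach"
  assumes f: "continuous_map X euclidean f"
  shows "\<exists>v. is_mean f v"
proof -
  define d where "d n = 1 / real (Suc n)" for n
  have "\<forall>n. \<exists>T\<in>right_averages. \<forall>x\<in>carrier H. \<forall>y\<in>carrier H. norm (T f x - T f y) \<le> d n"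
    by (intro allI right_averages_small_oscillation f) (simp add: d_def)
  then obtain T where T: "\<And>n. T n \<in> right_averages"
    "\<And>n x y. x \<in> carrier H \<Longrightarrow> y \<in> carrier H \<Longrightarrow> norm (T n f x - T n f y) \<le> d n"
    by metis
  define v where "v n = T n f \<one>" for n
  have lim: "d \<longlonglongrightarrow> 0"
    unfolding d_def using LIMSEQ_Suc[OF lim_1_over_n] .
  have small: "\<exists>n. \<forall>m\<ge>n. d m < e" if "e > 0" for e
    using order_tendstoD(2)[OF lim that] by (simp add: eventually_sequentially)
  have dist: "norm (v m - v n) \<le> d m + d n" for m n
    by (rule right_averages_agree[OF f, of "T m" _ _ "T n"]) (simp_all add: v_def T)
  have "Cauchy v"
  proof (rule CauchyI)
    fix e :: real assume "e > 0"
    then obtain n where n: "\<forall>m\<ge>n. d m < e / 2" using small[of "e / 2"] by auto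
    have "norm (v i - v j) < e" if "i \<ge> n" "j \<ge> n" for i j
      using dist[of i j] n[rule_format, OF that(1)] n[rule_format, OF that(2)] by simp
    then show "\<exists>M. \<forall>m\<ge>M. \<forall>n\<ge>M. norm (v m - v n) < e" by blast
  qed
  then obtain l where l: "v \<longlonglongrightarrow> l"
    using Cauchy_convergent_iff convergent_def by blast
  have "is_mean f l"
    unfolding is_mean_def
  proof (intro allI impI)
    fix e :: real assume "e > 0"
    then obtain n1 where n1: "\<forall>m\<ge>n1. d m < e / 2" using small[of "e / 2"] by auto
    obtain n2 where n2: "\<forall>m\<ge>n2. norm (v m - l) < e / 2"
      using LIMSEQ_D[OF l, of "e / 2"] \<open>e > 0\<close> by auto
    let ?n = "max n1 n2"
    have "norm (T ?n f x - l) \<le> e" if "x \<in> carrier H" for x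
    proof -
      have "norm (T ?n f x - l) \<le> norm (T ?n f x - v ?n) + norm (v ?n - l)"
        using norm_triangle_ineq[of "T ?n f x - v ?n" "v ?n - l"] by simp
      also have "\<dots> \<le> e / 2 + e / 2"
        using T(2)[OF that one_closed, of ?n] n1 n2 unfolding v_def
        by (intro add_mono) (auto simp: less_imp_le dest!: spec[of _ ?n])
      finally show ?thesis by simp
    qed
    then show "\<exists>T\<in>right_averages. \<forall>x\<in>carrier H. norm (T f x - l) \<le> e"
      using T(1) by blast
  qed
  then show ?thesis by blast
qed

lemma is_mean_mean:
  fixes f :: "'h \<Rightarrow> 'e::banach"
  assumes "continuous_map X euclidean f"
  shows "is_mean f (mean f)"
  unfolding mean_def using is_mean_exists[OF assms] is_mean_unique[OF assms] by (metis theI)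

lemma mean_eqI:
  assumes "continuous_map X euclidean f" "is_mean f v"
  shows "mean f = v"
  unfolding mean_def using assms is_mean_unique by blast

lemma right_averages_cong:
  assumes "T \<in> right_averages" "\<And>x. x \<in> carrier H \<Longrightarrow> f x = g x" "x \<in> carrier H"
  shows "T f x = T g x"
  using assms(1,3)
proof (induction arbitrary: x rule: right_averages.induct)
  case (step T A)
  have "T f (x \<otimes> a) = T g (x \<otimes> a)" if "a \<in> A" for a
    using step.hyps step.prems that by (intro step.IH) auto
  then show ?case by (simp add: right_average_def)
qed (use assms(2) in simp)

lemma mean_cong:
  fixes f :: "'h \<Rightarrow> 'e::banach"
  assumes g: "continuous_map X euclidean g" and eq: "\<And>x. x \<in> carrier H \<Longrightarrow> f x = g x"
  shows "mean f = mean g"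
proof (rule mean_eqI)
  show "continuous_map X euclidean f"
    using g by (rule continuous_map_eq) (simp add: eq topspace_carrier)
  show "is_mean f (mean g)"
    unfolding is_mean_def
  proof (intro allI impI)
    fix e :: real assume "e > 0"
    then obtain T where T: "T \<in> right_averages" "\<And>x. x \<in> carrier H \<Longrightarrow> norm (T g x - mean g) \<le> e"
      using is_mean_mean[OF g] unfolding is_mean_def by blast
    have "T f x = T g x" if "x \<in> carrier H" for x
      using T(1) eq that by (rule right_averages_cong)
    then show "\<exists>T\<in>right_averages. \<forall>x\<in>carrier H. norm (T f x - mean g) \<le> e"
      using T by (intro bexI[of _ T]) auto
  qed
qed

lemma norm_mean_le:
  fixes f :: "'h \<Rightarrow> 'e::banach"
  assumes f: "continuous_map X euclidean f"
    and "\<And>x. x \<in> carrier H \<Longrightarrow> norm (f x) \<le> e"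
  shows "norm (mean f) \<le> e"
proof (rule field_le_epsilon)
  fix d :: real assume "d > 0"
  then obtain T where T: "T \<in> right_averages" "\<And>x. x \<in> carrier H \<Longrightarrow> norm (T f x - mean f) \<le> d"
    using is_mean_mean[OF f] unfolding is_mean_def by blast
  have "norm (T f \<one> - 0) \<le> e"
    using T(1) by (rule right_averages_near) (use assms(2) in auto)
  moreover have "norm (mean f) \<le> norm (T f \<one>) + norm (T f \<one> - mean f)"
    using norm_triangle_ineq4[of "T f \<one>" "T f \<one> - mean f"] by simp
  ultimately show "norm (mean f) \<le> e + d"
    using T(2)[OF one_closed] by simp
qed

lemma mean_bounded_linear:
  fixes f :: "'h \<Rightarrow> 'e::banach" and L :: "'e \<Rightarrow> 'e"
  assumes L: "bounded_linear L" and f: "continuous_map X euclidean f"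
  shows "mean (\<lambda>x. L (f x)) = L (mean f)"
proof (rule mean_eqI)
  interpret L: bounded_linear L by (rule L)
  have "continuous_on UNIV L"
    by (rule L.continuous_on[OF continuous_on_id])
  then show "continuous_map X euclidean (\<lambda>x. L (f x))"
    using continuous_map_compose[OF f, of euclidean L] by (simp add: o_def)
  show "is_mean (\<lambda>x. L (f x)) (L (mean f))"
    unfolding is_mean_def
  proof (intro allI impI)
    fix e :: real assume "e > 0"
    obtain K where K: "K > 0" "\<And>x. norm (L x) \<le> norm x * K"
      using L.pos_bounded by blast
    obtain T where T: "T \<in> right_averages" "\<And>x. x \<in> carrier H \<Longrightarrow> norm (T f x - mean f) \<le> e / K"
      using is_mean_mean[OF f] K(1) \<open>e > 0\<close> unfolding is_mean_def by (meson divide_pos_pos)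
    have "norm (T (\<lambda>x. L (f x)) x - L (mean f)) \<le> e" if "x \<in> carrier H" for x
    proof -
      have "norm (L (T f x - mean f)) \<le> norm (T f x - mean f) * K" by (rule K)
      also have "\<dots> \<le> e / K * K"
        using T(2)[OF that] K(1) by (intro mult_right_mono) auto
      finally show ?thesis
        using K(1) by (simp add: right_averages_linear[OF L.linear T(1)] L.diff)
    qed
    then show "\<exists>T\<in>right_averages. \<forall>x\<in>carrier H. norm (T (\<lambda>x. L (f x)) x - L (mean f)) \<le> e"
      using T(1) by blast
  qed
qed

lemma right_averages_continuous:
  fixes f :: "'h \<Rightarrow> 'e::real_normed_vector"
  assumes f: "continuous_map X euclidean f" and "T \<in> right_averages"
  shows "continuous_map X euclidean (T f)"
  using assms(2)
proof induction
  case (step T A)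
  have "continuous_map X euclidean (\<lambda>x. T f (x \<otimes> a))" if "a \<in> A" for a
  proof -
    have "continuous_map X (prod_topology X X) (\<lambda>x. (x, a))"
      using that step.hyps by (intro continuous_map_pairedI) (auto simp: topspace_carrier)
    from continuous_map_compose[OF this continuous_mult]
    have "continuous_map X X (\<lambda>x. x \<otimes> a)" by (simp add: o_def)
    from continuous_map_compose[OF this step.IH] show ?thesis by (simp add: o_def)
  qed
  then have "continuous_map X euclidean (\<lambda>x. \<Sum>a\<in>A. T f (x \<otimes> a))"
    using step.hyps by (intro continuous_map_sum) auto
  moreover have "continuous_on UNIV (\<lambda>v::'e. (1 / real (card A)) *\<^sub>R v)"
    by (intro continuous_intros)
  ultimately show ?case
    using continuous_map_compose[of X euclidean "\<lambda>x. \<Sum>a\<in>A. T f (x \<otimes> a)" euclidean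
        "\<lambda>v. (1 / real (card A)) *\<^sub>R v"]
    by (simp add: o_def right_average_def[abs_def])
qed (use f in simp)

lemma mean_right_averages:
  fixes f :: "'h \<Rightarrow> 'e::banach"
  assumes f: "continuous_map X euclidean f" and T: "T \<in> right_averages"
  shows "mean (T f) = mean f"
proof (rule mean_eqI[symmetric, OF f])
  show "is_mean f (mean (T f))"
    unfolding is_mean_def
  proof (intro allI impI)
    fix e :: real assume "e > 0"
    then obtain S where S: "S \<in> right_averages"
      "\<And>x. x \<in> carrier H \<Longrightarrow> norm (S (T f) x - mean (T f)) \<le> e"
      using is_mean_mean[OF right_averages_continuous[OF f T]] unfolding is_mean_def by blast
    then show "\<exists>T'\<in>right_averages. \<forall>x\<in>carrier H. norm (T' f x - mean (T f)) \<le> e"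
      by (intro bexI[OF _ right_averages_comp[OF S(1) T]]) simp
  qed
qed

text \<open>
  A right average \<open>T\<close> that is good for \<open>f\<close> is followed by a right average \<open>S\<close> that is good for
  \<open>T g\<close>, a function with the same mean as \<open>g\<close>.  The second averaging does no harm to \<open>T f\<close>, which
  stays near the same constant.
\<close>
lemma mean_add:
  fixes f :: "'h \<Rightarrow> 'e::banach"
  assumes f: "continuous_map X euclidean f" and g: "continuous_map X euclidean g"
  shows "mean (\<lambda>x. f x + g x) = mean f + mean g"
proof (rule mean_eqI[OF continuous_map_add[OF f g]])
  show "is_mean (\<lambda>x. f x + g x) (mean f + mean g)"
    unfolding is_mean_def
  proof (intro allI impI)
    fix e :: real assume "e > 0"
    then have "e / 2 > 0" by simp
    then obtain T where T: "T \<in> right_averages" "\<And>x. x \<in> carrier H \<Longrightarrow> norm (T f x - mean f) \<le> e / 2"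
      using is_mean_mean[OF f] unfolding is_mean_def by blast
    have Tg: "continuous_map X euclidean (T g)"
      by (rule right_averages_continuous[OF g T(1)])
    obtain S where S: "S \<in> right_averages" "\<And>x. x \<in> carrier H \<Longrightarrow> norm (S (T g) x - mean (T g)) \<le> e / 2"
      using is_mean_mean[OF Tg] \<open>e / 2 > 0\<close> unfolding is_mean_def by blast
    have "norm (S (T (\<lambda>x. f x + g x)) x - (mean f + mean g)) \<le> e" if x: "x \<in> carrier H" for x
    proof -
      have Sf: "norm (S (T f) x - mean f) \<le> e / 2"
        using S(1) T(2) x by (rule right_averages_near)
      have Sg: "norm (S (T g) x - mean g) \<le> e / 2"
        using S(2)[OF x] by (simp only: mean_right_averages[OF g T(1)])
      have "S (T (\<lambda>x. f x + g x)) x - (mean f + mean g)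
          = (S (T f) x - mean f) + (S (T g) x - mean g)"
        unfolding right_averages_add[OF T(1), of f g] right_averages_add[OF S(1), of "T f" "T g"]
        by simp
      also have "norm \<dots> \<le> e / 2 + e / 2"
        using Sf Sg by (rule norm_triangle_mono)
      finally show ?thesis by simp
    qed
    then show "\<exists>T\<in>right_averages. \<forall>x\<in>carrier H.
        norm (T (\<lambda>x. f x + g x) x - (mean f + mean g)) \<le> e"
      by (intro bexI[OF _ right_averages_comp[OF S(1) T(1)]]) simp
  qed
qed

lemma mean_diff:
  fixes f :: "'h \<Rightarrow> 'e::banach"
  assumes f: "continuous_map X euclidean f" and g: "continuous_map X euclidean g"
  shows "mean (\<lambda>x. f x - g x) = mean f - mean g"
  using mean_add[OF continuous_map_diff[OF f g] g] by simp

lemma mean_const: "mean (\<lambda>_. c :: 'e::banach) = c"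
proof (rule mean_eqI)
  show "is_mean (\<lambda>_. c) c"
    unfolding is_mean_def by (intro allI impI bexI[OF _ right_averages.id]) simp
qed simp

text \<open>
  Invariance is immediate from the construction, as right averages commute with left translations.
\<close>
lemma mean_left_translate:
  fixes f :: "'h \<Rightarrow> 'e::banach"
  assumes f: "continuous_map X euclidean f" and h: "h \<in> carrier H"
  shows "mean (\<lambda>x. f (h \<otimes> x)) = mean f"
proof (rule mean_eqI)
  have "continuous_map X (prod_topology X X) (\<lambda>x. (h, x))"
    using h by (intro continuous_map_pairedI) (auto simp: topspace_carrier)
  from continuous_map_compose[OF this continuous_mult]
  have "continuous_map X X (\<lambda>x. h \<otimes> x)" by (simp add: o_def)
  from continuous_map_compose[OF this f] show "continuous_map X euclidean (\<lambda>x. f (h \<otimes> x))"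
    by (simp add: o_def)
  show "is_mean (\<lambda>x. f (h \<otimes> x)) (mean f)"
    unfolding is_mean_def
  proof (intro allI impI)
    fix e :: real assume "e > 0"
    then obtain T where T: "T \<in> right_averages" "\<And>x. x \<in> carrier H \<Longrightarrow> norm (T f x - mean f) \<le> e"
      using is_mean_mean[OF f] unfolding is_mean_def by blast
    then show "\<exists>T\<in>right_averages. \<forall>x\<in>carrier H. norm (T (\<lambda>x. f (h \<otimes> x)) x - mean f) \<le> e"
      by (intro bexI[OF _ T(1)]) (simp add: right_averages_left_translate[OF T(1) h] h)
  qed
qed

text \<open>
  Continuity in the parameter is uniform over the group, by the same compactness argument as in
  \<open>left_uniformly_continuous\<close>.
\<close>
lemma jointly_continuous_uniform:
  fixes \<phi> :: "real \<Rightarrow> 'h \<Rightarrow> 'e::real_normed_vector"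
  assumes \<phi>: "continuous_map (prod_topology (top_of_set J) X) euclidean (\<lambda>p. \<phi> (fst p) (snd p))"
    and J: "open J" "t \<in> J" and "e > 0"
  obtains \<delta> where "\<delta> > 0" "ball t \<delta> \<subseteq> J"
    "\<And>s x. s \<in> ball t \<delta> \<Longrightarrow> x \<in> carrier H \<Longrightarrow> norm (\<phi> s x - \<phi> t x) < e"
proof -
  let ?P = "prod_topology (top_of_set J) X"
  have "continuous_map ?P ?P (\<lambda>p. (t, snd p))"
    using J by (intro continuous_map_pairedI continuous_map_snd) auto
  from continuous_map_compose[OF this \<phi>]
  have "continuous_map ?P euclidean (\<lambda>p. \<phi> t (snd p))" by (simp add: o_def)
  from continuous_map_diff[OF \<phi> this]
  have W: "openin ?P {p \<in> topspace ?P. \<phi> (fst p) (snd p) - \<phi> t (snd p) \<in> ball 0 e}"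
    (is "openin _ ?W")
    by (rule openin_continuous_map_preimage) simp
  have K: "compactin (top_of_set J) {t}" "compactin X (topspace X)" "{t} \<times> topspace X \<subseteq> ?W"
    using compact_space \<open>e > 0\<close> J by (auto simp: compact_space_def)
  obtain U V where UV: "openin (top_of_set J) U" "openin X V" "{t} \<subseteq> U" "topspace X \<subseteq> V"
    "U \<times> V \<subseteq> ?W"
    by (rule Wallace_theorem_prod_topology[OF K(1,2) W K(3)])
  have "open U" "U \<subseteq> J"
    using UV(1) J(1) by (auto simp: openin_open_eq)
  then obtain \<delta> where \<delta>: "\<delta> > 0" "ball t \<delta> \<subseteq> U"
    using UV(3) open_contains_ball by blast
  show ?thesis
  proof (rule that[OF \<delta>(1)])
    show "norm (\<phi> s x - \<phi> t x) < e" if "s \<in> ball t \<delta>" "x \<in> carrier H" for s x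
    proof -
      have "(s, x) \<in> ?W"
        by (rule subsetD[OF UV(5)]) (use UV(4) \<delta>(2) that in \<open>auto simp: topspace_carrier\<close>)
      then show ?thesis by simp
    qed
  qed (use \<delta>(2) \<open>U \<subseteq> J\<close> in blast)
qed

lemma continuous_map_section:
  assumes "continuous_map (prod_topology (top_of_set J) X) euclidean (\<lambda>p. \<phi> (fst p) (snd p))" "t \<in> J"
  shows "continuous_map X euclidean (\<phi> t)"
proof -
  have "continuous_map X (prod_topology (top_of_set J) X) (\<lambda>x. (t, x))"
    using assms(2) by (intro continuous_map_pairedI) auto
  from continuous_map_compose[OF this assms(1)] show ?thesis by (simp add: o_def)
qed

lemma continuous_on_mean:
  fixes \<phi> :: "real \<Rightarrow> 'h \<Rightarrow> 'e::banach"
  assumes \<phi>: "continuous_map (prod_topology (top_of_set J) X) euclidean (\<lambda>p. \<phi> (fst p) (snd p))"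
    and J: "open J"
  shows "continuous_on J (\<lambda>t. mean (\<phi> t))"
  unfolding continuous_on_iff
proof (intro ballI allI impI)
  fix t :: real and e :: real assume "t \<in> J" "e > 0"
  then obtain \<delta> where \<delta>: "\<delta> > 0" "ball t \<delta> \<subseteq> J"
    "\<And>s x. s \<in> ball t \<delta> \<Longrightarrow> x \<in> carrier H \<Longrightarrow> norm (\<phi> s x - \<phi> t x) < e / 2"
    using jointly_continuous_uniform[OF \<phi> J, of t "e / 2"] by auto
  have "dist (mean (\<phi> s)) (mean (\<phi> t)) < e" if "s \<in> J" "dist s t < \<delta>" for s
  proof -
    have c: "continuous_map X euclidean (\<phi> s)" "continuous_map X euclidean (\<phi> t)"
      using continuous_map_section[OF \<phi>] that \<open>t \<in> J\<close> by auto
    have "norm (mean (\<lambda>x. \<phi> s x - \<phi> t x)) \<le> e / 2"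
      using \<delta>(3)[of s] that(2)
      by (intro norm_mean_le continuous_map_diff c) (auto simp: dist_commute less_imp_le)
    then show ?thesis
      using \<open>e > 0\<close> by (simp add: mean_diff[OF c] dist_norm)
  qed
  then show "\<exists>d>0. \<forall>s\<in>J. dist s t < d \<longrightarrow> dist (mean (\<phi> s)) (mean (\<phi> t)) < e"
    using \<delta>(1) by blast
qed

text \<open>
  The mean value theorem bounds the error of linearisation by the variation of the derivative, which
  is small uniformly over the compact group, and the mean does not exceed the supremum norm.
\<close>
lemma has_vector_derivative_mean:
  fixes \<phi> :: "real \<Rightarrow> 'h \<Rightarrow> 'e::banach"
  assumes \<phi>: "continuous_map (prod_topology (top_of_set J) X) euclidean (\<lambda>p. \<phi> (fst p) (snd p))"
    and \<phi>': "continuous_map (prod_topology (top_of_set J) X) euclidean (\<lambda>p. \<phi>' (fst p) (snd p))"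
    and J: "open J" "t \<in> J"
    and der: "\<And>s x. s \<in> J \<Longrightarrow> x \<in> carrier H \<Longrightarrow>
      ((\<lambda>s. \<phi> s x) has_vector_derivative \<phi>' s x) (at s)"
  shows "((\<lambda>t. mean (\<phi> t)) has_vector_derivative mean (\<phi>' t)) (at t)"
  unfolding has_vector_derivative_def has_derivative_at_alt
proof (intro conjI allI impI)
  show "bounded_linear (\<lambda>r. r *\<^sub>R mean (\<phi>' t))"
    by (rule bounded_linear_scaleR_left)
  fix e :: real assume "e > 0"
  obtain \<delta> where \<delta>: "\<delta> > 0" "ball t \<delta> \<subseteq> J"
    "\<And>s x. s \<in> ball t \<delta> \<Longrightarrow> x \<in> carrier H \<Longrightarrow> norm (\<phi>' s x - \<phi>' t x) < e"
    using jointly_continuous_uniform[OF \<phi>' J \<open>e > 0\<close>] by blast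
  have "norm (mean (\<phi> s) - mean (\<phi> t) - (s - t) *\<^sub>R mean (\<phi>' t)) \<le> e * norm (s - t)"
    if "norm (s - t) < \<delta>" for s
  proof -
    have s: "s \<in> ball t \<delta>" using that by (simp add: dist_norm norm_minus_commute)
    have c: "continuous_map X euclidean (\<phi> s)" "continuous_map X euclidean (\<phi> t)"
      using continuous_map_section[OF \<phi>] s \<delta>(2) J by auto
    have c': "continuous_map X euclidean (\<phi>' t)"
      using continuous_map_section[OF \<phi>'] J by auto
    have L: "bounded_linear (\<lambda>v::'e. (s - t) *\<^sub>R v)"
      by (rule bounded_linear_scaleR_right)
    have cL: "continuous_map X euclidean (\<lambda>x. (s - t) *\<^sub>R \<phi>' t x)"
      using continuous_map_compose[OF c', of euclidean "\<lambda>v. (s - t) *\<^sub>R v"]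
        bounded_linear.continuous_on[OF L continuous_on_id] by (simp add: o_def)
    have "norm (mean (\<lambda>x. \<phi> s x - \<phi> t x - (s - t) *\<^sub>R \<phi>' t x)) \<le> e * norm (s - t)"
    proof (intro norm_mean_le continuous_map_diff c cL)
      fix x assume x: "x \<in> carrier H"
      have "norm (\<phi> s x - \<phi> t x - (s - t) *\<^sub>R \<phi>' t x) \<le> norm (s - t) * e"
      proof (rule vector_differentiable_bound_linearization[where S = "ball t \<delta>"
            and f = "\<lambda>s. \<phi> s x" and a = t and b = s and ?x0.0 = t and f' = "\<lambda>s. \<phi>' s x"])
        show "closed_segment t s \<subseteq> ball t \<delta>"
          by (rule closed_segment_subset) (use s \<delta>(1) in simp_all)
        show "((\<lambda>s. \<phi> s x) has_vector_derivative \<phi>' r x) (at r within ball t \<delta>)" if "r \<in> ball t \<delta>" for r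
          by (rule has_vector_derivative_at_within[OF der[OF _ x]]) (use that \<delta>(2) in blast)
        show "norm (\<phi>' r x - \<phi>' t x) \<le> e" if "r \<in> ball t \<delta>" for r
          using \<delta>(3)[OF that x] by simp
        show "t \<in> ball t \<delta>" using \<delta>(1) by simp
      qed
      then show "norm (\<phi> s x - \<phi> t x - (s - t) *\<^sub>R \<phi>' t x) \<le> e * norm (s - t)"
        unfolding mult.commute[of e] .
    qed
    moreover have "mean (\<lambda>x. \<phi> s x - \<phi> t x - (s - t) *\<^sub>R \<phi>' t x)
        = mean (\<phi> s) - mean (\<phi> t) - (s - t) *\<^sub>R mean (\<phi>' t)"
      unfolding mean_diff[OF continuous_map_diff[OF c] cL] mean_diff[OF c]
        mean_bounded_linear[OF L c'] ..
    ultimately show ?thesis by metis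
  qed
  then show "\<exists>d>0. \<forall>s. norm (s - t) < d \<longrightarrow>
      norm (mean (\<phi> s) - mean (\<phi> t) - (s - t) *\<^sub>R mean (\<phi>' t)) \<le> e * norm (s - t)"
    using \<delta>(1) by blast
qed

end

section \<open>Ordinary differential equations\<close>

text \<open>
  Smoothness controls the derivative in the directions of a basis only; expanding a direction in its
  coordinates yields a bound of the operator norm on a compact set.
\<close>
lemma smooth_on_imp_Lipschitz:
  fixes f :: "'a::finite_dim_normed_vector \<Rightarrow> 'b::finite_dim_normed_vector"
  assumes f: "smooth_on f W" and W: "open W" "K \<subseteq> W" and K: "compact K" "convex K"
  obtains L where "L \<ge> 0" "\<And>x y. x \<in> K \<Longrightarrow> y \<in> K \<Longrightarrow> norm (f x - f y) \<le> L * norm (x - y)"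
proof -
  obtain B :: "'a set" and coord where B: "finite B" "\<And>b. b \<in> B \<Longrightarrow> bounded_linear (coord b)"
    "\<And>x. x = (\<Sum>b\<in>B. coord b x *\<^sub>R b)"
    using bounded_coordinates by blast
  let ?D = "\<lambda>x. frechet_derivative f (at x)"
  have D: "(f has_derivative ?D x) (at x)" if "x \<in> K" for x
    using smooth_on_has_derivative[OF f W(1)] that W(2) by blast
  have "\<exists>M\<ge>0. \<forall>x\<in>K. norm (?D x b) \<le> M" for b
  proof -
    have "compact ((\<lambda>x. ?D x b) ` K)"
      using smooth_on_imp_continuous_on[OF smooth_on_frechet_derivative[OF f]] W(2) K(1)
      by (intro compact_continuous_image) (auto intro: continuous_on_subset)
    then have "bounded ((\<lambda>x. ?D x b) ` K)" by (rule compact_imp_bounded)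
    then obtain M where "\<forall>x\<in>K. norm (?D x b) \<le> M" by (auto simp: bounded_iff)
    then have "\<forall>x\<in>K. norm (?D x b) \<le> \<bar>M\<bar>" by fastforce
    then show ?thesis by (intro exI[of _ "\<bar>M\<bar>"]) simp
  qed
  then obtain M where M: "\<And>b. M b \<ge> 0" "\<And>b x. x \<in> K \<Longrightarrow> norm (?D x b) \<le> M b"
    by metis
  have "\<exists>c\<ge>0. \<forall>v. \<bar>coord b v\<bar> \<le> norm v * c" if "b \<in> B" for b
    using bounded_linear.nonneg_bounded[OF B(2)[OF that]] by simp
  then obtain c where c: "\<And>b. b \<in> B \<Longrightarrow> c b \<ge> 0"
    "\<And>b v. b \<in> B \<Longrightarrow> \<bar>coord b v\<bar> \<le> norm v * c b"
    by metis
  define L where "L = (\<Sum>b\<in>B. c b * M b)"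
  have L: "L \<ge> 0"
    unfolding L_def using c(1) M(1) by (intro sum_nonneg mult_nonneg_nonneg) auto
  have onorm: "onorm (?D x) \<le> L" if x: "x \<in> K" for x
  proof (rule onorm_bound[OF L])
    fix v
    have lin: "linear (?D x)"
      using D[OF x] has_derivative_linear by blast
    have "?D x v = ?D x (\<Sum>b\<in>B. coord b v *\<^sub>R b)"
      by (rule arg_cong[OF B(3)])
    also have "\<dots> = (\<Sum>b\<in>B. coord b v *\<^sub>R ?D x b)"
      by (simp only: linear_sum[OF lin] linear_scale[OF lin])
    also have "norm \<dots> \<le> (\<Sum>b\<in>B. (norm v * c b) * M b)"
    proof (rule sum_norm_le)
      fix b assume b: "b \<in> B"
      have "\<bar>coord b v\<bar> * norm (?D x b) \<le> (norm v * c b) * M b"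
        using c[OF b] M(1)[of b] M(2)[OF x, of b] by (intro mult_mono) auto
      then show "norm (coord b v *\<^sub>R ?D x b) \<le> (norm v * c b) * M b" by simp
    qed
    also have "\<dots> = L * norm v"
      by (simp add: L_def sum_distrib_left mult.commute mult.left_commute)
    finally show "norm (?D x v) \<le> L * norm v" .
  qed
  show ?thesis
  proof (rule that[OF L])
    show "norm (f x - f y) \<le> L * norm (x - y)" if "x \<in> K" "y \<in> K" for x y
      by (rule differentiable_bound[OF K(2) has_derivative_at_withinI[OF D] onorm that(1,2)])
  qed
qed

lemma norm_integral_difference_le:
  fixes f :: "real \<Rightarrow> 'e::banach"
  assumes f: "continuous_on {a..b} f" "\<And>s. s \<in> {a..b} \<Longrightarrow> norm (f s) \<le> C"
    and t: "t \<in> {a..b}" "u \<in> {a..b}"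
  shows "norm (integral {a..t} f - integral {a..u} f) \<le> 2 * C * (b - a)"
proof -
  have "norm (integral {a..t} f) \<le> C * (b - a)" if "t \<in> {a..b}" for t
  proof -
    have "norm (integral {a..t} f) \<le> C * (t - a)"
      using that f by (intro integral_bound) (auto intro: continuous_on_subset)
    moreover have "C \<ge> 0"
      using f(2)[OF that] norm_ge_zero order_trans by blast
    then have "C * (t - a) \<le> C * (b - a)"
      using that by (intro mult_left_mono) auto
    ultimately show ?thesis by linarith
  qed
  from this[OF t(1)] this[OF t(2)] norm_triangle_ineq4[of "integral {a..t} f" "integral {a..u} f"]
  show ?thesis by linarith
qed

text \<open>
  The solution is the fixed point of the Picard operator, by Banach's theorem.  It acts on bounded
  continuous functions on the whole real line: the operator evaluates its integral at the
  point \<open>cl t\<close> of the interval \<open>{a..b}\<close> that is nearest to \<open>t\<close>, so its values are constant on both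
  sides of the interval.
\<close>
lemma Picard_Lindeloef:
  fixes A :: "real \<times> 'e::finite_dim_normed_vector \<Rightarrow> 'e"
  assumes W: "open W" "(t0, x0) \<in> W" and A: "smooth_on A W"
  obtains d x where "d > 0" "x t0 = x0"
    "\<And>t. t \<in> ball t0 d \<Longrightarrow> (t, x t) \<in> W"
    "\<And>t. t \<in> ball t0 d \<Longrightarrow> (x has_vector_derivative A (t, x t)) (at t)"
proof -
  obtain U V where UV: "open U" "open V" "t0 \<in> U" "x0 \<in> V" "U \<times> V \<subseteq> W"
    using open_prod_elim[OF W] by (metis mem_Sigma_iff)
  obtain r1 where r1: "r1 > 0" "cball t0 r1 \<subseteq> U"
    using UV(1,3) open_contains_cball by blast
  obtain r2 where r2: "r2 > 0" "cball x0 r2 \<subseteq> V"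
    using UV(2,4) open_contains_cball by blast
  define K where "K = cball t0 r1 \<times> cball x0 r2"
  have K: "compact K" "convex K" "K \<subseteq> W"
    using r1(2) r2(2) UV(5) by (auto simp: K_def compact_Times convex_Times)
  obtain L where L: "L \<ge> 0" "\<And>p q. p \<in> K \<Longrightarrow> q \<in> K \<Longrightarrow> norm (A p - A q) \<le> L * norm (p - q)"
    using smooth_on_imp_Lipschitz[OF A W(1) K(3,1,2)] by blast
  have contA: "continuous_on K A"
    using smooth_on_imp_continuous_on[OF A] K(3) continuous_on_subset by blast
  then have "bounded (A ` K)"
    using K(1) compact_continuous_image compact_imp_bounded by blast
  then obtain C0 where "\<forall>p\<in>K. norm (A p) \<le> C0" by (auto simp: bounded_iff)
  then obtain C where C: "C > 0" "\<And>p. p \<in> K \<Longrightarrow> norm (A p) \<le> C"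
    by (meson less_max_iff_disj max.coboundedI1 zero_less_one)
  define d where "d = min r1 (min (r2 / (4 * C)) (1 / (8 * (L + 1))))"
  have d: "d > 0" "d \<le> r1" "4 * C * d \<le> r2" "8 * L * d \<le> 1"
  proof -
    show "d > 0" "d \<le> r1"
      using r1(1) r2(1) C(1) L(1) by (auto simp: d_def)
    have "d \<le> r2 / (4 * C)" "d \<le> 1 / (8 * (L + 1))" by (auto simp: d_def)
    then show "4 * C * d \<le> r2"
      using C(1) by (simp add: field_simps)
    have "8 * L * d \<le> 8 * (L + 1) * d"
      using \<open>d > 0\<close> by simp
    also have "\<dots> \<le> 1"
      using \<open>d \<le> 1 / (8 * (L + 1))\<close> L(1) by (simp add: field_simps)
    finally show "8 * L * d \<le> 1" .
  qed
  define a where "a = t0 - d"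
  define b where "b = t0 + d"
  define cl where "cl t = max a (min b t)" for t :: real
  have ab: "a \<le> b" "t0 \<in> {a..b}" "b - a = 2 * d"
    using d(1) by (auto simp: a_def b_def)
  have sub: "{a..b} \<subseteq> cball t0 r1"
    using d(2) by (auto simp: a_def b_def dist_real_def)
  have cl: "cl t \<in> {a..b}" "t \<in> {a..b} \<Longrightarrow> cl t = t" for t
    using ab by (auto simp: cl_def)
  have cl_cont: "continuous_on UNIV cl"
    unfolding cl_def by (intro continuous_intros)
  define S where "S = {x :: real \<Rightarrow>\<^sub>C 'e. \<forall>t. apply_bcontfun x t \<in> cball x0 r2}"
  define F where "F x s = A (s, apply_bcontfun x s)" for x :: "real \<Rightarrow>\<^sub>C 'e" and s
  \<comment> \<open>Writing the integral from \<open>t0\<close> to \<open>t\<close> as a difference of integrals from \<open>a\<close> treats both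
     directions of time alike; this accounts for the constants in the choice of \<open>d\<close>.\<close>
  define P where "P x t = x0 + (integral {a..cl t} (F x) - integral {a..t0} (F x))" for x t
  have inK: "(s, apply_bcontfun x s) \<in> K" if "x \<in> S" "s \<in> {a..b}" for x s
    using that sub by (auto simp: K_def S_def)
  have contF: "continuous_on {a..b} (F x)" if "x \<in> S" for x
  proof -
    have "continuous_on {a..b} (apply_bcontfun x)"
      by (rule continuous_on_apply_bcontfun)
    then show ?thesis
      unfolding F_def using inK[OF that]
      by (intro continuous_on_compose2[OF contA] continuous_intros) auto
  qed
  have P_ball: "P x t \<in> cball x0 r2" if "x \<in> S" for x t
  proof -
    have "norm (P x t - x0) \<le> 2 * C * (b - a)"
      unfolding P_def add_diff_cancel_left'
      using C(2) inK[OF that] cl(1) ab(2) contF[OF that]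
      by (intro norm_integral_difference_le) (auto simp: F_def)
    also have "\<dots> \<le> r2"
      using d(3) ab(3) by simp
    finally show ?thesis
      by (simp add: dist_norm norm_minus_commute)
  qed
  have P_cont: "continuous_on UNIV (P x)" if "x \<in> S" for x
  proof -
    have "continuous_on {a..b} (\<lambda>t. integral {a..t} (F x))"
      using contF[OF that] by (intro indefinite_integral_continuous_1 integrable_continuous_real)
    then have "continuous_on UNIV (\<lambda>t. integral {a..cl t} (F x))"
      by (rule continuous_on_compose2[OF _ cl_cont]) (use cl(1) in auto)
    then show ?thesis
      unfolding P_def by (intro continuous_intros)
  qed
  define T where "T x = Bcontfun (P x)" for x
  have T: "apply_bcontfun (T x) t = P x t" if "x \<in> S" for x t
  proof -
    have "bounded (range (P x))"
      by (rule bounded_subset[OF bounded_cball[of x0 r2]]) (use P_ball[OF that] in blast)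
    then have "P x \<in> bcontfun"
      using P_cont[OF that] by (simp add: bcontfun_def)
    then show ?thesis
      unfolding T_def by (simp add: Bcontfun_inverse)
  qed
  have "complete S"
  proof -
    have "S = PiC UNIV (\<lambda>_. cball x0 r2)"
      by (auto simp: S_def mem_PiC_iff Pi_iff)
    then have "closed S" by (simp add: closed_PiC)
    then show ?thesis by (simp add: complete_eq_closed)
  qed
  moreover have "const_bcontfun x0 \<in> S"
    using r2(1) by (simp add: S_def)
  then have "S \<noteq> {}" by blast
  moreover have "T ` S \<subseteq> S"
    using P_ball by (auto simp: S_def[unfolded set_eq_iff] T)
  moreover have "dist (T x) (T y) \<le> 1 / 2 * dist x y" if "x \<in> S" "y \<in> S" for x y
  proof (rule dist_bound)
    fix t
    have "P x t - P y t = integral {a..cl t} (\<lambda>s. F x s - F y s) - integral {a..t0} (\<lambda>s. F x s - F y s)"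
    proof -
      have "integral {a..u} (\<lambda>s. F x s - F y s) = integral {a..u} (F x) - integral {a..u} (F y)"
        if "u \<in> {a..b}" for u
        using that \<open>x \<in> S\<close> \<open>y \<in> S\<close>
        by (intro Henstock_Kurzweil_Integration.integral_diff integrable_continuous_real
            continuous_on_subset[OF contF]) auto
      then show ?thesis
        using cl(1)[of t] ab(2) by (simp add: P_def)
    qed
    also have "norm \<dots> \<le> 2 * (L * dist x y) * (b - a)"
    proof (rule norm_integral_difference_le[OF _ _ cl(1) ab(2)])
      show "continuous_on {a..b} (\<lambda>s. F x s - F y s)"
        using contF that by (intro continuous_intros)
      fix s assume s: "s \<in> {a..b}"
      have "norm (F x s - F y s) \<le> L * norm ((s, apply_bcontfun x s) - (s, apply_bcontfun y s))"
        unfolding F_def using inK s that by (intro L(2))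
      also have "\<dots> = L * dist (apply_bcontfun x s) (apply_bcontfun y s)"
        by (simp add: dist_norm norm_Pair)
      also have "\<dots> \<le> L * dist x y"
        using L(1) dist_bounded by (intro mult_left_mono)
      finally show "norm (F x s - F y s) \<le> L * dist x y" .
    qed
    also have "\<dots> = (8 * L * d) * (1 / 2 * dist x y)"
      using ab(3) by simp
    also have "\<dots> \<le> 1 * (1 / 2 * dist x y)"
      using d(4) by (intro mult_right_mono) auto
    finally show "dist (apply_bcontfun (T x) t) (apply_bcontfun (T y) t) \<le> 1 / 2 * dist x y"
      by (simp add: T that dist_norm)
  qed
  ultimately have "\<exists>!x\<in>S. T x = x"
    by (intro Banach_fix[where c = "1 / 2"]) auto
  then obtain x where x: "x \<in> S" "T x = x" by blast
  have eq: "apply_bcontfun x t = P x t" for t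
    using T[OF x(1)] x(2) by metis
  have ball: "t \<in> {a..b}" "t \<in> interior {a..b}" if "t \<in> ball t0 d" for t
    using that by (auto simp: a_def b_def dist_real_def)
  show ?thesis
  proof (rule that[OF d(1)])
    show "apply_bcontfun x t0 = x0"
      unfolding eq P_def using cl(2)[OF ab(2)] by simp
    show "(t, apply_bcontfun x t) \<in> W" if "t \<in> ball t0 d" for t
      using inK[OF x(1) ball(1)[OF that]] K(3) by blast
    show "(apply_bcontfun x has_vector_derivative A (t, apply_bcontfun x t)) (at t)"
      if "t \<in> ball t0 d" for t
    proof -
      have "((\<lambda>u. integral {a..u} (F x)) has_vector_derivative F x t) (at t within {a..b})"
        using contF[OF x(1)] ball(1)[OF that] by (rule integral_has_vector_derivative)
      then have "((\<lambda>u. integral {a..u} (F x)) has_vector_derivative F x t) (at t)"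
        using at_within_interior[OF ball(2)[OF that]] by simp
      then have "((\<lambda>u. x0 + (integral {a..u} (F x) - integral {a..t0} (F x))) has_vector_derivative F x t) (at t)"
        by (auto intro!: derivative_eq_intros)
      then have "(apply_bcontfun x has_vector_derivative F x t) (at t)"
        by (rule has_vector_derivative_transform_within_open[OF _ open_ball that])
          (simp add: eq P_def cl(2)[OF ball(1)])
      then show ?thesis by (simp add: F_def)
    qed
  qed
qed

text \<open>
  Bootstrapping: if \<open>x\<close> is of class \<open>C\<^sup>k\<close>, then so is its derivative \<open>A (t, x t)\<close>, and \<open>x\<close> is of
  class \<open>C\<^sup>k\<^sup>+\<^sup>1\<close>.
\<close>
lemma smooth_on_ODE_solution:
  fixes x :: "real \<Rightarrow> 'e::finite_dim_normed_vector"
  assumes J: "open J" and A: "open W" "smooth_on A W"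
    and x: "\<And>t. t \<in> J \<Longrightarrow> (t, x t) \<in> W"
      "\<And>t. t \<in> J \<Longrightarrow> (x has_vector_derivative A (t, x t)) (at t)"
  shows "smooth_on x J"
proof -
  have "C_k_on k x J" for k
  proof (induction k)
    case 0
    show ?case
      using has_vector_derivative_continuous[OF x(2)] J
      by (simp add: continuous_on_eq_continuous_at)
  next
    case (Suc k)
    show ?case
    proof (rule C_k_on_Suc_realI[OF J x(2)])
      show "C_k_on k (\<lambda>t. A (t, x t)) J"
        using A x(1) Suc unfolding smooth_on_def
        by (intro C_k_on_compose[where f = "\<lambda>t. (t, x t)" and g = A and T = W]
            C_k_on_Pair C_k_on_id J) auto
    qed
  qed
  then show ?thesis by (simp add: smooth_on_def)
qed

section \<open>Smooth maps into manifolds\<close>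

text \<open>
  The property of an atlas on which the composition of smooth maps rests.  It passes to products and
  holds trivially for open subsets of vector spaces.
\<close>
definition charted :: "('p, 'e::finite_dim_normed_vector) manifold \<Rightarrow> bool" where
  "charted M \<longleftrightarrow> (\<forall>(U, a) \<in> atlas M. openin (mtop M) U \<and> inj_on a U \<and>
       (\<forall>W. openin (mtop M) W \<longrightarrow> W \<subseteq> U \<longrightarrow> open (a ` W))) \<and>
     (\<Union>c \<in> atlas M. fst c) = topspace (mtop M)"

lemma charted_openin: "charted M \<Longrightarrow> (U, a) \<in> atlas M \<Longrightarrow> openin (mtop M) U"
  and charted_inj_on: "charted M \<Longrightarrow> (U, a) \<in> atlas M \<Longrightarrow> inj_on a U"
  and charted_open_image:
    "charted M \<Longrightarrow> (U, a) \<in> atlas M \<Longrightarrow> openin (mtop M) W \<Longrightarrow> W \<subseteq> U \<Longrightarrow> open (a ` W)"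
  unfolding charted_def by blast+

lemma charted_cover:
  assumes "charted M" "p \<in> topspace (mtop M)"
  obtains U a where "(U, a) \<in> atlas M" "p \<in> U"
proof -
  have "p \<in> (\<Union>c \<in> atlas M. fst c)"
    using assms by (simp add: charted_def)
  then obtain c where "c \<in> atlas M" "p \<in> fst c" by blast
  then show ?thesis using that[of "fst c" "snd c"] by simp
qed

lemma smooth_manifold_imp_charted:
  assumes "smooth_manifold M"
  shows "charted M"
proof -
  have *: "openin (mtop M) U \<and> inj_on a U \<and> (\<forall>W. openin (mtop M) W \<longrightarrow> W \<subseteq> U \<longrightarrow> open (a ` W))"
    if "(U, a) \<in> atlas M" for U a
  proof -
    have chart: "openin (mtop M) U" "open (a ` U)"
      "homeomorphic_map (subtopology (mtop M) U) (top_of_set (a ` U)) a"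
      using assms that unfolding smooth_manifold_def is_chart_def by fastforce+
    have "topspace (subtopology (mtop M) U) = U"
      using openin_subset[OF chart(1)] by auto
    then have "inj_on a U"
      using homeomorphic_imp_injective_map[OF chart(3)] by simp
    moreover have "open (a ` W)" if "openin (mtop M) W" "W \<subseteq> U" for W
    proof -
      have "openin (subtopology (mtop M) U) W"
        using that by (auto simp: openin_subtopology)
      then have "openin (top_of_set (a ` U)) (a ` W)"
        using homeomorphic_imp_open_map[OF chart(3)] by (simp add: open_map_def)
      then show ?thesis
        using chart(2) openin_open_trans by blast
    qed
    ultimately show ?thesis using chart(1) by blast
  qed
  show ?thesis
    unfolding charted_def
  proof (intro conjI ballI)
    show "(\<Union>c \<in> atlas M. fst c) = topspace (mtop M)"
      using assms by (simp add: smooth_manifold_def)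
  qed (clarify, rule *)
qed

lemma charted_open_submanifold: "open S \<Longrightarrow> charted (open_submanifold S)"
  unfolding charted_def open_submanifold_def by (auto simp: openin_open_eq)

lemma charted_prod_manifold:
  assumes M: "charted M" and N: "charted N"
  shows "charted (prod_manifold M N)"
proof -
  have "open (map_prod a b ` W)"
    if ab: "(U, a) \<in> atlas M" "(V, b) \<in> atlas N"
      and W: "openin (prod_topology (mtop M) (mtop N)) W" "W \<subseteq> U \<times> V" for U a V b W
  proof (rule Topological_Spaces.openI)
    fix z assume "z \<in> map_prod a b ` W"
    then obtain p q where z: "z = (a p, b q)" "(p, q) \<in> W" by auto
    obtain P Q where PQ: "openin (mtop M) P" "openin (mtop N) Q" "p \<in> P" "q \<in> Q" "P \<times> Q \<subseteq> W"
      using W(1) z(2) unfolding openin_prod_topology_alt by metis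
    then have "P \<subseteq> U" "Q \<subseteq> V" using W(2) by auto
    then have "open (a ` P \<times> b ` Q)"
      by (intro open_Times charted_open_image[OF M ab(1) PQ(1)] charted_open_image[OF N ab(2) PQ(2)])
    moreover have "z \<in> a ` P \<times> b ` Q" using PQ z by auto
    ultimately obtain e where "e > 0" "ball z e \<subseteq> a ` P \<times> b ` Q"
      by (rule openE)
    moreover have "a ` P \<times> b ` Q \<subseteq> map_prod a b ` W"
      using PQ(5) by (auto simp: image_iff)
    ultimately show "\<exists>T. open T \<and> z \<in> T \<and> T \<subseteq> map_prod a b ` W"
      by (intro exI[of _ "ball z e"]) auto
  qed
  moreover have "openin (prod_topology (mtop M) (mtop N)) (U \<times> V)" "inj_on (map_prod a b) (U \<times> V)"
    if "(U, a) \<in> atlas M" "(V, b) \<in> atlas N" for U a V b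
    using charted_openin[OF M that(1)] charted_openin[OF N that(2)]
      charted_inj_on[OF M that(1)] charted_inj_on[OF N that(2)]
    by (auto simp: openin_prod_Times_iff inj_on_def)
  moreover have "(\<Union>c \<in> atlas (prod_manifold M N). fst c) = topspace (mtop M) \<times> topspace (mtop N)"
  proof (intro equalityI subsetI)
    fix z assume "z \<in> (\<Union>c \<in> atlas (prod_manifold M N). fst c)"
    then obtain U a V b where "(U, a) \<in> atlas M" "(V, b) \<in> atlas N" "z \<in> U \<times> V"
      unfolding prod_manifold_def by auto
    then show "z \<in> topspace (mtop M) \<times> topspace (mtop N)"
      using openin_subset[OF charted_openin[OF M]] openin_subset[OF charted_openin[OF N]] by blast
  next
    fix z assume "z \<in> topspace (mtop M) \<times> topspace (mtop N)"
    then have "fst z \<in> topspace (mtop M)" "snd z \<in> topspace (mtop N)" by auto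
    obtain U a where Ua: "(U, a) \<in> atlas M" "fst z \<in> U"
      using charted_cover[OF M \<open>fst z \<in> _\<close>] by blast
    obtain V b where Vb: "(V, b) \<in> atlas N" "snd z \<in> V"
      using charted_cover[OF N \<open>snd z \<in> _\<close>] by blast
    have "(U \<times> V, map_prod a b) \<in> atlas (prod_manifold M N)"
      using Ua Vb unfolding prod_manifold_def by auto
    moreover have "z \<in> U \<times> V" using Ua Vb by (cases z) auto
    ultimately show "z \<in> (\<Union>c \<in> atlas (prod_manifold M N). fst c)" by fastforce
  qed
  ultimately show ?thesis
    unfolding charted_def by (auto simp: prod_manifold_def)
qed

text \<open>
  Plots, in the sense of diffeology.  A manifold is explored through its plots only, which turns all
  differentiation into differentiation of functions between vector spaces.
\<close>
definition plot ::
  "'a::finite_dim_normed_vector set \<Rightarrow> ('p, 'e::finite_dim_normed_vector) manifold \<Rightarrow> ('a \<Rightarrow> 'p) \<Rightarrow> bool"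
where
  "plot S M f \<longleftrightarrow> open S \<and> continuous_map (top_of_set S) (mtop M) f \<and>
     (\<forall>(V, b) \<in> atlas M. smooth_on (\<lambda>x. b (f x)) {x \<in> S. f x \<in> V})"

lemma plot_open: "plot S M f \<Longrightarrow> open S"
  and plot_continuous: "plot S M f \<Longrightarrow> continuous_map (top_of_set S) (mtop M) f"
  and plot_chart: "plot S M f \<Longrightarrow> (V, b) \<in> atlas M \<Longrightarrow> smooth_on (\<lambda>x. b (f x)) {x \<in> S. f x \<in> V}"
  unfolding plot_def by auto

lemma plot_in_topspace: "plot S M f \<Longrightarrow> x \<in> S \<Longrightarrow> f x \<in> topspace (mtop M)"
  using plot_continuous[of S M f] by (auto simp: continuous_map_def Pi_iff)

lemma plot_open_preimage:
  assumes "plot S M f" "openin (mtop M) W"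
  shows "open {x \<in> S. f x \<in> W}"
proof -
  have "openin (top_of_set S) {x \<in> S. f x \<in> W}"
    using openin_continuous_map_preimage[OF plot_continuous[OF assms(1)] assms(2)] by simp
  then show ?thesis
    using plot_open[OF assms(1)] openin_open_trans by blast
qed

lemma plot_iff_smooth_map:
  assumes "charted M" "open S"
  shows "plot S M f \<longleftrightarrow> smooth_map (open_submanifold S) M f"
proof -
  have "smooth_on (\<lambda>x. b (f x)) {x \<in> S. f x \<in> V} \<longleftrightarrow>
      smooth_on (b \<circ> f \<circ> inv_into S (\<lambda>x. x)) ((\<lambda>x. x) ` (S \<inter> f -` V))"
    if f: "continuous_map (top_of_set S) (mtop M) f" and V: "(V, b) \<in> atlas M" for V b
  proof -
    have "openin (top_of_set S) {x \<in> S. f x \<in> V}"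
      using openin_continuous_map_preimage[OF f charted_openin[OF assms(1) V]] by simp
    then have op: "open {x \<in> S. f x \<in> V}"
      using assms(2) openin_open_trans by blast
    have eq: "(\<lambda>x. x) ` (S \<inter> f -` V) = {x \<in> S. f x \<in> V}" by auto
    have inv: "inv_into S (\<lambda>x. x) x = x" if "x \<in> S" for x
      using inv_into_f_f[of "\<lambda>x. x" S x] that by simp
    show ?thesis
      unfolding eq
    proof
      assume "smooth_on (\<lambda>x. b (f x)) {x \<in> S. f x \<in> V}"
      then show "smooth_on (b \<circ> f \<circ> inv_into S (\<lambda>x. x)) {x \<in> S. f x \<in> V}"
        by (rule smooth_on_cong[OF op]) (simp add: inv)
    next
      assume "smooth_on (b \<circ> f \<circ> inv_into S (\<lambda>x. x)) {x \<in> S. f x \<in> V}"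
      then show "smooth_on (\<lambda>x. b (f x)) {x \<in> S. f x \<in> V}"
        by (rule smooth_on_cong[OF op]) (simp add: inv)
    qed
  qed
  then show ?thesis
    unfolding plot_def smooth_map_def using assms(2)
    by (auto simp: open_submanifold_def)
qed

lemma plot_cong:
  assumes M: "charted M" and f: "plot S M f" and eq: "\<And>x. x \<in> S \<Longrightarrow> f x = g x"
  shows "plot S M g"
  unfolding plot_def
proof (intro conjI ballI)
  show "open S" by (rule plot_open[OF f])
  show "continuous_map (top_of_set S) (mtop M) g"
    using plot_continuous[OF f] eq by (rule continuous_map_eq) simp
  fix c assume "c \<in> atlas M"
  then obtain V b where c: "c = (V, b)" "(V, b) \<in> atlas M" by (cases c) auto
  have S: "{x \<in> S. f x \<in> V} = {x \<in> S. g x \<in> V}" using eq by auto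
  have "smooth_on (\<lambda>x. b (g x)) {x \<in> S. f x \<in> V}"
    using plot_open_preimage[OF f charted_openin[OF M c(2)]] plot_chart[OF f c(2)]
    by (rule smooth_on_cong) (simp add: eq)
  then show "case c of (V, b) \<Rightarrow> smooth_on (\<lambda>x. b (g x)) {x \<in> S. g x \<in> V}"
    by (simp add: c(1) S)
qed

lemma plot_local:
  assumes S: "open S" and M: "charted M"
    and loc: "\<And>x. x \<in> S \<Longrightarrow> \<exists>T. x \<in> T \<and> T \<subseteq> S \<and> plot T M f"
  shows "plot S M f"
proof -
  have op: "open {x \<in> S. f x \<in> W}" if "openin (mtop M) W" for W
  proof (rule Topological_Spaces.openI)
    fix x assume x: "x \<in> {x \<in> S. f x \<in> W}"
    then obtain T where T: "x \<in> T" "T \<subseteq> S" "plot T M f" using loc by blast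
    show "\<exists>T. open T \<and> x \<in> T \<and> T \<subseteq> {x \<in> S. f x \<in> W}"
      using plot_open_preimage[OF T(3) that] T x by (intro exI[of _ "{x \<in> T. f x \<in> W}"]) auto
  qed
  have "f x \<in> topspace (mtop M)" if "x \<in> S" for x
    using loc[OF that] plot_in_topspace by blast
  then have "continuous_map (top_of_set S) (mtop M) f"
    using op S by (auto simp: continuous_map_def openin_open_eq)
  moreover have "smooth_on (\<lambda>x. b (f x)) {x \<in> S. f x \<in> V}" if "(V, b) \<in> atlas M" for V b
  proof (rule smooth_on_local)
    fix x assume x: "x \<in> {x \<in> S. f x \<in> V}"
    then obtain T where T: "x \<in> T" "T \<subseteq> S" "plot T M f" using loc by blast
    show "\<exists>T. open T \<and> x \<in> T \<and> T \<subseteq> {x \<in> S. f x \<in> V} \<and> smooth_on (\<lambda>x. b (f x)) T"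
      using plot_open_preimage[OF T(3) charted_openin[OF M that]] plot_chart[OF T(3) that] T x
      by (intro exI[of _ "{x \<in> T. f x \<in> V}"]) auto
  qed
  ultimately show ?thesis
    using S by (auto simp: plot_def)
qed

lemma plot_precompose:
  assumes M: "charted M" and f: "plot S M f" and k: "open T" "smooth_on k T" "k ` T \<subseteq> S"
  shows "plot T M (\<lambda>x. f (k x))"
proof -
  have "continuous_map (top_of_set T) (top_of_set S) k"
    using smooth_on_imp_continuous_on[OF k(2)] k(3) by (auto simp: continuous_map_in_subtopology)
  from continuous_map_compose[OF this plot_continuous[OF f]]
  have cont: "continuous_map (top_of_set T) (mtop M) (\<lambda>x. f (k x))"
    by (simp add: o_def)
  moreover have "smooth_on (\<lambda>x. b (f (k x))) {x \<in> T. f (k x) \<in> V}" if V: "(V, b) \<in> atlas M" for V b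
  proof -
    have "openin (top_of_set T) {x \<in> T. f (k x) \<in> V}"
      using openin_continuous_map_preimage[OF cont charted_openin[OF M V]] by simp
    then have "open {x \<in> T. f (k x) \<in> V}"
      using k(1) openin_open_trans by blast
    then show ?thesis
      using k(3) by (intro smooth_on_compose[where f = k and g = "\<lambda>y. b (f y)", OF _ _ _ _ plot_chart[OF f V]]
          plot_open_preimage[OF f charted_openin[OF M V]] smooth_on_subset[OF k(2)]) auto
  qed
  ultimately show ?thesis using k(1) by (auto simp: plot_def)
qed

lemma plot_subset: "charted M \<Longrightarrow> plot S M f \<Longrightarrow> open T \<Longrightarrow> T \<subseteq> S \<Longrightarrow> plot T M f"
  using plot_precompose[of M S f T "\<lambda>x. x"] smooth_on_id[of T] by auto

lemma plot_const:
  assumes "open S" "p \<in> topspace (mtop M)"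
  shows "plot S M (\<lambda>_. p)"
proof -
  have "open {x \<in> S. p \<in> V}" for V using assms(1) by (cases "p \<in> V") simp_all
  then show ?thesis
    using assms by (auto simp: plot_def intro!: smooth_on_const)
qed

lemma plot_Pair:
  assumes M: "charted M" and N: "charted N" and f: "plot S M f" and g: "plot S N g"
  shows "plot S (prod_manifold M N) (\<lambda>x. (f x, g x))"
proof -
  have "smooth_on (\<lambda>x. (a (f x), b (g x))) {x \<in> S. f x \<in> U \<and> g x \<in> V}"
    if "(U, a) \<in> atlas M" "(V, b) \<in> atlas N" for U a V b
  proof -
    have "open ({x \<in> S. f x \<in> U} \<inter> {x \<in> S. g x \<in> V})"
      by (intro open_Int plot_open_preimage[OF f charted_openin[OF M that(1)]]
          plot_open_preimage[OF g charted_openin[OF N that(2)]])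
    moreover have eq: "{x \<in> S. f x \<in> U} \<inter> {x \<in> S. g x \<in> V} = {x \<in> S. f x \<in> U \<and> g x \<in> V}"
      by auto
    ultimately show ?thesis
      by (intro smooth_on_Pair smooth_on_subset[OF plot_chart[OF f that(1)]]
          smooth_on_subset[OF plot_chart[OF g that(2)]]) auto
  qed
  then show ?thesis
    using plot_open[OF f] plot_continuous[OF f] plot_continuous[OF g]
    unfolding plot_def prod_manifold_def by (auto simp: continuous_map_paired)
qed

text \<open>
  Near a given point, the chart expression of the composition is the chart expression of \<open>F\<close> applied
  to that of \<open>f\<close>.
\<close>
lemma plot_compose_smooth_map:
  assumes M: "charted M" and N: "charted N" and f: "plot S M f" and F: "smooth_map M N F"
  shows "plot S N (\<lambda>x. F (f x))"
proof -
  have contF: "continuous_map (mtop M) (mtop N) F"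
    using F by (simp add: smooth_map_def)
  have cont: "continuous_map (top_of_set S) (mtop N) (\<lambda>x. F (f x))"
    using continuous_map_compose[OF plot_continuous[OF f] contF] by (simp add: o_def)
  moreover have "smooth_on (\<lambda>x. c (F (f x))) {x \<in> S. F (f x) \<in> V}" if V: "(V, c) \<in> atlas N" for V c
  proof (rule smooth_on_local)
    fix x assume x: "x \<in> {x \<in> S. F (f x) \<in> V}"
    then obtain U a where U: "(U, a) \<in> atlas M" "f x \<in> U"
      using charted_cover[OF M plot_in_topspace[OF f]] by (metis mem_Collect_eq)
    let ?W = "{p \<in> U. F p \<in> V}" and ?T = "{y \<in> S. f y \<in> {p \<in> U. F p \<in> V}}"
    have W: "openin (mtop M) ?W"
      by (rule openin_continuous_map_preimage_gen[OF contF charted_openin[OF M U(1)] charted_openin[OF N V]])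
    have T: "open ?T" by (rule plot_open_preimage[OF f W])
    have "smooth_on (c \<circ> F \<circ> inv_into U a) (a ` (U \<inter> F -` V))"
      using F U(1) V unfolding smooth_map_def by fastforce
    moreover have "U \<inter> F -` V = ?W" by auto
    ultimately have g: "smooth_on (c \<circ> F \<circ> inv_into U a) (a ` ?W)" by simp
    have "open (a ` ?W)"
      by (rule charted_open_image[OF M U(1) W]) auto
    then have "smooth_on (\<lambda>y. (c \<circ> F \<circ> inv_into U a) (a (f y))) ?T"
      by (rule smooth_on_compose[where f = "\<lambda>y. a (f y)", OF T _ _ _ g])
        (auto intro: smooth_on_subset[OF plot_chart[OF f U(1)]])
    then have "smooth_on (\<lambda>y. c (F (f y))) ?T"
      by (rule smooth_on_cong[OF T]) (use charted_inj_on[OF M U(1)] in auto)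
    then show "\<exists>T. open T \<and> x \<in> T \<and> T \<subseteq> {x \<in> S. F (f x) \<in> V} \<and> smooth_on (\<lambda>x. c (F (f x))) T"
      using T x U(2) by (intro exI[of _ ?T]) auto
  qed
  ultimately show ?thesis
    using plot_open[OF f] by (auto simp: plot_def)
qed

text \<open>
  The chart expressions of an inverse chart are the transition maps.
\<close>
lemma plot_inverse_chart:
  assumes M: "smooth_manifold M" and U: "(U, a) \<in> atlas M"
  shows "plot (a ` U) M (inv_into U a)"
proof -
  note ch = smooth_manifold_imp_charted[OF M]
  note inj = charted_inj_on[OF ch U]
  note op = charted_openin[OF ch U]
  have pre: "{y \<in> a ` U. inv_into U a y \<in> W} = a ` (U \<inter> W)" for W
    using inj by auto
  have "inv_into U a y \<in> topspace (mtop M)" if "y \<in> a ` U" for y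
    using openin_subset[OF op] inv_into_into[OF that] by blast
  moreover have "open (a ` (U \<inter> W))" if "openin (mtop M) W" for W
    by (rule charted_open_image[OF ch U]) (use op that in auto)
  moreover have opU: "open (a ` U)"
    by (rule charted_open_image[OF ch U op]) simp
  ultimately have "continuous_map (top_of_set (a ` U)) (mtop M) (inv_into U a)"
    unfolding continuous_map_def
    by (simp only: topspace_euclidean_subtopology pre openin_open_eq[OF opU]) auto
  moreover have "smooth_on (\<lambda>x. b (inv_into U a x)) {x \<in> a ` U. inv_into U a x \<in> V}"
    if V: "(V, b) \<in> atlas M" for V b
  proof -
    have "smooth_transition (U, a) (V, b)"
      using M U V by (simp add: smooth_manifold_def)
    then show ?thesis
      unfolding pre by (simp add: smooth_transition_def o_def)
  qed
  ultimately show ?thesis using opU by (auto simp: plot_def)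
qed

lemma plot_open_submanifold:
  assumes "open T" "smooth_on k T" "k ` T \<subseteq> S"
  shows "plot T (open_submanifold S) k"
proof -
  have "{x \<in> T. k x \<in> S} = T" using assms(3) by auto
  then show ?thesis
    using assms smooth_on_imp_continuous_on[OF assms(2)]
    by (auto simp: plot_def open_submanifold_def continuous_map_in_subtopology)
qed

section \<open>The logarithmic derivative in a Lie group\<close>

context lie_group
begin

lemma charted_M: "charted M"
  by (rule smooth_manifold_imp_charted[OF manifold])

lemma plot_in_carrier: "plot S M f \<Longrightarrow> x \<in> S \<Longrightarrow> f x \<in> carrier G"
  using plot_in_topspace topspace_eq_carrier by metis

lemma plot_mult:
  assumes "plot S M f" "plot S M g"
  shows "plot S M (\<lambda>x. f x \<otimes> g x)"
  using plot_compose_smooth_map[OF charted_prod_manifold[OF charted_M charted_M] charted_M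
      plot_Pair[OF charted_M charted_M assms] smooth_mult] by simp

lemma plot_inv: "plot S M f \<Longrightarrow> plot S M (\<lambda>x. inv (f x))"
  by (rule plot_compose_smooth_map[OF charted_M charted_M _ smooth_inv])

lemma plot_constant: "open S \<Longrightarrow> g \<in> carrier G \<Longrightarrow> plot S M (\<lambda>_. g)"
  by (rule plot_const) (auto simp: topspace_eq_carrier)

text \<open>
  This chart identifies the Lie algebra, the tangent space at the unit, with the model space.  Its
  domain, the chart itself, its inverse, its range and the image of the unit are named next.
\<close>
definition unit_chart :: "'g set \<times> ('g \<Rightarrow> 'e)" where
  "unit_chart = (SOME c. c \<in> atlas M \<and> \<one> \<in> fst c)"

definition unit_nbhd :: "'g set" where "unit_nbhd = fst unit_chart"
definition coord :: "'g \<Rightarrow> 'e" where "coord = snd unit_chart"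
definition elem :: "'e \<Rightarrow> 'g" where "elem = inv_into unit_nbhd coord"
definition coords :: "'e set" where "coords = coord ` unit_nbhd"
definition origin :: 'e where "origin = coord \<one>"

lemma unit_chart: "(unit_nbhd, coord) \<in> atlas M" and one_in_unit_nbhd: "\<one> \<in> unit_nbhd"
proof -
  have "\<one> \<in> topspace (mtop M)" by (simp add: topspace_eq_carrier)
  then obtain U a where "(U, a) \<in> atlas M" "\<one> \<in> U"
    by (rule charted_cover[OF charted_M])
  then have "\<exists>c. c \<in> atlas M \<and> \<one> \<in> fst c"
    by (intro exI[of _ "(U, a)"]) simp
  from someI_ex[OF this] have "unit_chart \<in> atlas M \<and> \<one> \<in> fst unit_chart"
    by (simp add: unit_chart_def)
  then show "(unit_nbhd, coord) \<in> atlas M" "\<one> \<in> unit_nbhd"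
    by (simp_all add: unit_nbhd_def coord_def)
qed

lemma openin_unit_nbhd: "openin (mtop M) unit_nbhd"
  by (rule charted_openin[OF charted_M unit_chart])

lemma unit_nbhd_carrier: "p \<in> unit_nbhd \<Longrightarrow> p \<in> carrier G"
  using openin_subset[OF openin_unit_nbhd] topspace_eq_carrier by auto

lemma plot_elem: "plot coords M elem"
  unfolding coords_def elem_def by (rule plot_inverse_chart[OF manifold unit_chart])

lemma open_coords: "open coords"
  by (rule plot_open[OF plot_elem])

lemma elem_coord: "p \<in> unit_nbhd \<Longrightarrow> elem (coord p) = p"
  unfolding elem_def by (rule inv_into_f_f[OF charted_inj_on[OF charted_M unit_chart]])

lemma coord_elem: "y \<in> coords \<Longrightarrow> coord (elem y) = y"
  unfolding elem_def coords_def by (rule f_inv_into_f)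

lemma elem_in_unit_nbhd: "y \<in> coords \<Longrightarrow> elem y \<in> unit_nbhd"
  unfolding elem_def coords_def by (rule inv_into_into)

lemma coord_in_coords: "p \<in> unit_nbhd \<Longrightarrow> coord p \<in> coords"
  unfolding coords_def by (rule imageI)

lemma elem_carrier: "y \<in> coords \<Longrightarrow> elem y \<in> carrier G"
  by (intro unit_nbhd_carrier elem_in_unit_nbhd)

lemma origin_in_coords: "origin \<in> coords" and elem_origin: "elem origin = \<one>"
  unfolding origin_def using one_in_unit_nbhd by (auto intro: coord_in_coords elem_coord)

lemma smooth_on_coord: "plot S M f \<Longrightarrow> smooth_on (\<lambda>x. coord (f x)) {x \<in> S. f x \<in> unit_nbhd}"
  by (rule plot_chart[OF _ unit_chart])

lemma open_coord_domain: "plot S M f \<Longrightarrow> open {x \<in> S. f x \<in> unit_nbhd}"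
  by (rule plot_open_preimage[OF _ openin_unit_nbhd])

lemma coord_has_derivative:
  assumes "plot S M f" "x \<in> S" "f x \<in> unit_nbhd"
  shows "((\<lambda>x. coord (f x)) has_derivative frechet_derivative (\<lambda>x. coord (f x)) (at x)) (at x)"
  by (rule smooth_on_has_derivative[OF smooth_on_coord[OF assms(1)] open_coord_domain[OF assms(1)]])
    (use assms in auto)

text \<open>
  The element \<open>\<gamma>'(t) \<gamma>(t)\<^sup>-\<^sup>1\<close> of the Lie algebra.  The curve is translated so that it passes through
  the unit at time \<open>t\<close>, which makes the unit chart sufficient to differentiate it.
\<close>
definition dlog :: "(real \<Rightarrow> 'g) \<Rightarrow> real \<Rightarrow> 'e" where
  "dlog \<gamma> t = vector_derivative (\<lambda>s. coord (\<gamma> s \<otimes> inv (\<gamma> t))) (at t)"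

text \<open>
  The adjoint representation, read in the unit chart.
\<close>
definition Ad :: "'g \<Rightarrow> 'e \<Rightarrow> 'e" where
  "Ad g = frechet_derivative (\<lambda>y. coord (g \<otimes> elem y \<otimes> inv g)) (at origin)"

text \<open>
  The differential at the unit of the right translation by \<open>k\<close>, read in the unit chart at both ends;
  it is meaningful for \<open>k\<close> in the domain of this chart.
\<close>
definition Rt :: "'g \<Rightarrow> 'e \<Rightarrow> 'e" where
  "Rt k = frechet_derivative (\<lambda>y. coord (elem y \<otimes> k)) (at origin)"

lemma plot_right_translate:
  assumes "plot J M \<gamma>" "k \<in> carrier G"
  shows "plot J M (\<lambda>s. \<gamma> s \<otimes> k)"
  by (rule plot_mult[OF assms(1) plot_constant[OF plot_open[OF assms(1)] assms(2)]])

lemma dlog_has_vector_derivative: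
  assumes "plot J M \<gamma>" "t \<in> J"
  shows "((\<lambda>s. coord (\<gamma> s \<otimes> inv (\<gamma> t))) has_vector_derivative dlog \<gamma> t) (at t)"
proof -
  have g: "\<gamma> t \<in> carrier G" by (rule plot_in_carrier[OF assms])
  have p: "plot J M (\<lambda>s. \<gamma> s \<otimes> inv (\<gamma> t))"
    using g by (intro plot_right_translate[OF assms(1)]) simp
  show ?thesis
    unfolding dlog_def
    by (rule smooth_on_has_vector_derivative[OF smooth_on_coord[OF p] open_coord_domain[OF p]])
      (use assms(2) g one_in_unit_nbhd in simp)
qed

lemma dlog_eqI:
  assumes "((\<lambda>s. coord (\<gamma> s \<otimes> inv (\<gamma> t))) has_vector_derivative v) (at t)"
  shows "dlog \<gamma> t = v"
  unfolding dlog_def by (rule vector_derivative_at[OF assms])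

lemma dlog_cong:
  assumes "open S" "t \<in> S" "\<And>s. s \<in> S \<Longrightarrow> \<gamma> s = \<eta> s" and "plot S M \<gamma>"
  shows "dlog \<eta> t = dlog \<gamma> t"
proof (rule dlog_eqI)
  show "((\<lambda>s. coord (\<eta> s \<otimes> inv (\<eta> t))) has_vector_derivative dlog \<gamma> t) (at t)"
    by (rule has_vector_derivative_transform_within_open[OF
          dlog_has_vector_derivative[OF assms(4,2)] assms(1,2)])
      (use assms(2,3) in auto)
qed

lemma dlog_const:
  assumes "g \<in> carrier G"
  shows "dlog (\<lambda>_. g) t = 0"
  by (rule dlog_eqI) auto

lemma Ad_has_derivative:
  assumes g: "g \<in> carrier G"
  shows "((\<lambda>y. coord (g \<otimes> elem y \<otimes> inv g)) has_derivative Ad g) (at origin)"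
proof -
  have "plot coords M (\<lambda>y. g \<otimes> elem y \<otimes> inv g)"
    using g by (intro plot_mult plot_constant plot_elem open_coords) auto
  then show ?thesis
    unfolding Ad_def
    by (rule coord_has_derivative)
      (use g origin_in_coords elem_origin one_in_unit_nbhd in auto)
qed

lemma bounded_linear_Ad: "g \<in> carrier G \<Longrightarrow> bounded_linear (Ad g)"
  using Ad_has_derivative has_derivative_bounded_linear by blast

lemma Rt_has_derivative:
  assumes k: "k \<in> unit_nbhd"
  shows "((\<lambda>y. coord (elem y \<otimes> k)) has_derivative Rt k) (at origin)"
proof -
  have k': "k \<in> carrier G" by (rule unit_nbhd_carrier[OF k])
  have "plot coords M (\<lambda>y. elem y \<otimes> k)"
    by (rule plot_right_translate[OF plot_elem k'])
  then show ?thesis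
    unfolding Rt_def
    by (rule coord_has_derivative) (use k k' origin_in_coords elem_origin in auto)
qed

text \<open>
  The right translation by \<open>k\<close> has a smooth inverse, so its differential has a left inverse by the
  chain rule.
\<close>
lemma Rt_inj:
  assumes k: "k \<in> unit_nbhd" and eq: "Rt k v = Rt k w"
  shows "v = w"
proof -
  have k': "k \<in> carrier G" by (rule unit_nbhd_carrier[OF k])
  let ?f = "\<lambda>y. coord (elem y \<otimes> k)" and ?h = "\<lambda>z. coord (elem z \<otimes> inv k)"
  have fo: "?f origin = coord k" using k' elem_origin by simp
  have ph: "plot coords M (\<lambda>z. elem z \<otimes> inv k)"
    using k' by (intro plot_right_translate[OF plot_elem]) simp
  define D where "D = frechet_derivative ?h (at (coord k))"
  have h: "(?h has_derivative D) (at (?f origin))"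
    unfolding fo D_def
    by (rule coord_has_derivative[OF ph])
      (use k k' one_in_unit_nbhd in \<open>auto simp: coord_in_coords elem_coord\<close>)
  have comp: "((\<lambda>y. ?h (?f y)) has_derivative (\<lambda>v. D (Rt k v))) (at origin)"
    by (rule has_derivative_compose[where f = ?f and g = ?h, OF Rt_has_derivative[OF k] h])
  have pf: "plot coords M (\<lambda>y. elem y \<otimes> k)"
    by (rule plot_right_translate[OF plot_elem k'])
  have id: "((\<lambda>y. y) has_derivative (\<lambda>v. D (Rt k v))) (at origin)"
  proof (rule has_derivative_transform_within_open[OF comp open_coord_domain[OF pf]])
    show "origin \<in> {y \<in> coords. elem y \<otimes> k \<in> unit_nbhd}"
      using k k' origin_in_coords elem_origin by simp
    fix y assume y: "y \<in> {y \<in> coords. elem y \<otimes> k \<in> unit_nbhd}"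
    then have "elem (?f y) \<otimes> inv k = elem y"
      using k' elem_carrier[of y] by (simp add: elem_coord m_assoc)
    then show "?h (?f y) = y" using y by (simp add: coord_elem)
  qed
  note left_inverse = fun_cong[OF has_derivative_unique[OF id has_derivative_ident]]
  have "v = D (Rt k v)" by (rule left_inverse[symmetric])
  also have "\<dots> = D (Rt k w)" by (simp only: eq)
  also have "\<dots> = w" by (rule left_inverse)
  finally show ?thesis .
qed

text \<open>
  The usual velocity of a curve in the chart is recovered from the logarithmic derivative by writing
  \<open>\<gamma>(s) k = (\<gamma>(s) \<gamma>(t)\<^sup>-\<^sup>1) (\<gamma>(t) k)\<close> and applying the chain rule.
\<close>
lemma coord_right_translate_has_vector_derivative:
  assumes \<gamma>: "plot J M \<gamma>" and t: "t \<in> J" and k: "k \<in> carrier G" and nbhd: "\<gamma> t \<otimes> k \<in> unit_nbhd"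
  shows "((\<lambda>s. coord (\<gamma> s \<otimes> k)) has_vector_derivative Rt (\<gamma> t \<otimes> k) (dlog \<gamma> t)) (at t)"
proof -
  have g: "\<gamma> t \<in> carrier G" by (rule plot_in_carrier[OF \<gamma> t])
  let ?p = "\<lambda>s. coord (\<gamma> s \<otimes> inv (\<gamma> t))" and ?m = "\<lambda>y. coord (elem y \<otimes> (\<gamma> t \<otimes> k))"
  have plot: "plot J M (\<lambda>s. \<gamma> s \<otimes> inv (\<gamma> t))"
    using g by (intro plot_right_translate[OF \<gamma>]) simp
  have p0: "?p t = origin" using g by (simp add: origin_def)
  have comp: "((\<lambda>s. ?m (?p s)) has_vector_derivative Rt (\<gamma> t \<otimes> k) (dlog \<gamma> t)) (at t)"
    by (rule has_vector_derivative_compose_at[where f = ?p and g = ?m,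
          OF dlog_has_vector_derivative[OF \<gamma> t]])
      (unfold p0, rule Rt_has_derivative[OF nbhd])
  show ?thesis
  proof (rule has_vector_derivative_transform_within_open[OF comp open_coord_domain[OF plot]])
    show "t \<in> {s \<in> J. \<gamma> s \<otimes> inv (\<gamma> t) \<in> unit_nbhd}"
      using t g one_in_unit_nbhd by simp
    fix s assume s: "s \<in> {s \<in> J. \<gamma> s \<otimes> inv (\<gamma> t) \<in> unit_nbhd}"
    then have gs: "\<gamma> s \<in> carrier G" using plot_in_carrier[OF \<gamma>] by blast
    have "elem (?p s) \<otimes> (\<gamma> t \<otimes> k) = \<gamma> s \<otimes> k"
    proof -
      have "elem (?p s) \<otimes> (\<gamma> t \<otimes> k) = \<gamma> s \<otimes> (inv (\<gamma> t) \<otimes> \<gamma> t) \<otimes> k"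
        using s g gs k by (simp only: elem_coord mem_Collect_eq m_assoc m_closed inv_closed)
      then show ?thesis using g gs by simp
    qed
    then show "?m (?p s) = coord (\<gamma> s \<otimes> k)" by simp
  qed
qed

text \<open>
  With \<open>g = \<gamma>(t)\<close> and \<open>k = \<eta>(t)\<close>, the translated product \<open>\<gamma>(s) \<eta>(s) (g k)\<^sup>-\<^sup>1\<close> equals
  \<open>(\<gamma>(s) g\<^sup>-\<^sup>1) (g (\<eta>(s) k\<^sup>-\<^sup>1) g\<^sup>-\<^sup>1)\<close>, a product of two curves through the unit.  The differential of
  the multiplication at \<open>(\<one>, \<one>)\<close> adds the velocities of the factors.
\<close>
lemma dlog_mult:
  assumes \<gamma>: "plot J M \<gamma>" and \<eta>: "plot J M \<eta>" and t: "t \<in> J"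
  shows "dlog (\<lambda>s. \<gamma> s \<otimes> \<eta> s) t = dlog \<gamma> t + Ad (\<gamma> t) (dlog \<eta> t)"
proof (rule dlog_eqI)
  define g where "g = \<gamma> t"
  define k where "k = \<eta> t"
  have g: "g \<in> carrier G" and k: "k \<in> carrier G"
    unfolding g_def k_def by (rule plot_in_carrier[OF _ t]; fact)+
  let ?f = "\<lambda>z. elem (fst z) \<otimes> (g \<otimes> elem (snd z) \<otimes> inv g)"
  let ?m = "\<lambda>z. coord (?f z)"
  have pf: "plot (coords \<times> coords) M ?f"
  proof (intro plot_mult plot_constant)
    have op: "open (coords \<times> coords)" by (intro open_Times open_coords)
    have sm: "smooth_on fst (coords \<times> coords)" "smooth_on snd (coords \<times> coords)"
      using smooth_on_fst[OF op smooth_on_id[OF op]] smooth_on_snd[OF op smooth_on_id[OF op]] by simp_all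
    show "plot (coords \<times> coords) M (\<lambda>z. elem (fst z))" "plot (coords \<times> coords) M (\<lambda>z. elem (snd z))"
      by (rule plot_precompose[OF charted_M plot_elem op], use sm in auto)+
    show "open (coords \<times> coords)" by (rule op)
    show "open (coords \<times> coords)" by (rule op)
  qed (use g in auto)
  define D where "D = frechet_derivative ?m (at (origin, origin))"
  have D: "(?m has_derivative D) (at (origin, origin))"
    unfolding D_def
    by (rule coord_has_derivative[OF pf])
      (use g origin_in_coords elem_origin one_in_unit_nbhd in auto)
  have lin: "linear D" using D has_derivative_linear by blast
  have D1: "D (u, 0) = u" for u
  proof -
    have "((\<lambda>y. ?m (y, origin)) has_derivative (\<lambda>u. D (u, 0))) (at origin)"
      by (rule has_derivative_compose[where f = "\<lambda>y. (y, origin)" and g = ?m, OF _ D])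
        (auto intro!: derivative_eq_intros)
    then have "((\<lambda>y. y) has_derivative (\<lambda>u. D (u, 0))) (at origin)"
      by (rule has_derivative_transform_within_open[OF _ open_coords origin_in_coords])
        (use g elem_origin in \<open>simp add: elem_carrier coord_elem\<close>)
    from has_derivative_unique[OF this has_derivative_ident] show ?thesis by metis
  qed
  have D2: "D (0, v) = Ad g v" for v
  proof -
    have "((\<lambda>y. ?m (origin, y)) has_derivative (\<lambda>v. D (0, v))) (at origin)"
      by (rule has_derivative_compose[where f = "\<lambda>y. (origin, y)" and g = ?m, OF _ D])
        (auto intro!: derivative_eq_intros)
    then have "((\<lambda>y. coord (g \<otimes> elem y \<otimes> inv g)) has_derivative (\<lambda>v. D (0, v))) (at origin)"
      by (rule has_derivative_transform_within_open[OF _ open_coords origin_in_coords])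
        (use g elem_origin in \<open>simp add: elem_carrier\<close>)
    from has_derivative_unique[OF this Ad_has_derivative[OF g]] show ?thesis by metis
  qed
  let ?p = "\<lambda>s. coord (\<gamma> s \<otimes> inv g)" and ?r = "\<lambda>s. coord (\<eta> s \<otimes> inv k)"
  have p: "(?p has_vector_derivative dlog \<gamma> t) (at t)"
    unfolding g_def by (rule dlog_has_vector_derivative[OF \<gamma> t])
  have r: "(?r has_vector_derivative dlog \<eta> t) (at t)"
    unfolding k_def by (rule dlog_has_vector_derivative[OF \<eta> t])
  have pr: "((\<lambda>s. (?p s, ?r s)) has_vector_derivative (dlog \<gamma> t, dlog \<eta> t)) (at t)"
    by (rule has_vector_derivative_Pair[OF p r])
  have pr0: "(?p t, ?r t) = (origin, origin)"
    using g k by (simp add: g_def k_def origin_def)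
  have "((\<lambda>s. ?m (?p s, ?r s)) has_vector_derivative D (dlog \<gamma> t, dlog \<eta> t)) (at t)"
    by (rule has_vector_derivative_compose_at[where f = "\<lambda>s. (?p s, ?r s)" and g = ?m, OF pr])
      (unfold pr0, rule D)
  moreover have "D (dlog \<gamma> t, dlog \<eta> t) = dlog \<gamma> t + Ad g (dlog \<eta> t)"
    using linear_add[OF lin, of "(dlog \<gamma> t, 0)" "(0, dlog \<eta> t)"] by (simp add: D1 D2)
  ultimately have comp: "((\<lambda>s. ?m (?p s, ?r s)) has_vector_derivative dlog \<gamma> t + Ad g (dlog \<eta> t)) (at t)"
    by simp
  have plots: "plot J M (\<lambda>s. \<gamma> s \<otimes> inv g)" "plot J M (\<lambda>s. \<eta> s \<otimes> inv k)"
    using g k by (auto intro: plot_right_translate \<gamma> \<eta>)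
  have "((\<lambda>s. coord (\<gamma> s \<otimes> \<eta> s \<otimes> inv (g \<otimes> k))) has_vector_derivative
      dlog \<gamma> t + Ad g (dlog \<eta> t)) (at t)"
  proof (rule has_vector_derivative_transform_within_open[OF comp
        open_Int[OF open_coord_domain[OF plots(1)] open_coord_domain[OF plots(2)]]])
    show "t \<in> {s \<in> J. \<gamma> s \<otimes> inv g \<in> unit_nbhd} \<inter> {s \<in> J. \<eta> s \<otimes> inv k \<in> unit_nbhd}"
      using t g k one_in_unit_nbhd by (simp add: g_def k_def)
    fix s assume s: "s \<in> {s \<in> J. \<gamma> s \<otimes> inv g \<in> unit_nbhd} \<inter> {s \<in> J. \<eta> s \<otimes> inv k \<in> unit_nbhd}"
    then have c: "\<gamma> s \<in> carrier G" "\<eta> s \<in> carrier G"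
      using plot_in_carrier \<gamma> \<eta> by blast+
    have "?f (?p s, ?r s) = (\<gamma> s \<otimes> inv g) \<otimes> (g \<otimes> (\<eta> s \<otimes> inv k) \<otimes> inv g)"
      using s by (simp add: elem_coord)
    also have "\<dots> = \<gamma> s \<otimes> (inv g \<otimes> g) \<otimes> (\<eta> s \<otimes> (inv k \<otimes> inv g))"
      using c g k by (simp only: m_assoc m_closed inv_closed)
    also have "\<dots> = \<gamma> s \<otimes> \<eta> s \<otimes> inv (g \<otimes> k)"
      using c g k by (simp add: inv_mult_group m_assoc)
    finally show "?m (?p s, ?r s) = coord (\<gamma> s \<otimes> \<eta> s \<otimes> inv (g \<otimes> k))" by simp
  qed
  then show "((\<lambda>s. coord (\<gamma> s \<otimes> \<eta> s \<otimes> inv (\<gamma> t \<otimes> \<eta> t))) has_vector_derivative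
      dlog \<gamma> t + Ad (\<gamma> t) (dlog \<eta> t)) (at t)"
    by (simp add: g_def k_def)
qed

lemma dlog_mult_const:
  assumes \<gamma>: "plot J M \<gamma>" and k: "k \<in> carrier G" and t: "t \<in> J"
  shows "dlog (\<lambda>s. \<gamma> s \<otimes> k) t = dlog \<gamma> t"
proof -
  have "linear (Ad (\<gamma> t))"
    using bounded_linear_Ad[OF plot_in_carrier[OF \<gamma> t]] by (rule bounded_linear.linear)
  then show ?thesis
    using dlog_mult[OF \<gamma> plot_constant[OF plot_open[OF \<gamma>] k] t]
    by (simp add: dlog_const[OF k] linear_0)
qed

text \<open>
  In the unit chart, translated to a point of the curve, the velocity vanishes; so the curve is locally
  constant, and constant on the connected set \<open>J\<close>.
\<close>
lemma dlog_zero_imp_constant: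
  assumes \<gamma>: "plot J M \<gamma>" and J: "is_interval J" and zero: "\<And>t. t \<in> J \<Longrightarrow> dlog \<gamma> t = 0"
    and t: "t \<in> J" "t' \<in> J"
  shows "\<gamma> t = \<gamma> t'"
proof -
  have "open J" by (rule plot_open[OF \<gamma>])
  have loc: "\<exists>e>0. \<forall>s\<in>ball t0 e. s \<in> J \<and> \<gamma> s = \<gamma> t0" if t0: "t0 \<in> J" for t0
  proof -
    have g0: "\<gamma> t0 \<in> carrier G" by (rule plot_in_carrier[OF \<gamma> t0])
    let ?N = "{s \<in> J. \<gamma> s \<otimes> inv (\<gamma> t0) \<in> unit_nbhd}"
    have plot: "plot J M (\<lambda>s. \<gamma> s \<otimes> inv (\<gamma> t0))"
      using g0 by (intro plot_right_translate[OF \<gamma>]) simp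
    have "t0 \<in> ?N" using t0 g0 one_in_unit_nbhd by simp
    then obtain e where e: "e > 0" "ball t0 e \<subseteq> ?N"
      using open_coord_domain[OF plot] open_contains_ball by metis
    let ?f = "\<lambda>s. coord (\<gamma> s \<otimes> inv (\<gamma> t0))"
    have der: "(?f has_derivative (\<lambda>h. 0)) (at s within ball t0 e)" if "s \<in> ball t0 e" for s
    proof -
      have s: "s \<in> J" "\<gamma> s \<otimes> inv (\<gamma> t0) \<in> unit_nbhd" using e(2) that by auto
      have "linear (Rt (\<gamma> s \<otimes> inv (\<gamma> t0)))"
        using Rt_has_derivative[OF s(2)] has_derivative_linear by blast
      then have "(?f has_vector_derivative 0) (at s)"
        using coord_right_translate_has_vector_derivative[OF \<gamma> s(1) _ s(2)] g0 zero[OF s(1)]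
        by (simp add: linear_0)
      then show ?thesis
        by (simp add: has_vector_derivative_def has_derivative_at_withinI)
    qed
    have "\<gamma> s = \<gamma> t0" if s: "s \<in> ball t0 e" for s
    proof -
      have "?f s = ?f t0"
        using has_derivative_zero_unique[OF convex_ball der s, of t0] e(1) by auto
      then have "elem (?f s) = elem (?f t0)" by (rule arg_cong)
      moreover have "\<gamma> s \<otimes> inv (\<gamma> t0) \<in> unit_nbhd" "\<gamma> t0 \<otimes> inv (\<gamma> t0) \<in> unit_nbhd"
        using e(2) s \<open>t0 \<in> ?N\<close> by blast+
      ultimately have eq: "\<gamma> s \<otimes> inv (\<gamma> t0) = \<gamma> t0 \<otimes> inv (\<gamma> t0)"
        by (simp only: elem_coord)
      have "\<gamma> s \<in> carrier G"
        using plot_in_carrier[OF \<gamma>] e(2) s by blast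
      then show ?thesis
        using eq right_cancel[of "inv (\<gamma> t0)" "\<gamma> s" "\<gamma> t0"] g0 by blast
    qed
    then show ?thesis using e by blast
  qed
  have "connected J" using J by (simp add: is_interval_connected)
  moreover have "open {s \<in> J. P (\<gamma> s)}" for P
    unfolding open_contains_ball
  proof
    fix s assume s: "s \<in> {s \<in> J. P (\<gamma> s)}"
    then obtain e where e: "e > 0" "\<forall>r\<in>ball s e. r \<in> J \<and> \<gamma> r = \<gamma> s"
      using loc[of s] by blast
    have "ball s e \<subseteq> {s \<in> J. P (\<gamma> s)}"
    proof
      fix r assume "r \<in> ball s e"
      then have r: "r \<in> J" "\<gamma> r = \<gamma> s" using e(2) by blast+
      then show "r \<in> {s \<in> J. P (\<gamma> s)}" using s by (simp only: mem_Collect_eq)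
    qed
    then show "\<exists>e>0. ball s e \<subseteq> {s \<in> J. P (\<gamma> s)}" using e(1) by blast
  qed
  moreover from this[of "\<lambda>g. g = \<gamma> t"] this[of "\<lambda>g. g \<noteq> \<gamma> t"]
  have "open {s \<in> J. \<gamma> s = \<gamma> t}" "open {s \<in> J. \<gamma> s \<noteq> \<gamma> t}" .
  ultimately have "{s \<in> J. \<gamma> s = \<gamma> t} \<inter> J = {} \<or> {s \<in> J. \<gamma> s \<noteq> \<gamma> t} \<inter> J = {}"
    by (intro connectedD[of J]) auto
  then show ?thesis using t by auto
qed

text \<open>
  The product rule shows that \<open>\<gamma>\<^sup>-\<^sup>1 \<eta>\<close> has the same logarithmic derivative as \<open>\<gamma>\<^sup>-\<^sup>1 \<gamma>\<close>, namely zero.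
\<close>
lemma dlog_unique:
  assumes \<gamma>: "plot J M \<gamma>" and \<eta>: "plot J M \<eta>" and J: "is_interval J"
    and eq: "\<And>t. t \<in> J \<Longrightarrow> dlog \<gamma> t = dlog \<eta> t"
    and t0: "t0 \<in> J" "\<gamma> t0 = \<eta> t0" and t: "t \<in> J"
  shows "\<gamma> t = \<eta> t"
proof -
  let ?\<zeta> = "\<lambda>s. inv (\<gamma> s) \<otimes> \<eta> s"
  have \<gamma>i: "plot J M (\<lambda>s. inv (\<gamma> s))" by (rule plot_inv[OF \<gamma>])
  have \<zeta>: "plot J M ?\<zeta>" by (rule plot_mult[OF \<gamma>i \<eta>])
  have "dlog ?\<zeta> s = 0" if s: "s \<in> J" for s
  proof -
    have "dlog ?\<zeta> s = dlog (\<lambda>s. inv (\<gamma> s)) s + Ad (inv (\<gamma> s)) (dlog \<gamma> s)"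
      using dlog_mult[OF \<gamma>i \<eta> s] eq[OF s] by simp
    also have "\<dots> = dlog (\<lambda>s. inv (\<gamma> s) \<otimes> \<gamma> s) s"
      using dlog_mult[OF \<gamma>i \<gamma> s] by simp
    also have "\<dots> = dlog (\<lambda>_. \<one>) s"
      by (rule dlog_cong[OF plot_open[OF \<gamma>] s _ plot_constant[OF plot_open[OF \<gamma>]]])
        (use plot_in_carrier[OF \<gamma>] in auto)
    finally show ?thesis by (simp add: dlog_const)
  qed
  from dlog_zero_imp_constant[OF \<zeta> J this t t0(1)]
  have "inv (\<gamma> t) \<otimes> \<eta> t = \<one>"
    using t0(2) plot_in_carrier[OF \<eta> t0(1)] by simp
  then have *: "inv (\<eta> t) = inv (\<gamma> t)"
    using plot_in_carrier[OF \<gamma> t] plot_in_carrier[OF \<eta> t] by (intro inv_equality) auto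
  have "\<gamma> t = inv (inv (\<gamma> t))"
    by (rule inv_inv[OF plot_in_carrier[OF \<gamma> t], symmetric])
  also have "\<dots> = inv (inv (\<eta> t))"
    by (simp only: *)
  also have "\<dots> = \<eta> t"
    by (rule inv_inv[OF plot_in_carrier[OF \<eta> t]])
  finally show ?thesis .
qed

section \<open>Curves with prescribed logarithmic derivative\<close>

text \<open>
  The logarithmic derivative is a partial derivative of the smooth map
  \<open>(s, t, y) \<mapsto> f(s, y) f(t, y)\<^sup>-\<^sup>1\<close>, restricted to the diagonal \<open>s = t\<close>.
\<close>
lemma smooth_on_dlog:
  fixes f :: "real \<times> 'a::finite_dim_normed_vector \<Rightarrow> 'g"
  assumes J: "open J" and T: "open T" and f: "plot (J \<times> T) M f"
  shows "smooth_on (\<lambda>p. dlog (\<lambda>s. f (s, snd p)) (fst p)) (J \<times> T)"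
proof -
  define \<Omega> where "\<Omega> = J \<times> (J \<times> T)"
  have op: "open \<Omega>" "open (J \<times> T)"
    unfolding \<Omega>_def by (intro open_Times J T)+
  have sm: "smooth_on (\<lambda>z. (fst z, snd (snd z))) \<Omega>" "smooth_on snd \<Omega>"
    using smooth_on_Pair[OF op(1) smooth_on_fst[OF op(1) smooth_on_id[OF op(1)]]
        smooth_on_snd[OF op(1) smooth_on_snd[OF op(1) smooth_on_id[OF op(1)]]]]
      smooth_on_snd[OF op(1) smooth_on_id[OF op(1)]] by simp_all
  let ?K = "\<lambda>z. f (fst z, snd (snd z)) \<otimes> inv (f (snd z))"
  have K: "plot \<Omega> M ?K"
  proof (intro plot_mult plot_inv)
    show "plot \<Omega> M (\<lambda>z. f (fst z, snd (snd z)))"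
      by (rule plot_precompose[OF charted_M f op(1) sm(1)]) (auto simp: \<Omega>_def)
    show "plot \<Omega> M (\<lambda>z. f (snd z))"
      by (rule plot_precompose[OF charted_M f op(1) sm(2)]) (auto simp: \<Omega>_def)
  qed
  let ?N = "{z \<in> \<Omega>. ?K z \<in> unit_nbhd}"
  let ?D = "\<lambda>z. frechet_derivative (\<lambda>z. coord (?K z)) (at z) (1, 0)"
  have D: "smooth_on ?D ?N"
    by (rule smooth_on_frechet_derivative[OF smooth_on_coord[OF K]])
  have diag: "(fst p, p) \<in> ?N" if p: "p \<in> J \<times> T" for p
    using p plot_in_carrier[OF f p] one_in_unit_nbhd by (auto simp: \<Omega>_def)
  have diag_sm: "smooth_on (\<lambda>p. (fst p, p)) (J \<times> T)"
    by (intro smooth_on_Pair[OF op(2)] smooth_on_fst[OF op(2)] smooth_on_id[OF op(2)])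
  have "smooth_on (\<lambda>p. ?D (fst p, p)) (J \<times> T)"
    by (rule smooth_on_compose[where f = "\<lambda>p. (fst p, p)" and g = ?D, OF op(2)
          open_coord_domain[OF K] _ diag_sm D]) (use diag in blast)
  then show ?thesis
  proof (rule smooth_on_cong[OF op(2)])
    fix p assume p: "p \<in> J \<times> T"
    have "((\<lambda>z. coord (?K z)) has_derivative frechet_derivative (\<lambda>z. coord (?K z)) (at (fst p, p))) (at (fst p, p))"
      by (rule coord_has_derivative[OF K]) (use diag[OF p] in auto)
    moreover have "((\<lambda>s. (s, p)) has_vector_derivative (1, 0)) (at (fst p))"
      by (rule has_vector_derivative_Pair[OF has_vector_derivative_id has_vector_derivative_const])
    ultimately have "((\<lambda>s. coord (?K (s, p))) has_vector_derivative ?D (fst p, p)) (at (fst p))"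
      by (intro has_vector_derivative_compose_at[where f = "\<lambda>s. (s, p)" and g = "\<lambda>z. coord (?K z)"])
    then have "dlog (\<lambda>s. f (s, snd p)) (fst p) = ?D (fst p, p)"
      by (intro dlog_eqI) simp
    then show "?D (fst p, p) = dlog (\<lambda>s. f (s, snd p)) (fst p)" by simp
  qed
qed

text \<open>
  In the unit chart the equation \<open>dlog \<gamma> = \<xi>\<close> reads \<open>x' = A (t, x)\<close> with \<open>A (t, x) = Rt (elem x) (\<xi> t)\<close>.
  The vector field \<open>A\<close> is obtained as the derivative at \<open>r = 0\<close> of the smooth map that multiplies
  the group elements with coordinates \<open>origin + r \<xi>(t)\<close> and \<open>x\<close>; this makes it smooth in \<open>t\<close> and
  \<open>x\<close> together.
\<close>
lemma local_primitive:
  assumes J: "open J" "t0 \<in> J" and \<xi>: "smooth_on \<xi> J"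
  obtains d \<gamma> where "d > 0" "ball t0 d \<subseteq> J" "plot (ball t0 d) M \<gamma>"
    "\<And>t. t \<in> ball t0 d \<Longrightarrow> dlog \<gamma> t = \<xi> t"
proof -
  define X where "X = (UNIV :: real set) \<times> (J \<times> coords)"
  define u where "u z = origin + fst z *\<^sub>R \<xi> (fst (snd z))" for z :: "real \<times> real \<times> 'e"
  define \<Omega> where "\<Omega> = {z \<in> X. u z \<in> coords}"
  have opX: "open X" unfolding X_def by (intro open_Times open_UNIV J open_coords)
  have fstX: "smooth_on fst X" and sndX: "smooth_on snd X"
    using smooth_on_fst[OF opX smooth_on_id[OF opX]] smooth_on_snd[OF opX smooth_on_id[OF opX]] by simp_all
  have "smooth_on (\<lambda>z. \<xi> (fst (snd z))) X"
    by (rule smooth_on_compose[where f = "\<lambda>z. fst (snd z)" and g = \<xi>, OF opX J(1) _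
          smooth_on_fst[OF opX sndX] \<xi>]) (auto simp: X_def)
  then have u: "smooth_on u X"
    unfolding u_def by (intro smooth_on_add smooth_on_const smooth_on_scaleR opX fstX)
  have op\<Omega>: "open \<Omega>"
  proof -
    have "open (X \<inter> u -` coords)"
      by (rule continuous_open_preimage[OF smooth_on_imp_continuous_on[OF u] opX open_coords])
    moreover have "X \<inter> u -` coords = \<Omega>" by (auto simp: \<Omega>_def)
    ultimately show ?thesis by simp
  qed
  have sub: "\<Omega> \<subseteq> X" by (auto simp: \<Omega>_def)
  let ?B = "\<lambda>z. elem (u z) \<otimes> elem (snd (snd z))"
  have B: "plot \<Omega> M ?B"
  proof (rule plot_mult)
    show "plot \<Omega> M (\<lambda>z. elem (u z))"
      by (rule plot_precompose[OF charted_M plot_elem op\<Omega> smooth_on_subset[OF u sub]])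
        (auto simp: \<Omega>_def)
    show "plot \<Omega> M (\<lambda>z. elem (snd (snd z)))"
      by (rule plot_precompose[where k = "\<lambda>z. snd (snd z)", OF charted_M plot_elem op\<Omega>
            smooth_on_subset[OF smooth_on_snd[OF opX sndX] sub]]) (auto simp: \<Omega>_def X_def)
  qed
  let ?N = "{z \<in> \<Omega>. ?B z \<in> unit_nbhd}"
  define A where "A p = frechet_derivative (\<lambda>z. coord (?B z)) (at (0, p)) (1, 0)" for p
  have opW: "open (J \<times> coords)" by (intro open_Times J open_coords)
  have zero: "(0, p) \<in> ?N" if "p \<in> J \<times> coords" for p
    using that origin_in_coords elem_origin elem_in_unit_nbhd unit_nbhd_carrier
    by (auto simp: \<Omega>_def X_def u_def)
  have A: "smooth_on A (J \<times> coords)"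
    unfolding A_def
    by (rule smooth_on_compose[where f = "\<lambda>p. (0, p)", OF opW open_coord_domain[OF B] _
          smooth_on_Pair[OF opW smooth_on_const[OF opW] smooth_on_id[OF opW]]
          smooth_on_frechet_derivative[OF smooth_on_coord[OF B]]])
      (use zero in blast)
  have A_eq: "A (t, x) = Rt (elem x) (\<xi> t)" if t: "t \<in> J" and x: "x \<in> coords" for t x
  proof -
    have "((\<lambda>z. coord (?B z)) has_derivative frechet_derivative (\<lambda>z. coord (?B z)) (at (0, t, x))) (at (0, t, x))"
      by (rule coord_has_derivative[OF B]) (use zero[of "(t, x)"] t x in auto)
    moreover have "((\<lambda>r. (r, t, x)) has_vector_derivative (1, 0)) (at (0::real))"
      by (rule has_vector_derivative_Pair[OF has_vector_derivative_id has_vector_derivative_const])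
    ultimately have 1: "((\<lambda>r. coord (?B (r, t, x))) has_vector_derivative A (t, x)) (at 0)"
      unfolding A_def
      by (intro has_vector_derivative_compose_at[where f = "\<lambda>r. (r, t, x)" and g = "\<lambda>z. coord (?B z)"])
    have "((\<lambda>r. origin + r *\<^sub>R \<xi> t) has_vector_derivative \<xi> t) (at 0)"
      by (auto intro!: derivative_eq_intros)
    from has_vector_derivative_compose_at[OF this, of "\<lambda>y. coord (elem y \<otimes> elem x)" "Rt (elem x)"]
    have "((\<lambda>r. coord (elem (origin + r *\<^sub>R \<xi> t) \<otimes> elem x)) has_vector_derivative Rt (elem x) (\<xi> t)) (at 0)"
      using Rt_has_derivative[OF elem_in_unit_nbhd[OF x]] by simp
    then have 2: "((\<lambda>r. coord (?B (r, t, x))) has_vector_derivative Rt (elem x) (\<xi> t)) (at 0)"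
      by (simp add: u_def)
    show ?thesis by (rule vector_derivative_unique_at[OF 1 2])
  qed
  have "(t0, origin) \<in> J \<times> coords" using J origin_in_coords by simp
  then obtain d x where d: "d > 0" "x t0 = origin"
    "\<And>t. t \<in> ball t0 d \<Longrightarrow> (t, x t) \<in> J \<times> coords"
    "\<And>t. t \<in> ball t0 d \<Longrightarrow> (x has_vector_derivative A (t, x t)) (at t)"
    using Picard_Lindeloef[OF opW _ A] by blast
  have x: "smooth_on x (ball t0 d)"
    by (rule smooth_on_ODE_solution[OF open_ball opW A d(3,4)])
  have \<gamma>: "plot (ball t0 d) M (\<lambda>t. elem (x t))"
    by (rule plot_precompose[OF charted_M plot_elem open_ball x]) (use d(3) in blast)
  show ?thesis
  proof (rule that[OF d(1) _ \<gamma>])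
    show "ball t0 d \<subseteq> J" using d(3) by blast
    fix t assume t: "t \<in> ball t0 d"
    have tx: "t \<in> J" "x t \<in> coords" using d(3)[OF t] by auto
    have nbhd: "elem (x t) \<in> unit_nbhd" "elem (x t) \<in> carrier G"
      using elem_in_unit_nbhd[OF tx(2)] elem_carrier[OF tx(2)] by auto
    have "((\<lambda>s. coord (elem (x s) \<otimes> \<one>)) has_vector_derivative
        Rt (elem (x t) \<otimes> \<one>) (dlog (\<lambda>t. elem (x t)) t)) (at t)"
      by (rule coord_right_translate_has_vector_derivative[OF \<gamma> t]) (use nbhd in auto)
    then have "(x has_vector_derivative Rt (elem (x t) \<otimes> \<one>) (dlog (\<lambda>t. elem (x t)) t)) (at t)"
      by (rule has_vector_derivative_transform_within_open[OF _ open_ball t])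
        (use d(3) in \<open>auto simp: elem_carrier coord_elem\<close>)
    from vector_derivative_unique_at[OF this d(4)[OF t]]
    have "Rt (elem (x t)) (dlog (\<lambda>t. elem (x t)) t) = Rt (elem (x t)) (\<xi> t)"
      using nbhd by (simp add: A_eq[OF tx])
    then show "dlog (\<lambda>t. elem (x t)) t = \<xi> t"
      by (rule Rt_inj[OF nbhd(1)])
  qed
qed

lemma primitive_cong:
  assumes "plot T M g" "\<And>s. s \<in> T \<Longrightarrow> g s = f s" "t \<in> T" "\<And>s. s \<in> T \<Longrightarrow> dlog g s = \<xi> s"
  shows "plot T M f" "dlog f t = \<xi> t"
  using plot_cong[OF charted_M assms(1,2)]
    dlog_cong[OF plot_open[OF assms(1)] assms(3) assms(2) assms(1)] assms(3,4) by auto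

text \<open>
  By uniqueness, the solutions starting at the unit on subintervals of \<open>J\<close> agree where they are both
  defined and glue to a solution on the union \<open>U\<close> of these intervals.  A local solution near a point
  of \<open>J\<close> can be right-translated to match the maximal solution wherever it meets \<open>U\<close>, so no point
  of \<open>J\<close> outside \<open>U\<close> is a limit of points of \<open>U\<close>.  As \<open>J\<close> is connected, \<open>U = J\<close>.
\<close>
lemma global_primitive:
  assumes J: "open J" "is_interval J" "t0 \<in> J" and \<xi>: "smooth_on \<xi> J"
  obtains \<gamma> where "plot J M \<gamma>" "\<gamma> t0 = \<one>" "\<And>t. t \<in> J \<Longrightarrow> dlog \<gamma> t = \<xi> t"
proof -
  define sol where "sol K \<gamma> \<longleftrightarrow> is_interval K \<and> t0 \<in> K \<and> K \<subseteq> J \<and> plot K M \<gamma> \<and> \<gamma> t0 = \<one> \<and>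
    (\<forall>t\<in>K. dlog \<gamma> t = \<xi> t)" for K \<gamma>
  have agree: "\<gamma> t = \<eta> t" if \<gamma>: "sol K \<gamma>" and \<eta>: "sol L \<eta>" and t: "t \<in> K" "t \<in> L" for K \<gamma> L \<eta> t
  proof (rule dlog_unique[where J = "K \<inter> L" and ?t0.0 = t0])
    have op: "open (K \<inter> L)"
      using \<gamma> \<eta> plot_open unfolding sol_def by blast
    show "plot (K \<inter> L) M \<gamma>" "plot (K \<inter> L) M \<eta>"
      using plot_subset[OF charted_M _ op] \<gamma> \<eta> unfolding sol_def by blast+
  qed (use \<gamma> \<eta> t in \<open>auto simp: sol_def is_interval_Int\<close>)
  define U where "U = \<Union>{K. \<exists>\<gamma>. sol K \<gamma>}"
  define g where "g t = (SOME \<gamma>. \<exists>K. sol K \<gamma> \<and> t \<in> K) t" for t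
  have g: "\<gamma> t = g t" if "sol K \<gamma>" "t \<in> K" for K \<gamma> t
  proof -
    have "\<exists>L. sol L (SOME \<gamma>. \<exists>K. sol K \<gamma> \<and> t \<in> K) \<and> t \<in> L"
      using that by (intro someI_ex[where P = "\<lambda>\<gamma>. \<exists>K. sol K \<gamma> \<and> t \<in> K"]) blast
    then obtain L where "sol L (SOME \<gamma>. \<exists>K. sol K \<gamma> \<and> t \<in> K)" "t \<in> L" by blast
    from agree[OF that(1) this(1) that(2) this(2)] show ?thesis by (simp add: g_def)
  qed
  obtain d0 \<gamma>0 where d0: "d0 > 0" "ball t0 d0 \<subseteq> J" "plot (ball t0 d0) M \<gamma>0"
    "\<And>t. t \<in> ball t0 d0 \<Longrightarrow> dlog \<gamma>0 t = \<xi> t"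
    using local_primitive[OF J(1,3) \<xi>] by blast
  have t0: "t0 \<in> ball t0 d0" using d0(1) by simp
  have \<gamma>0: "\<gamma>0 t0 \<in> carrier G" by (rule plot_in_carrier[OF d0(3) t0])
  have "sol (ball t0 d0) (\<lambda>t. \<gamma>0 t \<otimes> inv (\<gamma>0 t0))"
    unfolding sol_def using d0 t0 \<gamma>0 dlog_mult_const[OF d0(3), of "inv (\<gamma>0 t0)"]
      plot_right_translate[OF d0(3), of "inv (\<gamma>0 t0)"]
    by (simp add: is_interval_ball_real)
  then have t0U: "t0 \<in> U" unfolding U_def using t0 by blast
  have ivU: "is_interval U"
    unfolding is_interval_connected_1 U_def
    by (rule connected_Union) (auto simp: sol_def is_interval_connected_1)
  have plotU: "plot U M g" and dlogU: "\<And>t. t \<in> U \<Longrightarrow> dlog g t = \<xi> t"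
  proof -
    have loc: "\<exists>T. t \<in> T \<and> T \<subseteq> U \<and> plot T M g \<and> dlog g t = \<xi> t" if t: "t \<in> U" for t
    proof -
      obtain K \<gamma> where K: "sol K \<gamma>" "t \<in> K" using t unfolding U_def by blast
      have "plot K M g" "dlog g t = \<xi> t"
        by (rule primitive_cong[where g = \<gamma>], use K g[OF K(1)] in \<open>auto simp: sol_def\<close>)+
      then show ?thesis using K unfolding U_def by blast
    qed
    have "open U"
      unfolding U_def sol_def using plot_open by blast
    then show "plot U M g"
      using loc by (intro plot_local[OF _ charted_M]) blast+
    show "dlog g t = \<xi> t" if "t \<in> U" for t using loc[OF that] by blast
  qed
  have solU: "sol U g"
    unfolding sol_def
  proof (intro conjI ballI)
    show "U \<subseteq> J" unfolding U_def sol_def by blast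
    show "g t0 = \<one>" using t0U g unfolding U_def sol_def by force
  qed (use ivU t0U plotU dlogU in auto)
  have ext: "ball t1 d \<subseteq> J - U"
    if d: "t1 \<in> J - U" "d > 0" "ball t1 d \<subseteq> J" "plot (ball t1 d) M \<eta>"
      "\<And>t. t \<in> ball t1 d \<Longrightarrow> dlog \<eta> t = \<xi> t" for t1 d \<eta>
  proof (rule ccontr)
    assume "\<not> ball t1 d \<subseteq> J - U"
    then obtain t2 where t2: "t2 \<in> ball t1 d" "t2 \<in> U" using d(3) by blast
    have c: "\<eta> t2 \<in> carrier G" "g t2 \<in> carrier G"
      using plot_in_carrier[OF d(4) t2(1)] plot_in_carrier[OF plotU t2(2)] by auto
    \<comment> \<open>The right translate \<open>h\<close> of the local solution passes through \<open>g t2\<close> at time \<open>t2\<close>.\<close>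
    define k where "k = inv (\<eta> t2) \<otimes> g t2"
    define h where "h t = \<eta> t \<otimes> k" for t
    have k: "k \<in> carrier G" using c by (simp add: k_def)
    have h: "plot (ball t1 d) M h" "\<And>t. t \<in> ball t1 d \<Longrightarrow> dlog h t = \<xi> t" "h t2 = g t2"
      using plot_right_translate[OF d(4) k] dlog_mult_const[OF d(4) k] d(5) c
      by (simp_all add: h_def[abs_def] k_def m_assoc[symmetric])
    define B where "B = ball t1 d"
    have ivB: "is_interval B" by (simp add: B_def is_interval_ball_real)
    have same: "h t = g t" if t: "t \<in> B" "t \<in> U" for t
    proof (rule dlog_unique[where J = "B \<inter> U" and ?t0.0 = t2])
      have op: "open (B \<inter> U)" using plot_open[OF plotU] by (auto simp: B_def)
      show "plot (B \<inter> U) M h" "plot (B \<inter> U) M g"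
        using plot_subset[OF charted_M _ op] h(1) plotU by (auto simp: B_def)
    qed (use h(2,3) dlogU t t2 ivB ivU in \<open>auto simp: B_def is_interval_Int\<close>)
    define G' where "G' t = (if t \<in> U then g t else h t)" for t
    have onU: "g t = G' t" if "t \<in> U" for t using that by (simp add: G'_def)
    have onB: "h t = G' t" if "t \<in> B" for t using that same by (simp add: G'_def)
    have U: "plot U M G'" "\<And>t. t \<in> U \<Longrightarrow> dlog G' t = \<xi> t"
      using primitive_cong[OF plotU onU _ dlogU] t0U by blast+
    have B: "plot B M G'" "\<And>t. t \<in> B \<Longrightarrow> dlog G' t = \<xi> t"
      using primitive_cong[OF h(1)[folded B_def] onB _ h(2)[folded B_def]] t2(1)[folded B_def] by blast+
    have "sol (U \<union> B) G'"
      unfolding sol_def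
    proof (intro conjI ballI)
      show "is_interval (U \<union> B)"
        using ivU ivB t2 unfolding is_interval_connected_1 B_def[symmetric]
        by (intro connected_Un) auto
      show "t0 \<in> U \<union> B" using t0U by blast
      show "U \<union> B \<subseteq> J" using d(3) solU by (auto simp: B_def sol_def)
      show "plot (U \<union> B) M G'"
        by (rule plot_local[OF open_Un[OF plot_open[OF U(1)] plot_open[OF B(1)]] charted_M])
          (use U(1) B(1) in blast)
      show "G' t0 = \<one>" using onU[OF t0U] solU by (simp add: sol_def)
      show "dlog G' t = \<xi> t" if "t \<in> U \<union> B" for t using that U(2) B(2) by blast
    qed
    then have "U \<union> B \<subseteq> U" unfolding U_def by blast
    moreover have "t1 \<in> B" using d(2) by (simp add: B_def)
    ultimately show False using d(1) by blast
  qed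
  have "open (J - U)"
    unfolding open_contains_ball
  proof
    fix t1 assume t1: "t1 \<in> J - U"
    then have "t1 \<in> J" by blast
    then obtain d \<eta> where "d > 0" "ball t1 d \<subseteq> J" "plot (ball t1 d) M \<eta>"
      "\<And>t. t \<in> ball t1 d \<Longrightarrow> dlog \<eta> t = \<xi> t"
      using local_primitive[OF J(1) _ \<xi>] by blast
    then show "\<exists>e>0. ball t1 e \<subseteq> J - U" using ext[OF t1] by blast
  qed
  moreover have "connected J" using J(2) by (simp add: is_interval_connected_1)
  moreover have "U \<subseteq> J" using solU by (simp add: sol_def)
  ultimately have "U \<inter> J = {} \<or> (J - U) \<inter> J = {}"
    using plot_open[OF plotU] by (intro connectedD[of J]) auto
  then have "U = J" using t0U \<open>U \<subseteq> J\<close> by blast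
  then show ?thesis
    using that[of g] solU by (auto simp: sol_def)
qed

end

section \<open>Averaging smooth families over a compact Lie group\<close>

text \<open>
  Smoothness of a vector-valued map on \<open>J \<times> M\<close>, tested through the inverse charts of \<open>M\<close>.
\<close>
definition smooth_family ::
  "real set \<Rightarrow> ('p, 'd::finite_dim_normed_vector) manifold \<Rightarrow> (real \<Rightarrow> 'p \<Rightarrow> 'e::finite_dim_normed_vector) \<Rightarrow> bool"
where
  "smooth_family J M \<phi> \<longleftrightarrow>
     (\<forall>(U, a) \<in> atlas M. smooth_on (\<lambda>p. \<phi> (fst p) (inv_into U a (snd p))) (J \<times> a ` U))"

lemma smooth_familyD:
  "smooth_family J M \<phi> \<Longrightarrow> (U, a) \<in> atlas M
    \<Longrightarrow> smooth_on (\<lambda>p. \<phi> (fst p) (inv_into U a (snd p))) (J \<times> a ` U)"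
  unfolding smooth_family_def by blast

lemma smooth_family_continuous:
  assumes M: "smooth_manifold M" and J: "open J" and \<phi>: "smooth_family J M \<phi>"
  shows "continuous_map (prod_topology (top_of_set J) (mtop M)) euclidean (\<lambda>p. \<phi> (fst p) (snd p))"
proof -
  let ?P = "prod_topology (top_of_set J) (mtop M)"
  note ch = smooth_manifold_imp_charted[OF M]
  have "openin ?P {p \<in> topspace ?P. \<phi> (fst p) (snd p) \<in> V}" if V: "open V" for V
  proof (subst openin_subopen, rule ballI)
    fix p assume p: "p \<in> {p \<in> topspace ?P. \<phi> (fst p) (snd p) \<in> V}"
    then have "snd p \<in> topspace (mtop M)" by auto
    then obtain U a where U: "(U, a) \<in> atlas M" "snd p \<in> U"
      by (rule charted_cover[OF ch])
    note op = charted_openin[OF ch U(1)]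
    have opU: "open (a ` U)"
      by (rule charted_open_image[OF ch U(1) op]) simp
    have "is_chart (mtop M) (U, a)"
      using M U(1) by (simp add: smooth_manifold_def)
    then have "continuous_map (subtopology (mtop M) U) (top_of_set (a ` U)) a"
      by (simp add: is_chart_def homeomorphic_imp_continuous_map)
    then have a: "continuous_map (subtopology (mtop M) U) euclidean a"
      by (simp add: continuous_map_in_subtopology)
    let ?Q = "prod_topology (top_of_set J) (subtopology (mtop M) U)"
    have "continuous_map ?Q (prod_topology euclidean euclidean) (\<lambda>p. (fst p, a (snd p)))"
      using continuous_map_compose[OF continuous_map_snd a, of "top_of_set J"]
        continuous_map_fst[of "top_of_set J" "subtopology (mtop M) U"]
      by (intro continuous_map_pairedI) (auto simp: o_def continuous_map_in_subtopology)
    then have "continuous_map ?Q euclidean (\<lambda>p. (fst p, a (snd p)))"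
      by simp
    moreover have topQ: "topspace ?Q = J \<times> U"
      using openin_subset[OF op] by auto
    ultimately have m1: "continuous_map ?Q (top_of_set (J \<times> a ` U)) (\<lambda>p. (fst p, a (snd p)))"
      by (auto simp: continuous_map_in_subtopology)
    have m2: "continuous_map (top_of_set (J \<times> a ` U)) euclidean (\<lambda>p. \<phi> (fst p) (inv_into U a (snd p)))"
      using smooth_on_imp_continuous_on[OF smooth_familyD[OF \<phi> U(1)]] by simp
    from continuous_map_compose[OF m1 m2]
    have "continuous_map ?Q euclidean (\<lambda>p. \<phi> (fst p) (inv_into U a (a (snd p))))"
      by (simp add: o_def)
    then have "continuous_map ?Q euclidean (\<lambda>p. \<phi> (fst p) (snd p))"
      by (rule continuous_map_eq) (use topQ charted_inj_on[OF ch U(1)] in auto)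
    then have "openin ?Q {p \<in> topspace ?Q. \<phi> (fst p) (snd p) \<in> V}"
      using V by (intro openin_continuous_map_preimage) auto
    then have "openin ?Q {p \<in> J \<times> U. \<phi> (fst p) (snd p) \<in> V}"
      by (simp only: topQ)
    then have "openin (subtopology ?P (J \<times> U)) {p \<in> J \<times> U. \<phi> (fst p) (snd p) \<in> V}"
      by (simp only: prod_topology_subtopology(2) topspace_euclidean_subtopology)
    moreover have "openin ?P (J \<times> U)"
      using op J by (simp add: openin_prod_Times_iff)
    ultimately have "openin ?P {p \<in> J \<times> U. \<phi> (fst p) (snd p) \<in> V}"
      by (rule openin_trans_full)
    then show "\<exists>T. openin ?P T \<and> p \<in> T \<and> T \<subseteq> {p \<in> topspace ?P. \<phi> (fst p) (snd p) \<in> V}"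
      using p U(2) openin_subset[OF op]
      by (intro exI[of _ "{p \<in> J \<times> U. \<phi> (fst p) (snd p) \<in> V}"]) auto
  qed
  then show ?thesis by (simp add: continuous_map_def)
qed

lemma smooth_family_derivative:
  assumes M: "smooth_manifold M" and J: "open J" and \<phi>: "smooth_family J M \<phi>"
  obtains \<phi>' where "smooth_family J M \<phi>'"
    "\<And>t h. t \<in> J \<Longrightarrow> h \<in> topspace (mtop M) \<Longrightarrow> ((\<lambda>s. \<phi> s h) has_vector_derivative \<phi>' t h) (at t)"
proof -
  note ch = smooth_manifold_imp_charted[OF M]
  define \<phi>' where "\<phi>' t h = vector_derivative (\<lambda>s. \<phi> s h) (at t)" for t h
  have der: "((\<lambda>s. \<phi> s h) has_vector_derivative
        frechet_derivative (\<lambda>p. \<phi> (fst p) (inv_into U a (snd p))) (at (t, a h)) (1, 0)) (at t)"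
    if U: "(U, a) \<in> atlas M" and h: "h \<in> U" and t: "t \<in> J" for U a h t
  proof -
    let ?F = "\<lambda>p. \<phi> (fst p) (inv_into U a (snd p))"
    have "open (J \<times> a ` U)"
      by (intro open_Times J charted_open_image[OF ch U charted_openin[OF ch U]]) simp
    from smooth_on_has_derivative[OF smooth_familyD[OF \<phi> U] this, of "(t, a h)"]
    have "(?F has_derivative frechet_derivative ?F (at (t, a h))) (at (t, a h))"
      using h t by simp
    moreover have "((\<lambda>s. (s, a h)) has_vector_derivative (1, 0)) (at t)"
      by (rule has_vector_derivative_Pair[OF has_vector_derivative_id has_vector_derivative_const])
    ultimately have "((\<lambda>s. ?F (s, a h)) has_vector_derivative frechet_derivative ?F (at (t, a h)) (1, 0)) (at t)"
      by (intro has_vector_derivative_compose_at[where f = "\<lambda>s. (s, a h)" and g = ?F])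
    then show ?thesis
      using inv_into_f_f[OF charted_inj_on[OF ch U] h] by simp
  qed
  show ?thesis
  proof (rule that[of \<phi>'])
    show "((\<lambda>s. \<phi> s h) has_vector_derivative \<phi>' t h) (at t)"
      if t: "t \<in> J" and h: "h \<in> topspace (mtop M)" for t h
    proof -
      obtain U a where "(U, a) \<in> atlas M" "h \<in> U"
        using h by (rule charted_cover[OF ch])
      from der[OF this t] show ?thesis
        unfolding \<phi>'_def using vector_derivative_at by metis
    qed
    show "smooth_family J M \<phi>'"
      unfolding smooth_family_def
    proof clarify
      fix U a assume U: "(U, a) \<in> atlas M"
      have op: "open (J \<times> a ` U)"
        by (intro open_Times J charted_open_image[OF ch U charted_openin[OF ch U]]) simp
      show "smooth_on (\<lambda>p. \<phi>' (fst p) (inv_into U a (snd p))) (J \<times> a ` U)"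
      proof (rule smooth_on_cong[OF op smooth_on_frechet_derivative[OF smooth_familyD[OF \<phi> U], of "(1, 0)"]])
        fix p assume "p \<in> J \<times> a ` U"
        then obtain t h where p: "p = (t, a h)" "t \<in> J" "h \<in> U" by auto
        show "frechet_derivative (\<lambda>p. \<phi> (fst p) (inv_into U a (snd p))) (at p) (1, 0)
            = \<phi>' (fst p) (inv_into U a (snd p))"
          using vector_derivative_at[OF der[OF U p(3,2)]] inv_into_f_f[OF charted_inj_on[OF ch U] p(3)]
          by (simp add: p(1) \<phi>'_def)
      qed
    qed
  qed
qed

locale compact_lie_group = lie_group +
  assumes compact_M: "compact_space (mtop M)"

sublocale compact_lie_group \<subseteq> compact_topological_group G "mtop M"
proof
  show "topspace (mtop M) = carrier G" by (rule topspace_eq_carrier)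
  show "compact_space (mtop M)" by (rule compact_M)
  show "continuous_map (prod_topology (mtop M) (mtop M)) (mtop M) (\<lambda>(x, y). x \<otimes> y)"
    using smooth_mult by (simp add: smooth_map_def prod_manifold_def)
  show "continuous_map (mtop M) (mtop M) (\<lambda>x. inv x)"
    using smooth_inv by (simp add: smooth_map_def)
qed

context compact_lie_group
begin

text \<open>
  The derivative of the mean is the mean of the derivative, which is again a smooth family; so the
  mean is of class \<open>C\<^sup>k\<close> for every \<open>k\<close> by induction.
\<close>
lemma smooth_on_mean:
  fixes \<phi> :: "real \<Rightarrow> 'a \<Rightarrow> 'f::finite_dim_normed_vector"
  assumes J: "open J" and \<phi>: "smooth_family J M \<phi>"
  shows "smooth_on (\<lambda>t. mean (\<phi> t)) J"
proof -
  have "C_k_on k (\<lambda>t. mean (\<phi> t)) J" for k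
    using \<phi>
  proof (induction k arbitrary: \<phi>)
    case 0
    then show ?case
      using continuous_on_mean[OF smooth_family_continuous[OF manifold J 0] J] by simp
  next
    case (Suc k)
    obtain \<phi>' where \<phi>': "smooth_family J M \<phi>'"
      "\<And>t h. t \<in> J \<Longrightarrow> h \<in> topspace (mtop M) \<Longrightarrow> ((\<lambda>s. \<phi> s h) has_vector_derivative \<phi>' t h) (at t)"
      using smooth_family_derivative[OF manifold J Suc.prems] by blast
    show ?case
    proof (rule C_k_on_Suc_realI[OF J])
      show "((\<lambda>t. mean (\<phi> t)) has_vector_derivative mean (\<phi>' t)) (at t)" if "t \<in> J" for t
        by (rule has_vector_derivative_mean[OF smooth_family_continuous[OF manifold J Suc.prems]
              smooth_family_continuous[OF manifold J \<phi>'(1)] J that])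
          (use \<phi>'(2) topspace_eq_carrier in simp)
      show "C_k_on k (\<lambda>t. mean (\<phi>' t)) J"
        by (rule Suc.IH[OF \<phi>'(1)])
    qed
  qed
  then show ?thesis by (simp add: smooth_on_def)
qed

end

section \<open>Rigidity of homomorphisms from compact groups\<close>

theorem theorem1p3:
  fixes H :: "('h, 'm) monoid_scheme"
    and MH :: "('h, 'd::finite_dim_normed_vector) manifold"
    and G :: "('g, 'n) monoid_scheme"
    and MG :: "('g, 'e::finite_dim_normed_vector) manifold"
    and \<phi> :: "'h \<Rightarrow> 'g"
    and I :: "real set"
    and \<Phi> :: "real \<Rightarrow> 'h \<Rightarrow> 'g"
  assumes "lie_group H MH"
    and "compact_space (mtop MH)"
    and "lie_group G MG"
    and "lie_group_hom H MH G MG \<phi>"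
    and "open I" and "is_interval I" and "0 \<in> I"
    and "deformation H MH G MG \<phi> I \<Phi>"
  shows "trivial_deformation H G MG \<phi> I \<Phi>"
proof -
  interpret H: compact_lie_group H MH
    using assms(1,2) by (simp add: compact_lie_group_def compact_lie_group_axioms_def)
  interpret G: lie_group G MG by (rule assms(3))
  note I = \<open>open I\<close> \<open>is_interval I\<close> \<open>0 \<in> I\<close>
  have hom: "\<Phi> t \<in> hom H G" if "t \<in> I" for t
    using assms(8) that by (simp add: deformation_def lie_group_hom_def)
  have \<Phi>: "smooth_map (prod_manifold (open_submanifold I) MH) MG (\<lambda>(t, h). \<Phi> t h)"
    and \<Phi>0: "\<And>h. h \<in> carrier H \<Longrightarrow> \<Phi> 0 h = \<phi> h"
    using assms(8) by (auto simp: deformation_def)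
  have chart_plot: "plot (I \<times> a ` U) MG (\<lambda>p. \<Phi> (fst p) (inv_into U a (snd p)))"
    if U: "(U, a) \<in> atlas MH" for U a
  proof -
    have aU: "plot (a ` U) MH (inv_into U a)"
      by (rule plot_inverse_chart[OF H.manifold U])
    have op: "open (I \<times> a ` U)" by (intro open_Times I plot_open[OF aU])
    have sm: "smooth_on fst (I \<times> a ` U)" "smooth_on snd (I \<times> a ` U)"
      using smooth_on_fst[OF op smooth_on_id[OF op]] smooth_on_snd[OF op smooth_on_id[OF op]] by simp_all
    have "plot (I \<times> a ` U) (prod_manifold (open_submanifold I) MH) (\<lambda>p. (fst p, inv_into U a (snd p)))"
      by (intro plot_Pair charted_open_submanifold I H.charted_M plot_open_submanifold[OF op sm(1)]
          plot_precompose[OF H.charted_M aU op sm(2)]) auto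
    from plot_compose_smooth_map[OF charted_prod_manifold[OF charted_open_submanifold[OF I(1)] H.charted_M]
        G.charted_M this \<Phi>]
    show ?thesis by simp
  qed
  have curve: "plot I MG (\<lambda>t. \<Phi> t h)" if h: "h \<in> carrier H" for h
  proof -
    have "h \<in> topspace (mtop MH)" using h by (simp add: H.topspace_eq_carrier)
    then obtain U a where U: "(U, a) \<in> atlas MH" "h \<in> U"
      by (rule charted_cover[OF H.charted_M])
    have "plot I MG (\<lambda>t. \<Phi> (fst (t, a h)) (inv_into U a (snd (t, a h))))"
      by (rule plot_precompose[where k = "\<lambda>t. (t, a h)", OF G.charted_M chart_plot[OF U(1)] I(1)
            smooth_on_Pair[OF I(1) smooth_on_id[OF I(1)] smooth_on_const[OF I(1)]]])
        (use U(2) in auto)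
    then show ?thesis
      using inv_into_f_f[OF charted_inj_on[OF H.charted_M U(1)] U(2)] by simp
  qed
  define c where "c t h = G.dlog (\<lambda>s. \<Phi> s h) t" for t h
  have c: "smooth_family I MH c"
    unfolding smooth_family_def
  proof clarify
    fix U a assume U: "(U, a) \<in> atlas MH"
    have "open (a ` U)" by (rule plot_open[OF plot_inverse_chart[OF H.manifold U]])
    from G.smooth_on_dlog[OF I(1) this chart_plot[OF U]]
    show "smooth_on (\<lambda>p. c (fst p) (inv_into U a (snd p))) (I \<times> a ` U)"
      by (simp add: c_def)
  qed
  have cont: "continuous_map (mtop MH) euclidean (c t)" if "t \<in> I" for t
    by (rule H.continuous_map_section[OF smooth_family_continuous[OF H.manifold I(1) c] that])
  \<comment> \<open>The homomorphism property, differentiated in the parameter.\<close>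
  have cocycle: "c t (h \<otimes>\<^bsub>H\<^esub> k) = c t h + G.Ad (\<Phi> t h) (c t k)"
    if t: "t \<in> I" and h: "h \<in> carrier H" and k: "k \<in> carrier H" for t h k
  proof -
    have "c t (h \<otimes>\<^bsub>H\<^esub> k) = G.dlog (\<lambda>s. \<Phi> s h \<otimes>\<^bsub>G\<^esub> \<Phi> s k) t"
      unfolding c_def
      by (rule G.dlog_cong[OF I(1) t _ G.plot_mult[OF curve[OF h] curve[OF k]]])
        (use hom_mult[OF hom h k] in simp)
    then show ?thesis
      using G.dlog_mult[OF curve[OF h] curve[OF k] t] by (simp add: c_def)
  qed
  define \<xi> where "\<xi> t = H.mean (c t)" for t
  have \<xi>: "smooth_on \<xi> I"
    unfolding \<xi>_def by (rule H.smooth_on_mean[OF I(1) c])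
  \<comment> \<open>The mean of the cocycle identity over \<open>k\<close>; the left-hand side has mean \<open>\<xi> t\<close> by invariance.\<close>
  have coboundary: "c t h + G.Ad (\<Phi> t h) (\<xi> t) = \<xi> t" if t: "t \<in> I" and h: "h \<in> carrier H" for t h
  proof -
    have bl: "bounded_linear (G.Ad (\<Phi> t h))"
      by (rule G.bounded_linear_Ad[OF G.plot_in_carrier[OF curve[OF h] t]])
    have contL: "continuous_map (mtop MH) euclidean (\<lambda>k. G.Ad (\<Phi> t h) (c t k))"
      using continuous_map_compose[OF cont[OF t], of euclidean "G.Ad (\<Phi> t h)"]
        bounded_linear.continuous_on[OF bl continuous_on_id] by (simp add: o_def)
    have contS: "continuous_map (mtop MH) euclidean (\<lambda>k. c t h + G.Ad (\<Phi> t h) (c t k))"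
      by (intro continuous_map_add contL) simp
    have "\<xi> t = H.mean (\<lambda>k. c t (h \<otimes>\<^bsub>H\<^esub> k))"
      unfolding \<xi>_def by (rule H.mean_left_translate[OF cont[OF t] h, symmetric])
    also have "\<dots> = H.mean (\<lambda>k. c t h + G.Ad (\<Phi> t h) (c t k))"
      by (rule H.mean_cong[OF contS]) (use cocycle[OF t h] in simp)
    also have "\<dots> = c t h + H.mean (\<lambda>k. G.Ad (\<Phi> t h) (c t k))"
      using H.mean_add[OF _ contL, of "\<lambda>_. c t h"] by (simp add: H.mean_const)
    also have "\<dots> = c t h + G.Ad (\<Phi> t h) (\<xi> t)"
      unfolding \<xi>_def by (simp only: H.mean_bounded_linear[OF bl cont[OF t]])
    finally show ?thesis by simp
  qed
  obtain g where g: "plot I MG g" "g 0 = \<one>\<^bsub>G\<^esub>" "\<And>t. t \<in> I \<Longrightarrow> G.dlog g t = \<xi> t"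
    using G.global_primitive[OF I \<xi>] by blast
  have conj: "\<Phi> t h = g t \<otimes>\<^bsub>G\<^esub> \<phi> h \<otimes>\<^bsub>G\<^esub> inv\<^bsub>G\<^esub> (g t)" if t: "t \<in> I" and h: "h \<in> carrier H" for t h
  proof -
    have gt: "g t \<in> carrier G" "\<Phi> t h \<in> carrier G"
      by (rule G.plot_in_carrier[OF g(1) t], rule G.plot_in_carrier[OF curve[OF h] t])
    have \<phi>h: "\<phi> h \<in> carrier G"
      using G.plot_in_carrier[OF curve[OF h] I(3)] \<Phi>0[OF h] by simp
    have "\<Phi> t h \<otimes>\<^bsub>G\<^esub> g t = g t \<otimes>\<^bsub>G\<^esub> \<phi> h"
    proof (rule G.dlog_unique[where J = I and ?t0.0 = 0])
      show "plot I MG (\<lambda>s. \<Phi> s h \<otimes>\<^bsub>G\<^esub> g s)"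
        by (rule G.plot_mult[OF curve[OF h] g(1)])
      show "plot I MG (\<lambda>s. g s \<otimes>\<^bsub>G\<^esub> \<phi> h)"
        by (rule G.plot_right_translate[OF g(1) \<phi>h])
      show "G.dlog (\<lambda>s. \<Phi> s h \<otimes>\<^bsub>G\<^esub> g s) s = G.dlog (\<lambda>s. g s \<otimes>\<^bsub>G\<^esub> \<phi> h) s" if s: "s \<in> I" for s
        using G.dlog_mult[OF curve[OF h] g(1) s] G.dlog_mult_const[OF g(1) \<phi>h s] g(3)[OF s]
          coboundary[OF s h] by (simp add: c_def)
      show "\<Phi> 0 h \<otimes>\<^bsub>G\<^esub> g 0 = g 0 \<otimes>\<^bsub>G\<^esub> \<phi> h"
        using \<phi>h by (simp add: g(2) \<Phi>0[OF h])
    qed (use I t in auto)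
    then have "g t \<otimes>\<^bsub>G\<^esub> \<phi> h \<otimes>\<^bsub>G\<^esub> inv\<^bsub>G\<^esub> (g t) = \<Phi> t h \<otimes>\<^bsub>G\<^esub> g t \<otimes>\<^bsub>G\<^esub> inv\<^bsub>G\<^esub> (g t)"
      by simp
    also have "\<dots> = \<Phi> t h" using gt by (simp add: G.m_assoc)
    finally show ?thesis by simp
  qed
  have "smooth_map (open_submanifold I) MG g"
    using plot_iff_smooth_map[OF G.charted_M I(1)] g(1) by blast
  then show ?thesis
    unfolding trivial_deformation_def using g(2) conj by blast
qed

end
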